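(* Let $\theta\in\mathbb{R}\setminus\mathbb{Q}$ and let $F(z,w)=(z+\cdots,\,e^{2\pi i\theta}w+\cdots)$ be a quasi-parabolic germ of holomorphic diffeomorphism of $\mathbb{C}^2$ at $0$ which is dynamically separating and which is formally conjugate to $$\hat F(z,w)=\Big(z+\sum_{j=\nu}^\infty a_jz^j,\; e^{2\pi i\theta}w+\sum_{j=\mu}^\infty b_jz^jw\Big),$$ where $\nu=\nu(F)$ and $a_\nu\neq0$. If $$\mathrm{Re}\left(\frac{b_{\nu-1}}{e^{2\pi i\theta}a_\nu}\right)>0,$$ then there exist $\nu(F)-1$ disjoint connected basins of attraction for $F$ at $0$.
   Context: A germ of holomorphic diffeomorphism of $\mathbb{C}^2$ at $0$ of the form $F(z,w)=(z+\cdots,e^{2\pi i\theta}w+\cdots)$, with $\theta\in\mathbb{R}$ and dots denoting terms of order at least $2$, is called quasi-parabolic. When $\theta$ is irrational, $F$ is formally conjugate (by a formal power series change of coordinates fixing $0$ with invertible linear part) to a map $\hat F$ of the form $$\hat F(z,w)=\Big(z+\sum_{j=\nu}^\infty a_jz^j,\; e^{2\pi i\theta}w+\sum_{j=\mu}^\infty b_jz^jw\Big),$$ with $\nu\ge2$, $\mu\ge1$, where either $a_\nu\neq0$ or, if all $a_j=0$, $\nu=\infty$; similarly either $b_\mu\neq0$ or, if all $b_j=0$, $\mu=\infty$. The coefficients $b_j$ with $j<\mu$ are understood to be $0$. The number $\nu(F):=\nu$ is a formal invariant of $F$, and if $\nu<+\infty$ the sign of $\Theta(F):=\nu-\mu-1$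 is a formal invariant. $F$ is dynamically separating if $\nu<+\infty$ and $\Theta(F)\le0$. Basin of attraction: a basin of attraction for $F$ at $0$ is a nonempty open set $U\subset\mathbb{C}^2$ with $0\in\overline U$ for which there exists a neighborhood basis $\{\Omega_i\}$ of $0$ such that $F(U\cap\Omega_i)\subset U\cap\Omega_i$ for all $i$, and the iterates satisfy $F^{\circ p}(z)\to0$ as $p\to\infty$ whenever $z\in U\cap\Omega_i$ for some $i$. *)

theory Defs
  imports "HOL-Analysis.Analysis" "HOL-Computational_Algebra.Formal_Power_Series"
begin

type_synonym C2 = "complex \<times> complex"

subsection \<open>Germs of holomorphic diffeomorphisms of the plane\<close>

definition holomorphic2_on :: "(C2 \<Rightarrow> C2) \<Rightarrow> C2 set \<Rightarrow> bool" where
  "holomorphic2_on F W \<longleftrightarrow>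
     (\<forall>x\<in>W. \<exists>D. (F has_derivative D) (at x) \<and>
        (\<forall>c z w. D (c * z, c * w) = (c * fst (D (z, w)), c * snd (D (z, w)))))"

text \<open>A germ at the origin is given by a representative \<open>F\<close> together with an open neighbourhood
  \<open>W\<close> of the origin on which it is defined; the values of \<open>F\<close> outside \<open>W\<close> are never used.\<close>

definition holomorphic_diffeo_germ :: "C2 set \<Rightarrow> (C2 \<Rightarrow> C2) \<Rightarrow> bool" where
  "holomorphic_diffeo_germ W F \<longleftrightarrow>
     open W \<and> 0 \<in> W \<and> F 0 = 0 \<and> holomorphic2_on F W \<and>
     (\<exists>V\<subseteq>W. open V \<and> 0 \<in> V \<and> inj_on F V \<and> open (F ` V) \<and>
        holomorphic2_on (inv_into V F) (F ` V))"

definition multiplier :: "real \<Rightarrow> complex" where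
  "multiplier \<theta> = exp (2 * complex_of_real pi * \<i> * complex_of_real \<theta>)"

definition quasi_parabolic :: "real \<Rightarrow> C2 set \<Rightarrow> (C2 \<Rightarrow> C2) \<Rightarrow> bool" where
  "quasi_parabolic \<theta> W F \<longleftrightarrow>
     holomorphic_diffeo_germ W F \<and>
     (F has_derivative (\<lambda>(z, w). (z, multiplier \<theta> * w))) (at 0)"

subsection \<open>Formal maps of the plane\<close>

text \<open>An element \<open>f\<close> of \<^typ>\<open>complex fps fps\<close> is a formal power series in \<open>z\<close> (outer variable) and
  \<open>w\<close> (inner variable).\<close>

type_synonym fmap2 = "complex fps fps \<times> complex fps fps"

text \<open>The coefficient at \<open>z^i w^j\<close>.\<close>

abbreviation coeff2 :: "complex fps fps \<Rightarrow> nat \<Rightarrow> nat \<Rightarrow> complex" where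
  "coeff2 f i j \<equiv> fps_nth (fps_nth f i) j"

abbreviation fz :: "complex fps fps" where "fz \<equiv> fps_X"
abbreviation fw :: "complex fps fps" where "fw \<equiv> fps_const fps_X"

text \<open>Substitution of a formal map \<open>G\<close> without constant term. As every monomial of
  \<open>(fst G)^k * (snd G)^l\<close> has total degree at least \<open>k + l\<close>, only the finitely many terms below
  contribute to the coefficient at \<open>z^i w^j\<close>.\<close>

definition fsubst :: "complex fps fps \<Rightarrow> fmap2 \<Rightarrow> complex fps fps" where
  "fsubst f G = Abs_fps (\<lambda>i. Abs_fps (\<lambda>j.
     \<Sum>(k, l) \<in> {(k, l). k + l \<le> i + j}. coeff2 f k l * coeff2 (fst G ^ k * snd G ^ l) i j))"

definition fcomp :: "fmap2 \<Rightarrow> fmap2 \<Rightarrow> fmap2" where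
  "fcomp P G = (fsubst (fst P) G, fsubst (snd P) G)"

definition formal_coordinate_change :: "fmap2 \<Rightarrow> bool" where
  "formal_coordinate_change P \<longleftrightarrow>
     coeff2 (fst P) 0 0 = 0 \<and> coeff2 (snd P) 0 0 = 0 \<and>
     coeff2 (fst P) 1 0 * coeff2 (snd P) 0 1 - coeff2 (fst P) 0 1 * coeff2 (snd P) 1 0 \<noteq> 0"

definition formally_conjugate :: "fmap2 \<Rightarrow> fmap2 \<Rightarrow> bool" where
  "formally_conjugate P Q \<longleftrightarrow>
     (\<exists>\<Phi>. formal_coordinate_change \<Phi> \<and> fcomp P \<Phi> = fcomp \<Phi> Q)"

definition taylor2 :: "(C2 \<Rightarrow> complex) \<Rightarrow> complex fps fps" where
  "taylor2 f = Abs_fps (\<lambda>i. Abs_fps (\<lambda>j.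
     (deriv ^^ i) (\<lambda>z. (deriv ^^ j) (\<lambda>w. f (z, w)) 0) 0 / (fact i * fact j)))"

definition taylor_map :: "(C2 \<Rightarrow> C2) \<Rightarrow> fmap2" where
  "taylor_map F = (taylor2 (fst \<circ> F), taylor2 (snd \<circ> F))"

subsection \<open>Formal normal forms\<close>

definition normal_form :: "real \<Rightarrow> (nat \<Rightarrow> complex) \<Rightarrow> (nat \<Rightarrow> complex) \<Rightarrow> fmap2" where
  "normal_form \<theta> a b =
     (fz + Abs_fps (\<lambda>j. fps_const (a j)),
      fps_const (fps_const (multiplier \<theta>)) * fw + Abs_fps (\<lambda>j. fps_const (b j)) * fw)"

text \<open>The coefficients \<open>a j\<close> with \<open>j < \<nu>\<close> and \<open>b j\<close> with \<open>j < \<mu>\<close>, which do not occur in a normal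
  form, are set to zero. Thus \<open>\<nu>\<close> and \<open>\<mu>\<close> are the orders of the two sequences (infinite for the
  zero sequence), and the first two conditions say that \<open>\<nu> \<ge> 2\<close> and \<open>\<mu> \<ge> 1\<close>.\<close>

definition has_normal_form ::
  "real \<Rightarrow> (C2 \<Rightarrow> C2) \<Rightarrow> (nat \<Rightarrow> complex) \<Rightarrow> (nat \<Rightarrow> complex) \<Rightarrow> bool" where
  "has_normal_form \<theta> F a b \<longleftrightarrow>
     (\<forall>j<2. a j = 0) \<and> (\<forall>j<1. b j = 0) \<and>
     formally_conjugate (taylor_map F) (normal_form \<theta> a b)"

definition coeff_order :: "(nat \<Rightarrow> complex) \<Rightarrow> enat" where
  "coeff_order c = (INF j\<in>{j. c j \<noteq> 0}. enat j)"

definition Theta :: "(nat \<Rightarrow> complex) \<Rightarrow> (nat \<Rightarrow> complex) \<Rightarrow> ereal" where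
  "Theta a b = ereal_of_enat (coeff_order a) - ereal_of_enat (coeff_order b) - 1"

text \<open>The order \<open>\<nu>\<close> and, if it is finite, the sign of \<open>\<Theta>\<close> do not depend on the normal form of \<open>F\<close>,
  so it does not matter which one is used.\<close>

definition dynamically_separating :: "real \<Rightarrow> (C2 \<Rightarrow> C2) \<Rightarrow> bool" where
  "dynamically_separating \<theta> F \<longleftrightarrow>
     (\<exists>a b. has_normal_form \<theta> F a b \<and> coeff_order a < \<infinity> \<and> Theta a b \<le> 0)"

subsection \<open>Basins of attraction\<close>

definition neighbourhood_basis_0 :: "C2 set set \<Rightarrow> bool" where
  "neighbourhood_basis_0 B \<longleftrightarrow>
     (\<forall>\<Omega>\<in>B. 0 \<in> interior \<Omega>) \<and> (\<forall>V. open V \<and> 0 \<in> V \<longrightarrow> (\<exists>\<Omega>\<in>B. \<Omega> \<subseteq> V))"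

text \<open>The requirement \<open>\<Omega> \<subseteq> W\<close> makes \<open>F\<close> and all its iterates defined on \<open>U \<inter> \<Omega>\<close>.\<close>

definition basin_of_attraction :: "C2 set \<Rightarrow> (C2 \<Rightarrow> C2) \<Rightarrow> C2 set \<Rightarrow> bool" where
  "basin_of_attraction W F U \<longleftrightarrow>
     U \<noteq> {} \<and> open U \<and> 0 \<in> closure U \<and>
     (\<exists>B. neighbourhood_basis_0 B \<and>
        (\<forall>\<Omega>\<in>B. \<Omega> \<subseteq> W \<and> F ` (U \<inter> \<Omega>) \<subseteq> U \<inter> \<Omega> \<and>
           (\<forall>x\<in>U \<inter> \<Omega>. (\<lambda>p. (F ^^ p) x) \<longlonglongrightarrow> 0)))"

end

theory Submission
  imports Defs "HOL-Complex_Analysis.Complex_Analysis"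
begin

text \<open>Truncating the formal conjugacy at a high order \<open>N\<close> yields a polynomial local homeomorphism
  \<open>\<phi>\<close>, bi-Lipschitz at the origin, which conjugates \<open>F\<close> to \<open>Q + O(|x|^(N+1))\<close>, where \<open>Q\<close> is the
  truncated normal form. Put \<open>d = \<nu> - 1\<close>. For each of the \<open>d\<close> roots of
  \<open>\<gamma>^d = - 1 / (d * a \<nu>)\<close> use coordinates \<open>z = \<gamma> v^(- 1 / d)\<close>, \<open>w = t |v|^(- \<sigma>)\<close> with \<open>|t| < 1\<close>.
  There \<open>F\<close> acts by \<open>v \<mapsto> v + 1 + o(1)\<close> and multiplies \<open>w\<close> by a factor of modulus
  \<open>1 - Re (\<beta> / v) + o(1 / |v|)\<close> with \<open>\<beta> = b d / (d * e^(2 \<pi> i \<theta>) * a \<nu>)\<close>. Since \<open>Re \<beta> > 0\<close>, in a narrow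
  cone around the positive \<open>v\<close>-axis \<open>w\<close> decays faster than \<open>|v|^(- \<sigma>)\<close> for small \<open>\<sigma> > 0\<close>, and for
  \<open>N\<close> large the error term is negligible, so the region is invariant.

  The expansion of the multiplier of \<open>w\<close> requires \<open>b j = 0\<close> for \<open>j < d\<close>. The separating hypothesis
  may refer to another normal form, so this property has to be transferred between two normal
  forms of the same germ.\<close>

section \<open>Jets of maps of the plane\<close>

text \<open>For \<open>z' = z + a z^(d+1) + ...\<close> and \<open>v = (\<gamma> / z)^d\<close> one
  finds \<open>v' = v - d a \<gamma>^d + ...\<close>, which dictates the equation for
  \<open>\<gamma>\<close>. It also gives \<open>z^d = - 1 / (d a v)\<close>, so \<open>b z^d\<close>
  divided by the multiplier becomes \<open>- \<beta> / v\<close>. A nonzero \<open>b j\<close> with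
  \<open>j < d\<close> would add a term of size \<open>|v|^(- j / d)\<close>, which could swamp the
  contraction of order \<open>1 / |v|\<close>. The formal conjugacy need not converge. Formal
  identities therefore become estimates O(|x|^n) between truncations, and a lower Lipschitz bound
  takes the place of the inverse coordinate change. The choice
  \<open>\<sigma> = Re \<beta> / 4\<close> balances two rates: in the cone \<open>w\<close> loses at
  least the fraction \<open>3/5 * Re \<beta> / |v|\<close> up to lower order, while the bound
  \<open>|v|^(- \<sigma>)\<close> loses at most \<open>2 * \<sigma> / |v|\<close>, that is
  \<open>1/2 * Re \<beta> / |v|\<close>. The sector coordinates involve \<open>|v|\<close> and are
  merely continuous, so openness of the basins comes from invariance of domain.\<close>

definition vanishes :: "nat \<Rightarrow> ('a::real_normed_vector \<Rightarrow> 'b::real_normed_vector) \<Rightarrow> bool" where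
  "vanishes n g \<longleftrightarrow> (\<exists>C. \<forall>\<^sub>F x in nhds 0. norm (g x) \<le> C * norm x ^ n)"

lemma vanishesI: "(\<forall>\<^sub>F x in nhds 0. norm (g x) \<le> C * norm x ^ n) \<Longrightarrow> vanishes n g"
  unfolding vanishes_def by blast

lemma vanishesE:
  assumes "vanishes n g"
  obtains C where "C > 0" "\<forall>\<^sub>F x in nhds 0. norm (g x) \<le> C * norm x ^ n"
proof -
  obtain C where C: "\<forall>\<^sub>F x in nhds 0. norm (g x) \<le> C * norm x ^ n"
    using assms unfolding vanishes_def by blast
  have "\<forall>\<^sub>F x in nhds 0. norm (g x) \<le> (\<bar>C\<bar> + 1) * norm x ^ n"
    using C by eventually_elim (erule order_trans, intro mult_right_mono, auto)
  then show thesis by (intro that[of "\<bar>C\<bar> + 1"]) auto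
qed

lemma eventually_nhds_0_ball:
  "eventually P (nhds (0::'a::real_normed_vector)) \<longleftrightarrow> (\<exists>d>0. \<forall>x. norm x < d \<longrightarrow> P x)"
  by (simp add: eventually_nhds_metric)

lemma vanishes_zero [simp]: "vanishes n (\<lambda>x. 0)"
  by (rule vanishesI[of _ 0]) simp

lemma vanishes_add:
  assumes "vanishes n f" "vanishes n g"
  shows "vanishes n (\<lambda>x. f x + g x)"
proof -
  obtain C where "\<forall>\<^sub>F x in nhds 0. norm (f x) \<le> C * norm x ^ n" using assms(1) by (rule vanishesE)
  moreover obtain D where "\<forall>\<^sub>F x in nhds 0. norm (g x) \<le> D * norm x ^ n" using assms(2) by (rule vanishesE)
  ultimately have "\<forall>\<^sub>F x in nhds 0. norm (f x + g x) \<le> (C + D) * norm x ^ n"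
    by eventually_elim (auto simp: distrib_right intro: norm_triangle_le)
  then show ?thesis by (rule vanishesI)
qed

lemma vanishes_uminus: "vanishes n f \<Longrightarrow> vanishes n (\<lambda>x. - f x)"
  by (simp add: vanishes_def)

lemma vanishes_diff: "vanishes n f \<Longrightarrow> vanishes n g \<Longrightarrow> vanishes n (\<lambda>x. f x - g x)"
  using vanishes_add[of n f "\<lambda>x. - g x"] vanishes_uminus[of n g] by simp

lemma vanishes_sum: "(\<And>i. i \<in> I \<Longrightarrow> vanishes n (f i)) \<Longrightarrow> vanishes n (\<lambda>x. \<Sum>i\<in>I. f i x)"
  by (induction I rule: infinite_finite_induct) (auto intro: vanishes_add)

lemma vanishes_mult:
  fixes f g :: "'a::real_normed_vector \<Rightarrow> 'b::real_normed_algebra"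
  assumes "vanishes m f" "vanishes n g"
  shows "vanishes (m + n) (\<lambda>x. f x * g x)"
proof -
  obtain C where C: "C > 0" "\<forall>\<^sub>F x in nhds 0. norm (f x) \<le> C * norm x ^ m" using assms(1) by (rule vanishesE)
  obtain D where D: "D > 0" "\<forall>\<^sub>F x in nhds 0. norm (g x) \<le> D * norm x ^ n" using assms(2) by (rule vanishesE)
  have "\<forall>\<^sub>F x in nhds 0. norm (f x * g x) \<le> (C * D) * norm x ^ (m + n)"
    using C(2) D(2)
  proof eventually_elim
    case (elim x)
    have "norm (f x * g x) \<le> norm (f x) * norm (g x)" by (rule norm_mult_ineq)
    also have "\<dots> \<le> (C * norm x ^ m) * (D * norm x ^ n)"
      using elim C(1) D(1) by (intro mult_mono) auto
    finally show ?case by (simp add: power_add mult_ac)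
  qed
  then show ?thesis by (rule vanishesI)
qed

lemma vanishes_mono:
  assumes "vanishes m f" "n \<le> m"
  shows "vanishes n f"
proof -
  obtain C where C: "C > 0" "\<forall>\<^sub>F x in nhds 0. norm (f x) \<le> C * norm x ^ m" using assms(1) by (rule vanishesE)
  have "\<forall>\<^sub>F x::'a in nhds 0. norm x < 1"
    unfolding eventually_nhds_0_ball by (rule exI[of _ 1]) simp
  with C(2) have "\<forall>\<^sub>F x in nhds 0. norm (f x) \<le> C * norm x ^ n"
  proof eventually_elim
    case (elim x)
    have "norm x ^ m \<le> norm x ^ n" using elim assms(2) by (intro power_decreasing) auto
    with elim C(1) show ?case by (meson mult_left_mono order_trans less_imp_le)
  qed
  then show ?thesis by (rule vanishesI)
qed

lemma vanishes_bounded_mult: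
  fixes f g :: "'a::real_normed_vector \<Rightarrow> 'b::real_normed_algebra"
  shows "vanishes 0 f \<Longrightarrow> vanishes n g \<Longrightarrow> vanishes n (\<lambda>x. f x * g x)"
  using vanishes_mult[of 0 f n g] by simp

lemma vanishes_const: "vanishes 0 (\<lambda>x. c)"
  by (rule vanishesI[of _ "norm c"]) simp

lemma vanishes_cmult:
  fixes c :: "'b::real_normed_algebra"
  shows "vanishes n f \<Longrightarrow> vanishes n (\<lambda>x. c * f x)"
  by (rule vanishes_bounded_mult[OF vanishes_const])

lemma vanishes_power:
  fixes f :: "'a::real_normed_vector \<Rightarrow> 'b::real_normed_algebra_1"
  shows "vanishes 1 f \<Longrightarrow> vanishes n (\<lambda>x. f x ^ n)"
proof (induction n)
  case 0 then show ?case by (simp add: vanishes_const)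
next
  case (Suc n) then show ?case using vanishes_mult[of 1 f n "\<lambda>x. f x ^ n"] by simp
qed

lemma vanishes_tendsto:
  assumes "vanishes (Suc n) f"
  shows "(f \<longlongrightarrow> 0) (nhds 0)"
proof -
  have "vanishes 1 f" using assms by (rule vanishes_mono) simp
  then obtain C where C: "\<forall>\<^sub>F x in nhds 0. norm (f x) \<le> C * norm x"
    by (auto elim: vanishesE)
  have "((\<lambda>x::'a. C * norm x) \<longlongrightarrow> C * norm (0::'a)) (nhds 0)"
    by (intro tendsto_intros) (simp add: filterlim_ident)
  then show ?thesis using C by (intro Lim_null_comparison[OF C]) simp
qed

lemma vanishes_compose:
  assumes "vanishes n g" "vanishes 1 f"
  shows "vanishes n (\<lambda>x. g (f x))"
proof -
  obtain C where C: "C > 0" "\<forall>\<^sub>F x in nhds 0. norm (g x) \<le> C * norm x ^ n" using assms(1) by (rule vanishesE)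
  obtain D where D: "D > 0" "\<forall>\<^sub>F x in nhds 0. norm (f x) \<le> D * norm x" using assms(2) by (auto elim: vanishesE)
  have "filterlim f (nhds 0) (nhds 0)" using vanishes_tendsto[of 0 f] assms(2) by simp
  then have "\<forall>\<^sub>F x in nhds 0. norm (g (f x)) \<le> C * norm (f x) ^ n"
    using C(2) by (rule eventually_compose_filterlim[rotated])
  with D(2) have "\<forall>\<^sub>F x in nhds 0. norm (g (f x)) \<le> (C * D ^ n) * norm x ^ n"
  proof eventually_elim
    case (elim x)
    have "norm (f x) ^ n \<le> (D * norm x) ^ n" using elim by (intro power_mono) auto
    then have "C * norm (f x) ^ n \<le> C * (D * norm x) ^ n" using C(1) by simp
    then show ?case using elim by (simp add: power_mult_distrib mult_ac)
  qed
  then show ?thesis by (rule vanishesI)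
qed

lemma vanishes_le:
  assumes "vanishes n f" "\<forall>\<^sub>F x in nhds 0. norm (g x) \<le> K * norm (f x)" "K \<ge> 0"
  shows "vanishes n g"
proof -
  obtain C where C: "C > 0" "\<forall>\<^sub>F x in nhds 0. norm (f x) \<le> C * norm x ^ n" using assms(1) by (rule vanishesE)
  have "\<forall>\<^sub>F x in nhds 0. norm (g x) \<le> (K * C) * norm x ^ n"
    using C(2) assms(2)
  proof eventually_elim
    case (elim x)
    have "K * norm (f x) \<le> K * (C * norm x ^ n)" using elim assms(3) by (intro mult_left_mono)
    then show ?case using elim by (simp add: mult_ac)
  qed
  then show ?thesis by (rule vanishesI)
qed

lemma vanishes_Pair:
  assumes "vanishes n f" "vanishes n g"
  shows "vanishes n (\<lambda>x. (f x, g x))"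
proof -
  obtain C where "\<forall>\<^sub>F x in nhds 0. norm (f x) \<le> C * norm x ^ n" using assms(1) by (rule vanishesE)
  moreover obtain D where "\<forall>\<^sub>F x in nhds 0. norm (g x) \<le> D * norm x ^ n" using assms(2) by (rule vanishesE)
  ultimately have "\<forall>\<^sub>F x in nhds 0. norm (f x, g x) \<le> (C + D) * norm x ^ n"
    by eventually_elim (simp add: distrib_right, meson norm_Pair_le add_mono order_trans)
  then show ?thesis by (rule vanishesI)
qed

lemma norm_fst_le_norm: "norm (fst x) \<le> norm x" and norm_snd_le_norm: "norm (snd x) \<le> norm x"
  for x :: "'a::real_normed_vector \<times> 'b::real_normed_vector"
  using norm_fst_le[of "fst x" "snd x"] norm_snd_le[of "snd x" "fst x"] by simp_all

lemma vanishes_prod_iff: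
  "vanishes n f \<longleftrightarrow> vanishes n (\<lambda>x. fst (f x)) \<and> vanishes n (\<lambda>x. snd (f x))"
proof safe
  assume "vanishes n f"
  then show "vanishes n (\<lambda>x. fst (f x))" "vanishes n (\<lambda>x. snd (f x))"
    by (auto elim!: vanishes_le[where K = 1] intro!: always_eventually norm_fst_le_norm norm_snd_le_norm)
next
  assume "vanishes n (\<lambda>x. fst (f x))" "vanishes n (\<lambda>x. snd (f x))"
  then show "vanishes n f" using vanishes_Pair by fastforce
qed

lemma vanishes_fst: "vanishes 1 (fst :: 'a::real_normed_vector \<times> 'b::real_normed_vector \<Rightarrow> 'a)"
  and vanishes_snd: "vanishes 1 (snd :: 'a::real_normed_vector \<times> 'b::real_normed_vector \<Rightarrow> 'b)"
  by (auto intro!: vanishesI[of _ 1] always_eventually simp: norm_fst_le norm_snd_le)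

lemma vanishes_monomial:
  "vanishes (i + j) (\<lambda>x::complex \<times> complex. fst x ^ i * snd x ^ j)"
  by (intro vanishes_mult vanishes_power vanishes_fst vanishes_snd)

section \<open>Truncated formal series and their products and substitutions\<close>

definition triangle :: "nat \<Rightarrow> (nat \<times> nat) set" where
  "triangle N = {(k, l). k + l \<le> N}"

lemma finite_triangle [simp]: "finite (triangle N)"
  by (rule finite_subset[of _ "{..N} \<times> {..N}"]) (auto simp: triangle_def)

definition ev :: "nat \<Rightarrow> complex fps fps \<Rightarrow> C2 \<Rightarrow> complex" where
  "ev N f x = (\<Sum>(i, j)\<in>triangle N. coeff2 f i j * (fst x ^ i * snd x ^ j))"

definition evm :: "nat \<Rightarrow> fmap2 \<Rightarrow> C2 \<Rightarrow> C2" where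
  "evm N G x = (ev N (fst G) x, ev N (snd G) x)"

text \<open>Equality of \<open>N\<close>-jets is phrased as an estimate, so that a possibly
  divergent series is compared with a function only through a polynomial.\<close>

definition jet :: "nat \<Rightarrow> (C2 \<Rightarrow> complex) \<Rightarrow> complex fps fps \<Rightarrow> bool" where
  "jet N g f \<longleftrightarrow> vanishes (Suc N) (\<lambda>x. g x - ev N f x)"

lemma jet_ev: "jet N (ev N f) f"
  by (simp add: jet_def)

lemma bounded_ev: "vanishes 0 (ev N f)"
  unfolding ev_def case_prod_unfold
  by (intro vanishes_sum vanishes_cmult vanishes_mono[OF vanishes_monomial]) simp

lemma jet_imp_bounded:
  assumes "jet N g f" shows "vanishes 0 g"
proof -
  have "vanishes 0 (\<lambda>x. (g x - ev N f x) + ev N f x)"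
    using assms by (intro vanishes_add bounded_ev) (auto simp: jet_def intro: vanishes_mono)
  then show ?thesis by simp
qed

lemma coeff2_mult:
  "coeff2 (f * g) p q = (\<Sum>i\<le>p. \<Sum>j\<le>q. coeff2 f i j * coeff2 g (p - i) (q - j))"
  by (simp add: fps_mult_nth fps_sum_nth atMost_atLeast0)

text \<open>Among all pairs of monomials from the two truncations, those of total degree at most
  \<open>N\<close> (the set \<open>S\<close>) give exactly the truncated Cauchy product. Every other
  pair has degree above \<open>N\<close>.\<close>

lemma ev_mult: "vanishes (Suc N) (\<lambda>x. ev N f x * ev N g x - ev N (f * g) x)"
proof -
  define m where "m = (\<lambda>((i,j),(k,l)). \<lambda>x::C2. (coeff2 f i j * coeff2 g k l) * (fst x ^ (i+k) * snd x ^ (j+l)))"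
  define S where "S = {((i,j),(k,l)). i+j+k+l \<le> N}"
  have S: "S \<subseteq> triangle N \<times> triangle N" by (auto simp: S_def triangle_def)
  have finS: "finite S" by (rule finite_subset[OF S]) simp
  have prod: "ev N f x * ev N g x = (\<Sum>a\<in>triangle N \<times> triangle N. m a x)" for x
    unfolding ev_def sum_product sum.cartesian_product
    by (intro sum.cong) (auto simp: m_def power_add mult_ac)
  have "ev N (f * g) x = (\<Sum>a\<in>S. m a x)" for x
  proof -
    have "ev N (f * g) x = (\<Sum>(p,q)\<in>triangle N. \<Sum>(i,j)\<in>{..p}\<times>{..q}. m ((i,j),(p-i,q-j)) x)"
      unfolding ev_def coeff2_mult
      by (intro sum.cong) (auto simp: m_def sum_distrib_right sum.cartesian_product case_prod_unfold intro!: sum.cong)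
    also have "\<dots> = (\<Sum>(pq,ij)\<in>(SIGMA pq:triangle N. {..fst pq}\<times>{..snd pq}). m (ij,(fst pq - fst ij,snd pq - snd ij)) x)"
      by (subst sum.Sigma[symmetric]) (auto simp: case_prod_unfold)
    also have "\<dots> = (\<Sum>a\<in>S. m a x)"
      by (rule sum.reindex_bij_witness[of _
            "\<lambda>((i,j),(k,l)). ((i+k,j+l),(i,j))" "\<lambda>((p,q),(i,j)). ((i,j),(p-i,q-j))"])
         (auto simp: S_def triangle_def)
    finally show ?thesis .
  qed
  then have "ev N f x * ev N g x - ev N (f * g) x = (\<Sum>a\<in>triangle N \<times> triangle N - S. m a x)" for x
    using prod[of x] S by (simp add: sum_diff)
  moreover have "vanishes (Suc N) (\<lambda>x. \<Sum>a\<in>triangle N \<times> triangle N - S. m a x)"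
  proof (rule vanishes_sum)
    fix a assume "a \<in> triangle N \<times> triangle N - S"
    then obtain i j k l where a: "a = ((i,j),(k,l))" "i+j+k+l > N" by (auto simp: S_def)
    show "vanishes (Suc N) (m a)"
      unfolding m_def a prod.case using a(2)
      by (intro vanishes_cmult vanishes_mono[OF vanishes_monomial]) simp
  qed
  ultimately show ?thesis by simp
qed

lemma jet_mult:
  assumes "jet N g1 f1" "jet N g2 f2"
  shows "jet N (\<lambda>x. g1 x * g2 x) (f1 * f2)"
proof -
  have "vanishes (Suc N) (\<lambda>x. g2 x * (g1 x - ev N f1 x) + ev N f1 x * (g2 x - ev N f2 x)
      + (ev N f1 x * ev N f2 x - ev N (f1 * f2) x))"
    using assms by (intro vanishes_add ev_mult vanishes_bounded_mult[of _ "Suc N"] bounded_ev)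
      (auto simp: jet_def[symmetric] intro: jet_imp_bounded)
  then show ?thesis unfolding jet_def by (simp add: algebra_simps)
qed

lemma ev_1: "ev N 1 x = 1"
proof -
  have "ev N 1 x = (\<Sum>a\<in>triangle N. if a = (0,0) then 1 else 0)"
    unfolding ev_def
  proof (intro sum.cong refl)
    fix a :: "nat \<times> nat"
    show "(case a of (i, j) \<Rightarrow> coeff2 1 i j * (fst x ^ i * snd x ^ j)) = (if a = (0, 0) then 1 else 0)"
      by (cases a; cases "fst a = 0"; cases "snd a = 0") simp_all
  qed
  also have "\<dots> = 1" using finite_triangle[of N] by (subst sum.delta) (auto simp: triangle_def)
  finally show ?thesis .
qed

lemma jet_power: "jet N g f \<Longrightarrow> jet N (\<lambda>x. g x ^ n) (f ^ n)"
proof (induction n)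
  case 0 then show ?case by (simp add: jet_def ev_1)
next
  case (Suc n) then show ?case using jet_mult[of N g f "\<lambda>x. g x ^ n" "f ^ n"] by simp
qed

definition order_at_least :: "nat \<Rightarrow> complex fps fps \<Rightarrow> bool" where
  "order_at_least n f \<longleftrightarrow> (\<forall>i j. i + j < n \<longrightarrow> coeff2 f i j = 0)"

lemma order_at_least_mult:
  assumes "order_at_least m f" "order_at_least n g" shows "order_at_least (m + n) (f * g)"
  unfolding order_at_least_def
proof (intro allI impI)
  fix p q :: nat assume pq: "p + q < m + n"
  have "coeff2 f i j * coeff2 g (p - i) (q - j) = 0" if "i \<le> p" "j \<le> q" for i j
  proof (cases "i + j < m")
    case True then show ?thesis using assms(1) by (simp add: order_at_least_def)
  next
    case False
    then have "(p - i) + (q - j) < n" using pq that by linarith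
    then show ?thesis using assms(2) by (simp add: order_at_least_def)
  qed
  then show "coeff2 (f * g) p q = 0" unfolding coeff2_mult by (simp add: sum.neutral)
qed

lemma order_at_least_power: "order_at_least 1 f \<Longrightarrow> order_at_least n (f ^ n)"
proof (induction n)
  case 0 then show ?case by (simp add: order_at_least_def)
next
  case (Suc n) then show ?case using order_at_least_mult[of 1 f n "f ^ n"] by simp
qed

lemma order_at_least_1_iff: "order_at_least 1 f \<longleftrightarrow> coeff2 f 0 0 = 0"
  by (auto simp: order_at_least_def)

lemma vanishes_ev:
  assumes "order_at_least n f" shows "vanishes n (ev N f)"
  unfolding ev_def
proof (rule vanishes_sum)
  fix a assume "a \<in> triangle N"
  obtain i j where a: "a = (i,j)" by force
  show "vanishes n (\<lambda>x. case a of (i, j) \<Rightarrow> coeff2 f i j * (fst x ^ i * snd x ^ j))"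
  proof (cases "i + j < n")
    case True then show ?thesis using assms by (simp add: a order_at_least_def)
  next
    case False then show ?thesis unfolding a prod.case
      by (intro vanishes_cmult vanishes_mono[OF vanishes_monomial]) simp
  qed
qed

lemma jet_imp_vanishes:
  assumes "jet N g f" "order_at_least n f" "n \<le> Suc N"
  shows "vanishes n g"
proof -
  have "vanishes n (\<lambda>x. (g x - ev N f x) + ev N f x)"
    using assms by (intro vanishes_add vanishes_ev) (auto simp: jet_def intro: vanishes_mono)
  then show ?thesis by simp
qed

text \<open>Since \<open>G\<close> has no constant term, indices with \<open>k + l > i + j\<close>
  contribute nothing to the coefficient at \<open>(i, j)\<close>. The index set, which depends on
  \<open>i + j\<close>, may thus be enlarged to the common \<open>triangle N\<close>, and the two
  sums can be swapped.\<close>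

lemma ev_fsubst:
  assumes "order_at_least 1 (fst G)" "order_at_least 1 (snd G)"
  shows "ev N (fsubst f G) x = (\<Sum>(k,l)\<in>triangle N. coeff2 f k l * ev N (fst G ^ k * snd G ^ l) x)"
proof -
  have *: "coeff2 (fsubst f G) i j = (\<Sum>(k,l)\<in>triangle N. coeff2 f k l * coeff2 (fst G ^ k * snd G ^ l) i j)"
    if "(i,j) \<in> triangle N" for i j
  proof -
    have "coeff2 (fsubst f G) i j = (\<Sum>(k,l)\<in>triangle (i + j). coeff2 f k l * coeff2 (fst G ^ k * snd G ^ l) i j)"
      by (simp add: fsubst_def triangle_def)
    also have "\<dots> = (\<Sum>(k,l)\<in>triangle N. coeff2 f k l * coeff2 (fst G ^ k * snd G ^ l) i j)"
    proof (rule sum.mono_neutral_left[OF finite_triangle])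
      show "\<forall>a\<in>triangle N - triangle (i + j). (case a of (k, l) \<Rightarrow> coeff2 f k l * coeff2 (fst G ^ k * snd G ^ l) i j) = 0"
      proof (clarify)
        fix k l assume "(k,l) \<notin> triangle (i + j)"
        then have "i + j < k + l" by (simp add: triangle_def)
        moreover have "order_at_least (k + l) (fst G ^ k * snd G ^ l)"
          using assms by (intro order_at_least_mult order_at_least_power)
        ultimately show "coeff2 f k l * coeff2 (fst G ^ k * snd G ^ l) i j = 0"
          by (simp add: order_at_least_def)
      qed
    qed (use that finite_triangle in \<open>auto simp: triangle_def simp del: finite_triangle\<close>)
    finally show ?thesis .
  qed
  have "ev N (fsubst f G) x = (\<Sum>(i,j)\<in>triangle N. \<Sum>(k,l)\<in>triangle N.
      coeff2 f k l * coeff2 (fst G ^ k * snd G ^ l) i j * (fst x ^ i * snd x ^ j))"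
    unfolding ev_def
    by (rule sum.cong) (auto simp: * sum_distrib_right case_prod_unfold)
  also have "\<dots> = (\<Sum>(k,l)\<in>triangle N. coeff2 f k l * ev N (fst G ^ k * snd G ^ l) x)"
    unfolding ev_def case_prod_unfold sum_distrib_left mult.assoc
    by (rule sum.swap)
  finally show ?thesis .
qed

text \<open>The error splits in two: replacing the outer function by its polynomial, evaluated at an
  argument of size O(|x|), and replacing each product of powers of \<open>g1\<close> and
  \<open>g2\<close> by its own jet.\<close>

lemma jet_subst:
  assumes "jet N g f" "jet N g1 (fst G)" "jet N g2 (snd G)" "order_at_least 1 (fst G)" "order_at_least 1 (snd G)"
  shows "jet N (\<lambda>x. g (g1 x, g2 x)) (fsubst f G)"
proof -
  have v: "vanishes 1 (\<lambda>x. (g1 x, g2 x))"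
    using assms by (intro vanishes_Pair) (auto intro: jet_imp_vanishes)
  have "vanishes (Suc N) (\<lambda>x. g (g1 x, g2 x) - ev N f (g1 x, g2 x))"
    using vanishes_compose[OF _ v, of "Suc N" "\<lambda>x. g x - ev N f x"] assms(1) by (simp add: jet_def)
  moreover have "vanishes (Suc N) (\<lambda>x. \<Sum>(k,l)\<in>triangle N. coeff2 f k l * (g1 x ^ k * g2 x ^ l - ev N (fst G ^ k * snd G ^ l) x))"
    unfolding case_prod_unfold
    by (intro vanishes_sum vanishes_cmult) (use assms in \<open>auto simp: jet_def[symmetric] intro: jet_mult jet_power\<close>)
  moreover have "(\<Sum>(k,l)\<in>triangle N. coeff2 f k l * (g1 x ^ k * g2 x ^ l - ev N (fst G ^ k * snd G ^ l) x))
     = ev N f (g1 x, g2 x) - ev N (fsubst f G) x" for x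
    unfolding ev_fsubst[OF assms(4,5)]
    by (simp add: ev_def[of N f] sum_subtractf[symmetric] right_diff_distrib case_prod_unfold)
  ultimately have "vanishes (Suc N) (\<lambda>x. (g (g1 x, g2 x) - ev N f (g1 x, g2 x)) + (ev N f (g1 x, g2 x) - ev N (fsubst f G) x))"
    by (intro vanishes_add) auto
  then show ?thesis by (simp add: jet_def)
qed

section \<open>Taylor expansion of holomorphic functions of two variables\<close>

text \<open>Cauchy's inequality bounds the tail by a geometric series of ratio
  \<open>norm z / R\<close>, which is at most 1/2; this produces the factor 2. The bound is uniform
  in \<open>f\<close>, as needed when \<open>f\<close> depends on a parameter.\<close>

lemma taylor_remainder_bound:
  fixes f :: "complex \<Rightarrow> complex"
  assumes hol: "f holomorphic_on ball 0 R" and cont: "continuous_on (cball 0 R) f"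
    and bd: "\<And>z. norm z \<le> R \<Longrightarrow> norm (f z) \<le> M"
    and R: "R > 0" and z: "norm z \<le> R / 2"
  shows "norm (f z - (\<Sum>i<n. (deriv ^^ i) f 0 / fact i * z ^ i)) \<le> 2 * M * (norm z / R) ^ n"
proof -
  define c where "c = (\<lambda>i. (deriv ^^ i) f 0 / fact i)"
  have M: "M \<ge> 0" using order_trans[OF norm_ge_zero bd[of 0]] R by simp
  have c: "norm (c i) \<le> M / R ^ i" for i
  proof -
    have "norm ((deriv ^^ i) f 0) \<le> fact i * M / R ^ i"
      using bd R by (intro Cauchy_inequality[OF hol cont]) auto
    then show ?thesis by (simp add: c_def norm_divide field_simps)
  qed
  have zb: "z \<in> ball 0 R" using z R by simp
  have sums: "(\<lambda>i. c i * z ^ i) sums f z"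
    using holomorphic_power_series[OF hol zb] by (simp add: c_def)
  define q where "q = norm z / R"
  have q: "0 \<le> q" "q \<le> 1/2" using z R by (auto simp: q_def field_simps)
  have trm: "norm (c i * z ^ i) \<le> M * q ^ i" for i
  proof -
    have "norm (c i * z ^ i) \<le> (M / R ^ i) * norm z ^ i"
      unfolding norm_mult norm_power using c by (intro mult_right_mono) auto
    then show ?thesis by (simp add: q_def power_divide)
  qed
  have tail: "(\<lambda>i. c (i + n) * z ^ (i + n)) sums (f z - (\<Sum>i<n. c i * z ^ i))"
    using sums by (rule sums_split_initial_segment)
  have geo: "(\<lambda>i. M * q ^ (i + n)) sums (M * q ^ n * (1 / (1 - q)))"
    using sums_mult[OF geometric_sums[of q], of "M * q ^ n"] q by (simp add: power_add mult_ac)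
  have "norm (f z - (\<Sum>i<n. c i * z ^ i)) \<le> M * q ^ n * (1 / (1 - q))"
    using tail geo trm by (intro norm_suminf_le[of _ "\<lambda>i. M * q ^ (i + n)", THEN order_trans, of "\<lambda>i. c (i + n) * z ^ (i + n)", unfolded sums_unique[OF tail, symmetric]])
      (auto simp: sums_iff)
  also have "\<dots> \<le> M * q ^ n * 2"
    using q M by (intro mult_left_mono) (auto simp: field_simps)
  finally show ?thesis by (simp add: c_def q_def mult_ac)
qed

text \<open>By induction on \<open>j\<close>, each Taylor coefficient in the second variable is a locally uniform limit
  of difference quotients that are holomorphic in the first one. This avoids integrals with
  parameters.\<close>

lemma holomorphic_iterated_deriv_snd:
  fixes f :: "complex \<Rightarrow> complex \<Rightarrow> complex"
  assumes R: "R > 0"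
    and h1: "\<And>w. norm w \<le> R \<Longrightarrow> (\<lambda>z. f z w) holomorphic_on ball 0 R"
    and h2: "\<And>z. norm z < R \<Longrightarrow> f z holomorphic_on ball 0 R" "\<And>z. norm z < R \<Longrightarrow> continuous_on (cball 0 R) (f z)"
    and bd: "\<And>z w. norm z < R \<Longrightarrow> norm w \<le> R \<Longrightarrow> norm (f z w) \<le> M"
  shows "(\<lambda>z. (deriv ^^ j) (f z) 0) holomorphic_on ball 0 R"
proof (induction j rule: less_induct)
  case (less j)
  define g where "g = (\<lambda>i z. (deriv ^^ i) (f z) 0 / fact i)"
  define h where "h = (\<lambda>n. of_real (R / (real n + 2)) :: complex)"
  \<comment> \<open>This is the remainder after \<open>j\<close> terms at the node
    \<open>h n\<close>, divided by \<open>h n ^ j\<close>. It involves only coefficients below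
    \<open>j\<close>, hence is holomorphic in \<open>z\<close> by induction; the remainder bound of
    order \<open>j + 1\<close> makes it converge uniformly to \<open>g j\<close>. The nodes are
    nonzero and at most \<open>R / 2\<close>, as that bound demands.\<close>
  define s where "s = (\<lambda>n z. (f z (h n) - (\<Sum>i<j. g i z * h n ^ i)) / h n ^ j)"
  have M: "M \<ge> 0" using order_trans[OF norm_ge_zero bd[of 0 0]] R by simp
  have h: "h n \<noteq> 0" "norm (h n) \<le> R / 2" "norm (h n) = R / (real n + 2)" for n
  proof -
    show *: "norm (h n) = R / (real n + 2)" unfolding h_def norm_of_real using R by simp
    show "norm (h n) \<le> R / 2" unfolding * using R by (intro divide_left_mono) auto
    show "h n \<noteq> 0" using * R by (metis norm_zero divide_eq_0_iff less_irrefl add_nonneg_eq_0_iff of_nat_0_le_iff zero_le_numeral zero_neq_numeral)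
  qed
  have hol: "s n holomorphic_on ball 0 R" for n
    unfolding s_def g_def using h(1,2)[of n] R
    by (intro holomorphic_intros less.IH h1) auto
  have est: "norm (s n z - g j z) \<le> 2 * M / R ^ Suc j * norm (h n)" if "norm z < R" for n z
  proof -
    have "norm (f z (h n) - (\<Sum>i<Suc j. g i z * h n ^ i)) \<le> 2 * M * (norm (h n) / R) ^ Suc j"
      unfolding g_def using that h2 bd h(1,2) R by (intro taylor_remainder_bound) auto
    moreover have "s n z - g j z = (f z (h n) - (\<Sum>i<Suc j. g i z * h n ^ i)) / h n ^ j"
      using h(1)[of n] by (simp add: s_def field_simps)
    ultimately have "norm (s n z - g j z) \<le> 2 * M * (norm (h n) / R) ^ Suc j / norm (h n) ^ j"
      by (simp only: norm_divide norm_power divide_right_mono zero_le_power norm_ge_zero)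
    also have "\<dots> = 2 * M / R ^ Suc j * norm (h n)"
      using h(1)[of n] R by (simp add: power_divide field_simps)
    finally show ?thesis .
  qed
  have lim: "(\<lambda>n. 2 * M / R ^ Suc j * norm (h n)) \<longlonglongrightarrow> 0"
  proof -
    have "(\<lambda>n. R * (1 / real (n + 2))) \<longlonglongrightarrow> 0"
      by (intro tendsto_mult_right_zero LIMSEQ_ignore_initial_segment lim_1_over_n)
    then have "(\<lambda>n. R / (real n + 2)) \<longlonglongrightarrow> 0" by (simp add: add.commute)
    then show ?thesis unfolding h(3) by (rule tendsto_mult_right_zero)
  qed
  have unif: "uniform_limit (ball 0 R) s (g j) sequentially"
    unfolding uniform_limit_iff
  proof (intro allI impI)
    fix e :: real assume "e > 0"
    with lim have "\<forall>\<^sub>F n in sequentially. 2 * M / R ^ Suc j * norm (h n) < e"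
      by (rule order_tendstoD)
    then show "\<forall>\<^sub>F n in sequentially. \<forall>z\<in>ball 0 R. dist (s n z) (g j z) < e"
      by eventually_elim (auto simp: dist_norm simp del: power_Suc intro: le_less_trans[OF est])
  qed
  have "g j holomorphic_on ball 0 R"
  proof (rule holomorphic_uniform_sequence[OF open_ball hol])
    fix x :: complex assume "x \<in> ball 0 R"
    then obtain d where "d > 0" "cball x d \<subseteq> ball 0 R"
      using open_contains_cball[of "ball (0::complex) R"] open_ball by blast
    then show "\<exists>d>0. cball x d \<subseteq> ball 0 R \<and> uniform_limit (cball x d) s (g j) sequentially"
      using unif by (blast intro: uniform_limit_on_subset)
  qed
  then have "(\<lambda>z. g j z * fact j) holomorphic_on ball 0 R" by (intro holomorphic_intros)
  then show ?case by (simp add: g_def)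
qed

definition hol2 :: "(C2 \<Rightarrow> complex) \<Rightarrow> C2 set \<Rightarrow> bool" where
  "hol2 f W \<longleftrightarrow> (\<forall>x\<in>W. \<exists>D. (f has_derivative D) (at x) \<and> (\<forall>c z w. D (c * z, c * w) = c * D (z, w)))"

lemma holomorphic2_on_imp_hol2:
  assumes "holomorphic2_on F W"
  shows "hol2 (fst \<circ> F) W" "hol2 (snd \<circ> F) W"
proof -
  {
    fix x assume "x \<in> W"
    then obtain D where D: "(F has_derivative D) (at x)"
      "\<And>c z w. D (c * z, c * w) = (c * fst (D (z, w)), c * snd (D (z, w)))"
      using assms unfolding holomorphic2_on_def by blast
    have "((\<lambda>y. fst (F y)) has_derivative (\<lambda>h. fst (D h))) (at x)"
      "((\<lambda>y. snd (F y)) has_derivative (\<lambda>h. snd (D h))) (at x)"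
      using D(1) by (auto intro!: derivative_intros)
    moreover have "\<forall>c z w. fst (D (c * z, c * w)) = c * fst (D (z, w))"
      "\<forall>c z w. snd (D (c * z, c * w)) = c * snd (D (z, w))"
      unfolding D(2) by simp_all
    ultimately have "\<exists>D. ((\<lambda>y. fst (F y)) has_derivative D) (at x) \<and> (\<forall>c z w. D (c * z, c * w) = c * D (z, w))"
      "\<exists>D. ((\<lambda>y. snd (F y)) has_derivative D) (at x) \<and> (\<forall>c z w. D (c * z, c * w) = c * D (z, w))"
      by blast+
  }
  then show "hol2 (fst \<circ> F) W" "hol2 (snd \<circ> F) W"
    unfolding hol2_def comp_def by blast+
qed

lemma hol2_partial:
  assumes "hol2 f W" "(z, w) \<in> W"
  shows "(\<lambda>z. f (z, w)) field_differentiable (at z)" "(\<lambda>w. f (z, w)) field_differentiable (at w)"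
proof -
  obtain D where D: "(f has_derivative D) (at (z, w))" "\<And>c z w. D (c * z, c * w) = c * D (z, w)"
    using assms unfolding hol2_def by blast
  have "((\<lambda>z. f (z, w)) has_derivative (\<lambda>h. D (h, 0))) (at z)"
    by (rule has_derivative_compose[OF has_derivative_Pair[OF has_derivative_ident has_derivative_const] D(1)])
  moreover have "(\<lambda>h. D (h, 0)) = (*) (D (1, 0))"
  proof
    show "D (h, 0) = D (1, 0) * h" for h using D(2)[of h 1 0] by (simp add: mult.commute)
  qed
  ultimately show "(\<lambda>z. f (z, w)) field_differentiable (at z)"
    unfolding field_differentiable_def has_field_derivative_def by (intro exI) simp
  have "((\<lambda>w. f (z, w)) has_derivative (\<lambda>h. D (0, h))) (at w)"
    by (rule has_derivative_compose[OF has_derivative_Pair[OF has_derivative_const has_derivative_ident] D(1)])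
  moreover have "(\<lambda>h. D (0, h)) = (*) (D (0, 1))"
  proof
    show "D (0, h) = D (0, 1) * h" for h using D(2)[of h 0 1] by (simp add: mult.commute)
  qed
  ultimately show "(\<lambda>w. f (z, w)) field_differentiable (at w)"
    unfolding field_differentiable_def has_field_derivative_def by (intro exI) simp
qed

lemma sum_triangle: "(\<Sum>(i, j)\<in>triangle N. g i j) = (\<Sum>j\<le>N. \<Sum>i<Suc N - j. g i j)"
proof -
  have "(\<Sum>j\<le>N. \<Sum>i<Suc N - j. g i j) = (\<Sum>(j, i)\<in>(SIGMA j:{..N}. {..<Suc N - j}). g i j)"
    by (rule sum.Sigma) auto
  also have "\<dots> = (\<Sum>(i, j)\<in>triangle N. g i j)"
    by (rule sum.reindex_bij_witness[of _ prod.swap prod.swap]) (auto simp: triangle_def)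
  finally show ?thesis ..
qed

text \<open>Two successive one-variable expansions: in \<open>w\<close> with coefficients
  \<open>g j z / fact j\<close>, then each coefficient in \<open>z\<close> up to degree
  \<open>N - j\<close>. Multiplied by \<open>w^j\<close>, the error of the second expansion again
  has order \<open>N + 1\<close>.\<close>

lemma hol2_jet:
  assumes "hol2 f W" "open W" "0 \<in> W"
  shows "jet N f (taylor2 f)"
proof -
  have cont: "continuous_on W f"
  proof (rule differentiable_imp_continuous_on)
    show "f differentiable_on W"
      using assms(1) unfolding hol2_def differentiable_on_def differentiable_def
      by (meson has_derivative_at_withinI)
  qed
  obtain d where d: "d > 0" "cball 0 d \<subseteq> W" using assms(2,3) open_contains_cball by blast
  define M where "M = Sup ((\<lambda>x. norm (f x)) ` cball 0 d) + 1"
  have bdd: "bdd_above ((\<lambda>x. norm (f x)) ` cball 0 d)"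
    using d by (intro bounded_imp_bdd_above compact_imp_bounded compact_continuous_image
        continuous_intros continuous_on_subset[OF cont]) auto
  have M: "norm (f x) \<le> M" if "norm x \<le> d" for x
  proof -
    have "norm (f x) \<le> Sup ((\<lambda>x. norm (f x)) ` cball 0 d)"
      using that by (intro cSup_upper bdd) auto
    then show ?thesis by (simp add: M_def)
  qed
  \<comment> \<open>Halving places the closed bidisc of radius \<open>R\<close> inside the ball of
    radius \<open>d\<close>.\<close>
  define R where "R = d / 2"
  have R: "R > 0" using d by (simp add: R_def)
  have nin: "norm (z, w) \<le> d" if "norm z \<le> R" "norm w \<le> R" for z w :: complex
    using norm_Pair_le[of z w] that by (simp add: R_def)
  then have inW: "(z, w) \<in> W" if "norm z \<le> R" "norm w \<le> R" for z w :: complex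
    using that d(2) by (auto simp: subset_iff)
  have Mb: "norm (f (z, w)) \<le> M" if "norm z \<le> R" "norm w \<le> R" for z w using M nin that by blast
  have M0: "M \<ge> 0" using order_trans[OF norm_ge_zero Mb[of 0 0]] R by simp
  have h1: "(\<lambda>z. f (z, w)) holomorphic_on cball 0 R" if "norm w \<le> R" for w
    unfolding holomorphic_on_def using that inW
    by (auto intro!: field_differentiable_at_within hol2_partial[OF assms(1)])
  have h2: "(\<lambda>w. f (z, w)) holomorphic_on cball 0 R" if "norm z \<le> R" for z
    unfolding holomorphic_on_def using that inW
    by (auto intro!: field_differentiable_at_within hol2_partial[OF assms(1)])
  define g where "g = (\<lambda>j z. (deriv ^^ j) (\<lambda>w. f (z, w)) 0)"
  have ghol: "g j holomorphic_on ball 0 R" for j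
    unfolding g_def using R
    by (rule holomorphic_iterated_deriv_snd[where M = M])
      (auto intro!: Mb intro: holomorphic_on_imp_continuous_on[OF h2] holomorphic_on_subset[OF h1] holomorphic_on_subset[OF h2])
  have gb: "norm (g j z) \<le> fact j * M / R ^ j" if "norm z < R" for j z
    unfolding g_def using that R
    by (intro Cauchy_inequality holomorphic_on_imp_continuous_on h2 holomorphic_on_subset[OF h2] Mb) auto
  have cf: "coeff2 (taylor2 f) i j = (deriv ^^ i) (g j) 0 / fact i / fact j" for i j
    by (simp add: taylor2_def g_def)
  define c where "c = coeff2 (taylor2 f)"
  have 1: "norm (f x - (\<Sum>j<Suc N. g j (fst x) / fact j * snd x ^ j)) \<le> 2 * M * (norm (snd x) / R) ^ Suc N"
    if "norm x \<le> R / 2" for x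
  proof -
    have "norm (fst x) \<le> R / 2" "norm (snd x) \<le> R / 2" using norm_fst_le_norm[of x] norm_snd_le_norm[of x] that by auto
    then have "norm ((\<lambda>w. f (fst x, w)) (snd x) - (\<Sum>j<Suc N. (deriv ^^ j) (\<lambda>w. f (fst x, w)) 0 / fact j * snd x ^ j))
        \<le> 2 * M * (norm (snd x) / R) ^ Suc N"
      using R by (intro taylor_remainder_bound holomorphic_on_imp_continuous_on h2 holomorphic_on_subset[OF h2] Mb) auto
    then show ?thesis by (simp add: g_def)
  qed
  \<comment> \<open>The bounds on \<open>g j\<close> hold on the open disc of radius
    \<open>R\<close> only, so the expansion is made on radius \<open>R / 2\<close> and is valid for
    \<open>norm z\<close> up to \<open>R / 4\<close>.\<close>
  have 2: "norm (g j z / fact j - (\<Sum>i<n. c i j * z ^ i)) \<le> 2 * (M / R ^ j) * (norm z / (R / 2)) ^ n"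
    if "norm z \<le> R / 4" for j n z
  proof -
    have "norm (g j z - (\<Sum>i<n. (deriv ^^ i) (g j) 0 / fact i * z ^ i)) \<le> 2 * (fact j * M / R ^ j) * (norm z / (R / 2)) ^ n"
      using R that by (intro taylor_remainder_bound holomorphic_on_imp_continuous_on holomorphic_on_subset[OF ghol] gb) auto
    moreover have "g j z / fact j - (\<Sum>i<n. c i j * z ^ i) = (g j z - (\<Sum>i<n. (deriv ^^ i) (g j) 0 / fact i * z ^ i)) / fact j"
      by (simp add: c_def cf diff_divide_distrib sum_divide_distrib)
    ultimately have "norm (g j z / fact j - (\<Sum>i<n. c i j * z ^ i)) \<le> 2 * (fact j * M / R ^ j) * (norm z / (R / 2)) ^ n / fact j"
      by (simp only: norm_divide norm_fact divide_right_mono fact_ge_zero)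
    then show ?thesis by simp
  qed
  have ev_nb: "\<forall>\<^sub>F x::C2 in nhds 0. norm x \<le> R / 4"
    unfolding eventually_nhds_0_ball using R by (intro exI[of _ "R/4"]) auto
  have v1: "vanishes (Suc N) (\<lambda>x. f x - (\<Sum>j<Suc N. g j (fst x) / fact j * snd x ^ j))"
  proof (rule vanishes_le[where K = "2 * M / R ^ Suc N", OF vanishes_power[OF vanishes_snd]])
    have "\<forall>\<^sub>F x::C2 in nhds 0. norm x \<le> R / 2"
      using ev_nb by eventually_elim (use R in auto)
    then show "\<forall>\<^sub>F x in nhds 0. norm (f x - (\<Sum>j<Suc N. g j (fst x) / fact j * snd x ^ j))
           \<le> 2 * M / R ^ Suc N * norm (snd x ^ Suc N)"
      by eventually_elim (use 1 in \<open>simp add: power_divide norm_power del: power_Suc\<close>)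
  qed (use M0 R in simp)
  have v2: "vanishes (Suc N - j) (\<lambda>x::C2. g j (fst x) / fact j - (\<Sum>i<Suc N - j. c i j * fst x ^ i))" for j
  proof (rule vanishes_le[where K = "2 * (M / R ^ j) / (R / 2) ^ (Suc N - j)", OF vanishes_power[OF vanishes_fst]])
    show "\<forall>\<^sub>F x::C2 in nhds 0. norm (g j (fst x) / fact j - (\<Sum>i<Suc N - j. c i j * fst x ^ i))
           \<le> 2 * (M / R ^ j) / (R / 2) ^ (Suc N - j) * norm (fst x ^ (Suc N - j))"
      using ev_nb
    proof eventually_elim
      case (elim x)
      then have "norm (fst x) \<le> R / 4" using norm_fst_le_norm[of x] by simp
      from 2[OF this, of j "Suc N - j"] show ?case
        unfolding power_divide norm_power by (simp add: mult_ac)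
    qed
  qed (use M0 R in simp)
  have v3: "vanishes (Suc N) (\<lambda>x::C2. (g j (fst x) / fact j - (\<Sum>i<Suc N - j. c i j * fst x ^ i)) * snd x ^ j)" if "j \<le> N" for j
    using vanishes_mult[OF v2[of j] vanishes_power[OF vanishes_snd, of j]] that by simp
  have "vanishes (Suc N) (\<lambda>x. (f x - (\<Sum>j<Suc N. g j (fst x) / fact j * snd x ^ j))
      + (\<Sum>j\<le>N. (g j (fst x) / fact j - (\<Sum>i<Suc N - j. c i j * fst x ^ i)) * snd x ^ j))"
    by (intro vanishes_add v1 vanishes_sum v3) auto
  moreover have "(\<Sum>j\<le>N. (g j (fst x) / fact j - (\<Sum>i<Suc N - j. c i j * fst x ^ i)) * snd x ^ j)
     = (\<Sum>j<Suc N. g j (fst x) / fact j * snd x ^ j) - ev N (taylor2 f) x" for x :: C2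
    unfolding ev_def sum_triangle
    by (simp add: c_def left_diff_distrib sum_subtractf lessThan_Suc_atMost sum_distrib_right mult.assoc)
  ultimately show ?thesis unfolding jet_def by simp
qed

section \<open>Polynomial expressions in holomorphic functions of two variables\<close>

lemma hol2_const: "hol2 (\<lambda>x. c) W"
  unfolding hol2_def by (intro ballI exI[of _ "\<lambda>_. 0"]) auto

lemma hol2_fst: "hol2 fst W" and hol2_snd: "hol2 snd W"
proof -
  have "(fst has_derivative fst) (at x)" "(snd has_derivative snd) (at x)" for x :: C2
    by (auto intro!: bounded_linear_imp_has_derivative bounded_linear_fst bounded_linear_snd)
  then show "hol2 fst W" "hol2 snd W" unfolding hol2_def by fastforce+
qed

lemma hol2_add:
  assumes "hol2 f W" "hol2 g W" shows "hol2 (\<lambda>x. f x + g x) W"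
  unfolding hol2_def
proof
  fix x assume "x \<in> W"
  obtain D where D: "(f has_derivative D) (at x)" "\<And>c z w. D (c * z, c * w) = c * D (z, w)"
    using assms(1) \<open>x \<in> W\<close> unfolding hol2_def by blast
  obtain E where E: "(g has_derivative E) (at x)" "\<And>c z w. E (c * z, c * w) = c * E (z, w)"
    using assms(2) \<open>x \<in> W\<close> unfolding hol2_def by blast
  show "\<exists>D. ((\<lambda>x. f x + g x) has_derivative D) (at x) \<and> (\<forall>c z w. D (c * z, c * w) = c * D (z, w))"
    by (intro exI[of _ "\<lambda>h. D h + E h"] conjI has_derivative_add D E) (auto simp: D E algebra_simps)
qed

lemma hol2_mult:
  assumes "hol2 f W" "hol2 g W" shows "hol2 (\<lambda>x. f x * g x) W"
  unfolding hol2_def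
proof
  fix x assume "x \<in> W"
  obtain D where D: "(f has_derivative D) (at x)" "\<And>c z w. D (c * z, c * w) = c * D (z, w)"
    using assms(1) \<open>x \<in> W\<close> unfolding hol2_def by blast
  obtain E where E: "(g has_derivative E) (at x)" "\<And>c z w. E (c * z, c * w) = c * E (z, w)"
    using assms(2) \<open>x \<in> W\<close> unfolding hol2_def by blast
  show "\<exists>D. ((\<lambda>x. f x * g x) has_derivative D) (at x) \<and> (\<forall>c z w. D (c * z, c * w) = c * D (z, w))"
    by (intro exI[of _ "\<lambda>h. f x * E h + D h * g x"] conjI has_derivative_mult D E) (auto simp: D E algebra_simps)
qed

lemma hol2_cmult: "hol2 f W \<Longrightarrow> hol2 (\<lambda>x. c * f x) W"
  by (intro hol2_mult hol2_const)

lemma hol2_diff: "hol2 f W \<Longrightarrow> hol2 g W \<Longrightarrow> hol2 (\<lambda>x. f x - g x) W"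
  using hol2_add[of f W "\<lambda>x. -1 * g x"] hol2_cmult[of g W "-1"] by simp

lemma hol2_sum: "(\<And>i. i \<in> I \<Longrightarrow> hol2 (f i) W) \<Longrightarrow> hol2 (\<lambda>x. \<Sum>i\<in>I. f i x) W"
  by (induction I rule: infinite_finite_induct) (auto intro: hol2_add hol2_const)

lemma hol2_power: "hol2 f W \<Longrightarrow> hol2 (\<lambda>x. f x ^ n) W"
  by (induction n) (auto intro: hol2_mult hol2_const)

lemma hol2_ev:
  assumes "hol2 f W" "hol2 g W"
  shows "hol2 (\<lambda>x. ev N p (f x, g x)) W"
  unfolding ev_def case_prod_unfold fst_conv snd_conv
  by (intro hol2_sum hol2_cmult hol2_mult hol2_power assms)

section \<open>Polynomial coordinate changes\<close>

definition lip :: "('a::real_normed_vector \<Rightarrow> 'b::real_normed_vector) \<Rightarrow> bool" where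
  "lip f \<longleftrightarrow> (\<exists>K\<ge>0. \<forall>x y. norm x \<le> 1 \<longrightarrow> norm y \<le> 1 \<longrightarrow> norm (f x - f y) \<le> K * norm (x - y))"

text \<open>A Lipschitz constant proportional to the radius \<open>\<rho>\<close> is the mark of a
  map whose derivative vanishes at the origin. It is what makes the nonlinear part of a coordinate
  change absorbable.\<close>

definition lip2 :: "('a::real_normed_vector \<Rightarrow> 'b::real_normed_vector) \<Rightarrow> bool" where
  "lip2 f \<longleftrightarrow> (\<exists>K\<ge>0. \<forall>\<rho> x y. \<rho> \<le> 1 \<longrightarrow> norm x \<le> \<rho> \<longrightarrow> norm y \<le> \<rho> \<longrightarrow>
     norm (f x - f y) \<le> K * \<rho> * norm (x - y))"

lemma lip_const: "lip (\<lambda>x. c)"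
  unfolding lip_def by (intro exI[of _ 0]) auto

lemma lip2_const: "lip2 (\<lambda>x. c)"
  unfolding lip2_def by (intro exI[of _ 0]) auto

lemma lip_add:
  assumes "lip f" "lip g" shows "lip (\<lambda>x. f x + g x)"
proof -
  obtain K where K: "K \<ge> 0" "\<And>x y. norm x \<le> 1 \<Longrightarrow> norm y \<le> 1 \<Longrightarrow> norm (f x - f y) \<le> K * norm (x - y)"
    using assms(1) unfolding lip_def by blast
  obtain L where L: "L \<ge> 0" "\<And>x y. norm x \<le> 1 \<Longrightarrow> norm y \<le> 1 \<Longrightarrow> norm (g x - g y) \<le> L * norm (x - y)"
    using assms(2) unfolding lip_def by blast
  have "norm (f x + g x - (f y + g y)) \<le> (K + L) * norm (x - y)" if "norm x \<le> 1" "norm y \<le> 1" for x y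
    using norm_diff_triangle_ineq[of "f x" "g x" "f y" "g y"] K(2)[OF that] L(2)[OF that]
    by (simp add: distrib_right)
  then show ?thesis unfolding lip_def using K(1) L(1) by (intro exI[of _ "K + L"]) auto
qed

lemma lip2_add:
  assumes "lip2 f" "lip2 g" shows "lip2 (\<lambda>x. f x + g x)"
proof -
  obtain K where K: "K \<ge> 0" "\<And>\<rho> x y. \<rho> \<le> 1 \<Longrightarrow> norm x \<le> \<rho> \<Longrightarrow> norm y \<le> \<rho> \<Longrightarrow> norm (f x - f y) \<le> K * \<rho> * norm (x - y)"
    using assms(1) unfolding lip2_def by blast
  obtain L where L: "L \<ge> 0" "\<And>\<rho> x y. \<rho> \<le> 1 \<Longrightarrow> norm x \<le> \<rho> \<Longrightarrow> norm y \<le> \<rho> \<Longrightarrow> norm (g x - g y) \<le> L * \<rho> * norm (x - y)"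
    using assms(2) unfolding lip2_def by blast
  have "norm (f x + g x - (f y + g y)) \<le> (K + L) * \<rho> * norm (x - y)" if "\<rho> \<le> 1" "norm x \<le> \<rho>" "norm y \<le> \<rho>" for \<rho> x y
    using norm_diff_triangle_ineq[of "f x" "g x" "f y" "g y"] K(2)[OF that] L(2)[OF that]
    by (simp add: distrib_right)
  then show ?thesis unfolding lip2_def using K(1) L(1) by (intro exI[of _ "K + L"]) auto
qed

lemma lip_bounded:
  assumes "lip f" obtains B where "B \<ge> 0" "\<And>x. norm x \<le> 1 \<Longrightarrow> norm (f x) \<le> B"
proof -
  obtain K where K: "K \<ge> 0" "\<And>x y. norm x \<le> 1 \<Longrightarrow> norm y \<le> 1 \<Longrightarrow> norm (f x - f y) \<le> K * norm (x - y)"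
    using assms(1) unfolding lip_def by blast
  have "norm (f x) \<le> K + norm (f 0)" if "norm x \<le> 1" for x
  proof -
    have "norm (f x - f 0) \<le> K * norm x" using K(2)[of x 0] that by simp
    also have "\<dots> \<le> K * 1" using that K(1) by (intro mult_left_mono)
    finally show ?thesis using norm_triangle_sub[of "f x" "f 0"] by simp
  qed
  then show ?thesis using K(1) that[of "K + norm (f 0)"] by simp
qed

lemma lip_mult:
  fixes f g :: "'a::real_normed_vector \<Rightarrow> 'b::real_normed_algebra"
  assumes "lip f" "lip g" shows "lip (\<lambda>x. f x * g x)"
proof -
  obtain K where K: "K \<ge> 0" "\<And>x y. norm x \<le> 1 \<Longrightarrow> norm y \<le> 1 \<Longrightarrow> norm (f x - f y) \<le> K * norm (x - y)"
    using assms(1) unfolding lip_def by blast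
  obtain L where L: "L \<ge> 0" "\<And>x y. norm x \<le> 1 \<Longrightarrow> norm y \<le> 1 \<Longrightarrow> norm (g x - g y) \<le> L * norm (x - y)"
    using assms(2) unfolding lip_def by blast
  obtain B where B: "B \<ge> 0" "\<And>x. norm x \<le> 1 \<Longrightarrow> norm (f x) \<le> B" using assms(1) by (rule lip_bounded) blast
  obtain C where C: "C \<ge> 0" "\<And>x. norm x \<le> 1 \<Longrightarrow> norm (g x) \<le> C" using assms(2) by (rule lip_bounded) blast
  have "norm (f x * g x - f y * g y) \<le> (B * L + K * C) * norm (x - y)" if "norm x \<le> 1" "norm y \<le> 1" for x y
  proof -
    have "f x * g x - f y * g y = f x * (g x - g y) + (f x - f y) * g y" by (simp add: algebra_simps)
    then have "norm (f x * g x - f y * g y) \<le> norm (f x) * norm (g x - g y) + norm (f x - f y) * norm (g y)"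
      by (metis norm_triangle_mono norm_mult_ineq)
    also have "\<dots> \<le> B * (L * norm (x - y)) + (K * norm (x - y)) * C"
      using K L B C that by (intro add_mono mult_mono) auto
    finally show ?thesis by (simp add: algebra_simps)
  qed
  then show ?thesis unfolding lip_def using K(1) L(1) B(1) C(1) by (intro exI[of _ "B * L + K * C"]) auto
qed

text \<open>In the splitting \<open>f x * (g x - g y) + (f x - f y) * g y\<close> the factors
  \<open>f x\<close> and \<open>g y\<close> are O(\<rho>), because \<open>f\<close> and
  \<open>g\<close> vanish at 0.\<close>

lemma lip2_mult:
  fixes f g :: "'a::real_normed_vector \<Rightarrow> 'b::real_normed_algebra"
  assumes "lip f" "lip g" "f 0 = 0" "g 0 = 0" shows "lip2 (\<lambda>x. f x * g x)"
proof -
  obtain K where K: "K \<ge> 0" "\<And>x y. norm x \<le> 1 \<Longrightarrow> norm y \<le> 1 \<Longrightarrow> norm (f x - f y) \<le> K * norm (x - y)"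
    using assms(1) unfolding lip_def by blast
  obtain L where L: "L \<ge> 0" "\<And>x y. norm x \<le> 1 \<Longrightarrow> norm y \<le> 1 \<Longrightarrow> norm (g x - g y) \<le> L * norm (x - y)"
    using assms(2) unfolding lip_def by blast
  have "norm (f x * g x - f y * g y) \<le> (K * L + K * L) * \<rho> * norm (x - y)"
    if "\<rho> \<le> 1" "norm x \<le> \<rho>" "norm y \<le> \<rho>" for x y \<rho>
  proof -
    have \<rho>: "\<rho> \<ge> 0" using that norm_ge_zero order_trans by blast
    have "norm (f x) \<le> K * norm x" using K(2)[of x 0] assms(3) that by simp
    also have "\<dots> \<le> K * \<rho>" using that K(1) by (intro mult_left_mono)
    finally have fx: "norm (f x) \<le> K * \<rho>" .
    have "norm (g y) \<le> L * norm y" using L(2)[of y 0] assms(4) that by simp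
    also have "\<dots> \<le> L * \<rho>" using that L(1) by (intro mult_left_mono)
    finally have gy: "norm (g y) \<le> L * \<rho>" .
    have "f x * g x - f y * g y = f x * (g x - g y) + (f x - f y) * g y" by (simp add: algebra_simps)
    then have "norm (f x * g x - f y * g y) \<le> norm (f x) * norm (g x - g y) + norm (f x - f y) * norm (g y)"
      by (metis norm_triangle_mono norm_mult_ineq)
    also have "\<dots> \<le> (K * \<rho>) * (L * norm (x - y)) + (K * norm (x - y)) * (L * \<rho>)"
      using K L fx gy that \<rho> by (intro add_mono mult_mono) auto
    finally show ?thesis by (simp add: algebra_simps)
  qed
  then show ?thesis unfolding lip2_def using K(1) L(1) by (intro exI[of _ "K * L + K * L"]) auto
qed

lemma lip_sum: "(\<And>i. i \<in> I \<Longrightarrow> lip (f i)) \<Longrightarrow> lip (\<lambda>x. \<Sum>i\<in>I. f i x)"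
  by (induction I rule: infinite_finite_induct) (auto intro: lip_add lip_const)

lemma lip2_sum: "(\<And>i. i \<in> I \<Longrightarrow> lip2 (f i)) \<Longrightarrow> lip2 (\<lambda>x. \<Sum>i\<in>I. f i x)"
  by (induction I rule: infinite_finite_induct) (auto intro: lip2_add lip2_const)

lemma lip_fst: "lip (fst :: 'a::real_normed_vector \<times> 'b::real_normed_vector \<Rightarrow> 'a)"
  and lip_snd: "lip (snd :: 'a \<times> 'b \<Rightarrow> 'b)"
  unfolding lip_def by (intro exI[of _ 1], simp add: norm_fst_le_norm norm_snd_le_norm flip: fst_diff snd_diff)+

lemma lip_power:
  fixes f :: "'a::real_normed_vector \<Rightarrow> 'b::real_normed_algebra_1"
  shows "lip f \<Longrightarrow> lip (\<lambda>x. f x ^ n)"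
  by (induction n) (auto intro: lip_mult lip_const)

lemma lip_Pair:
  assumes "lip f" "lip g" shows "lip (\<lambda>x. (f x, g x))"
proof -
  obtain K where K: "K \<ge> 0" "\<And>x y. norm x \<le> 1 \<Longrightarrow> norm y \<le> 1 \<Longrightarrow> norm (f x - f y) \<le> K * norm (x - y)"
    using assms(1) unfolding lip_def by blast
  obtain L where L: "L \<ge> 0" "\<And>x y. norm x \<le> 1 \<Longrightarrow> norm y \<le> 1 \<Longrightarrow> norm (g x - g y) \<le> L * norm (x - y)"
    using assms(2) unfolding lip_def by blast
  have "norm ((f x, g x) - (f y, g y)) \<le> (K + L) * norm (x - y)" if "norm x \<le> 1" "norm y \<le> 1" for x y
    using norm_Pair_le[of "f x - f y" "g x - g y"] K(2)[OF that] L(2)[OF that]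
    by (simp add: distrib_right)
  then show ?thesis unfolding lip_def using K(1) L(1) by (intro exI[of _ "K + L"]) auto
qed

lemma lip_ev: "lip (ev N f)"
  unfolding ev_def case_prod_unfold
  by (intro lip_sum lip_mult lip_const lip_power lip_fst lip_snd)

lemma lip_evm: "lip (evm N G)"
  unfolding evm_def by (intro lip_Pair lip_ev)

lemma lip_continuous_on:
  assumes "lip f" shows "continuous_on (ball 0 1) f"
proof -
  obtain K where K: "K \<ge> 0" "\<And>x y. norm x \<le> 1 \<Longrightarrow> norm y \<le> 1 \<Longrightarrow> norm (f x - f y) \<le> K * norm (x - y)"
    using assms(1) unfolding lip_def by blast
  have "K-lipschitz_on (ball 0 1) f"
    using K by (intro lipschitz_onI) (auto simp: dist_norm)
  then show ?thesis by (rule lipschitz_on_continuous_on)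
qed

lemma vanishes_lip_diff:
  assumes "lip g" "vanishes n (\<lambda>x. u x - v x)" "vanishes 1 u" "vanishes 1 v"
  shows "vanishes n (\<lambda>x. g (u x) - g (v x))"
proof -
  obtain K where K: "K \<ge> 0" "\<And>x y. norm x \<le> 1 \<Longrightarrow> norm y \<le> 1 \<Longrightarrow> norm (g x - g y) \<le> K * norm (x - y)"
    using assms(1) unfolding lip_def by blast
  have "(u \<longlongrightarrow> 0) (nhds 0)" "(v \<longlongrightarrow> 0) (nhds 0)"
    using assms(3,4) vanishes_tendsto[of 0] by auto
  then have "\<forall>\<^sub>F x in nhds 0. dist (u x) 0 < 1" "\<forall>\<^sub>F x in nhds 0. dist (v x) 0 < 1"
    by (simp_all only: tendstoD zero_less_one)
  then have "\<forall>\<^sub>F x in nhds 0. norm (g (u x) - g (v x)) \<le> K * norm (u x - v x)"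
    by eventually_elim (auto intro: K)
  then show ?thesis by (rule vanishes_le[OF assms(2)]) (fact K)
qed

lemma lip2_monomial:
  assumes "i + j \<ge> 2"
  shows "lip2 (\<lambda>x::C2. fst x ^ i * snd x ^ j)"
proof (cases i)
  case (Suc k)
  have "lip2 (\<lambda>x::C2. fst x * (fst x ^ k * snd x ^ j))"
    by (rule lip2_mult) (use assms Suc in \<open>auto intro!: lip_mult lip_fst lip_snd lip_power simp: power_0_left\<close>)
  then show ?thesis by (simp add: Suc mult.assoc)
next
  case 0
  then obtain k where j: "j = Suc k" "k \<ge> 1" using assms by (cases j) auto
  have "lip2 (\<lambda>x::C2. snd x * snd x ^ k)"
    by (rule lip2_mult) (use j in \<open>auto intro!: lip_snd lip_power simp: power_0_left\<close>)
  then show ?thesis by (simp add: 0 j)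
qed

lemma lip2_ev:
  assumes "N \<ge> 1"
  shows "lip2 (\<lambda>x. ev N f x - (coeff2 f 1 0 * fst x + coeff2 f 0 1 * snd x))"
proof -
  have sub: "{(0,0),(1,0),(0,1)} \<subseteq> triangle N" using assms by (auto simp: triangle_def)
  have "ev N f x - (coeff2 f 1 0 * fst x + coeff2 f 0 1 * snd x)
     = coeff2 f 0 0 + (\<Sum>(i,j)\<in>triangle N - {(0,0),(1,0),(0,1)}. coeff2 f i j * (fst x ^ i * snd x ^ j))" for x
    unfolding ev_def by (subst sum.subset_diff[OF sub]) auto
  moreover have "lip2 (\<lambda>x::C2. coeff2 f 0 0 + (\<Sum>(i,j)\<in>triangle N - {(0,0),(1,0),(0,1)}. coeff2 f i j * (fst x ^ i * snd x ^ j)))"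
  proof (intro lip2_add lip2_const lip2_sum)
    fix a :: "nat \<times> nat" assume "a \<in> triangle N - {(0,0),(1,0),(0,1)}"
    moreover obtain i j where aij: "a = (i,j)" by force
    ultimately have "\<not> (i = 0 \<and> j = 0)" "\<not> (i = 1 \<and> j = 0)" "\<not> (i = 0 \<and> j = 1)" by auto
    then have "i + j \<ge> 2" by linarith
    note a = aij this
    obtain K where K: "K \<ge> 0" "\<And>\<rho> x y::C2. \<rho> \<le> 1 \<Longrightarrow> norm x \<le> \<rho> \<Longrightarrow> norm y \<le> \<rho> \<Longrightarrow>
        norm (fst x ^ i * snd x ^ j - fst y ^ i * snd y ^ j) \<le> K * \<rho> * norm (x - y)"
      using lip2_monomial[OF a(2)] unfolding lip2_def by blast
    have "norm (coeff2 f i j * (fst x ^ i * snd x ^ j) - coeff2 f i j * (fst y ^ i * snd y ^ j))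
        \<le> (norm (coeff2 f i j) * K) * \<rho> * norm (x - y)" if "\<rho> \<le> 1" "norm x \<le> \<rho>" "norm y \<le> \<rho>" for x y :: C2 and \<rho>
      using mult_left_mono[OF K(2)[OF that], of "norm (coeff2 f i j)"]
      by (simp add: norm_mult flip: right_diff_distrib)
    then show "lip2 (\<lambda>x. case a of (i, j) \<Rightarrow> coeff2 f i j * (fst x ^ i * snd x ^ j))"
      unfolding lip2_def a prod.case using K(1) by (intro exI[of _ "norm (coeff2 f i j) * K"]) auto
  qed
  ultimately show ?thesis by simp
qed

text \<open>The linear part is invertible and the nonlinear part has Lipschitz constant O(r), which
  is absorbed for small \<open>r\<close>. The bound yields injectivity near 0 and carries error
  estimates back through the polynomial coordinate change.\<close>

lemma evm_lower_lipschitz: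
  assumes "formal_coordinate_change \<Phi>" "N \<ge> 1"
  obtains r c where "0 < r" "r < 1" "c > 0"
    "\<And>x y. norm x \<le> r \<Longrightarrow> norm y \<le> r \<Longrightarrow> norm (x - y) \<le> c * norm (evm N \<Phi> x - evm N \<Phi> y)"
proof -
  define p q s t where "p = coeff2 (fst \<Phi>) 1 0" and "q = coeff2 (fst \<Phi>) 0 1"
    and "s = coeff2 (snd \<Phi>) 1 0" and "t = coeff2 (snd \<Phi>) 0 1"
  define d where "d = p * t - q * s"
  have d: "d \<noteq> 0" using assms(1) by (simp add: formal_coordinate_change_def d_def p_def q_def s_def t_def)
  define e1 where "e1 = (\<lambda>x. ev N (fst \<Phi>) x - (p * fst x + q * snd x))"
  define e2 where "e2 = (\<lambda>x. ev N (snd \<Phi>) x - (s * fst x + t * snd x))"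
  obtain K1 where K1: "K1 \<ge> 0" "\<And>\<rho> x y. \<rho> \<le> 1 \<Longrightarrow> norm x \<le> \<rho> \<Longrightarrow> norm y \<le> \<rho> \<Longrightarrow> norm (e1 x - e1 y) \<le> K1 * \<rho> * norm (x - y)"
    using lip2_ev[OF assms(2), of "fst \<Phi>"] unfolding lip2_def e1_def p_def q_def by blast
  obtain K2 where K2: "K2 \<ge> 0" "\<And>\<rho> x y. \<rho> \<le> 1 \<Longrightarrow> norm x \<le> \<rho> \<Longrightarrow> norm y \<le> \<rho> \<Longrightarrow> norm (e2 x - e2 y) \<le> K2 * \<rho> * norm (x - y)"
    using lip2_ev[OF assms(2), of "snd \<Phi>"] unfolding lip2_def e2_def s_def t_def by blast
  define L where "L = norm p + norm q + norm s + norm t + 1"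
  define K where "K = K1 + K2 + 1"
  have L: "L > 0" by (simp add: L_def add_nonneg_pos)
  have K: "K > 0" using K1(1) K2(1) by (simp add: K_def)
  \<comment> \<open>Makes \<open>L * K * r\<close> at most \<open>norm d / 2\<close>, so that the
    term in \<open>norm h\<close> on the right costs only half of the left-hand side.\<close>
  define r where "r = min (1/2) (norm d / (2 * L * K))"
  have r: "0 < r" "r < 1" using d L K by (auto simp: r_def)
  have rLK: "L * K * r \<le> norm d / 2"
  proof -
    have "L * K * r \<le> L * K * (norm d / (2 * L * K))" unfolding r_def using L K by (intro mult_left_mono) auto
    then show ?thesis using L K by simp
  qed
  have "norm (x - y) \<le> (2 * L / norm d) * norm (evm N \<Phi> x - evm N \<Phi> y)" if "norm x \<le> r" "norm y \<le> r" for x y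
  proof -
    define D where "D = evm N \<Phi> x - evm N \<Phi> y"
    define h where "h = x - y"
    define E1 where "E1 = e1 x - e1 y"
    define E2 where "E2 = e2 x - e2 y"
    have E: "norm E1 \<le> K1 * r * norm h" "norm E2 \<le> K2 * r * norm h"
      using K1(2)[of r x y] K2(2)[of r x y] that r by (auto simp: E1_def E2_def h_def)
    have D1: "fst D = p * fst h + q * snd h + E1" and D2: "snd D = s * fst h + t * snd h + E2"
      by (auto simp: D_def h_def E1_def E2_def e1_def e2_def evm_def algebra_simps)
    \<comment> \<open>Cramer's rule for the linear part, applied to the increment \<open>D\<close>
      with the nonlinear errors removed.\<close>
    have h1: "d * fst h = t * (fst D - E1) - q * (snd D - E2)"
      unfolding D1 D2 d_def by (simp add: algebra_simps)
    have h2: "d * snd h = p * (snd D - E2) - s * (fst D - E1)"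
      unfolding D1 D2 d_def by (simp add: algebra_simps)
    define X where "X = norm D + K * r * norm h"
    have rh: "r * norm h \<ge> 0" using r by simp
    have "norm (fst D - E1) \<le> norm D + K1 * r * norm h" "norm (snd D - E2) \<le> norm D + K2 * r * norm h"
      using E norm_fst_le_norm[of D] norm_snd_le_norm[of D] norm_triangle_ineq4[of "fst D" E1] norm_triangle_ineq4[of "snd D" E2] by linarith+
    moreover have "K1 * (r * norm h) \<le> K * (r * norm h)" "K2 * (r * norm h) \<le> K * (r * norm h)"
      using rh K1(1) K2(1) by (auto simp: K_def intro!: mult_right_mono)
    ultimately have X: "norm (fst D - E1) \<le> X" "norm (snd D - E2) \<le> X"
      by (simp_all add: X_def mult.assoc)
    have X0: "X \<ge> 0" using X(1) norm_ge_zero order_trans by blast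
    have "norm d * norm (fst h) \<le> norm t * X + norm q * X"
      unfolding norm_mult[symmetric] h1
      by (rule order_trans[OF norm_triangle_ineq4]) (auto simp: norm_mult intro!: add_mono mult_left_mono X)
    moreover have "norm d * norm (snd h) \<le> norm p * X + norm s * X"
      unfolding norm_mult[symmetric] h2
      by (rule order_trans[OF norm_triangle_ineq4]) (auto simp: norm_mult intro!: add_mono mult_left_mono X)
    moreover have "norm d * norm h \<le> norm d * (norm (fst h) + norm (snd h))"
      using norm_Pair_le[of "fst h" "snd h"] by (intro mult_left_mono) auto
    ultimately have "norm d * norm h \<le> L * X"
      using X0 by (simp add: L_def algebra_simps)
    also have "L * X = L * norm D + L * K * r * norm h" by (simp add: X_def algebra_simps)
    also have "\<dots> \<le> L * norm D + norm d / 2 * norm h"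
      using rLK by (intro add_left_mono mult_right_mono) auto
    finally have "norm d * norm h \<le> 2 * L * norm D" by simp
    then show ?thesis using d by (simp add: D_def h_def field_simps)
  qed
  then show thesis using r d L by (intro that[of r "2 * L / norm d"]) auto
qed

section \<open>Transition between two formal coordinate changes\<close>

lemma order_coordinate_change:
  "formal_coordinate_change \<Phi> \<Longrightarrow> order_at_least 1 (fst \<Phi>)" "formal_coordinate_change \<Phi> \<Longrightarrow> order_at_least 1 (snd \<Phi>)"
  by (auto simp: formal_coordinate_change_def order_at_least_1_iff simp del: One_nat_def)

lemma vanishes_evm: "order_at_least n (fst G) \<Longrightarrow> order_at_least n (snd G) \<Longrightarrow> vanishes n (evm N G)"
  unfolding evm_def by (intro vanishes_Pair vanishes_ev)

text \<open>The filter \<open>nhds 0\<close> includes the point 0, so a bound of positive order,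
  read at 0, forces the value 0.\<close>

lemma ev_0: "order_at_least 1 f \<Longrightarrow> ev N f 0 = 0"
proof -
  assume f: "order_at_least 1 f"
  obtain C where "\<forall>\<^sub>F x in nhds 0. norm (ev N f x) \<le> C * norm x ^ 1"
    using vanishes_ev[OF f] by (rule vanishesE)
  then have "norm (ev N f 0) \<le> 0" by (auto dest: eventually_nhds_x_imp_x)
  then show ?thesis by simp
qed

text \<open>Newton's iteration with the derivative of \<open>\<Phi>\<close> frozen at the origin gains one order per step.\<close>

lemma newton_transition:
  assumes \<Phi>: "formal_coordinate_change \<Phi>" "formal_coordinate_change \<Phi>'" and N: "N \<ge> 1"
  shows "\<exists>\<psi>1 \<psi>2. hol2 \<psi>1 UNIV \<and> hol2 \<psi>2 UNIV \<and> vanishes 1 \<psi>1 \<and> vanishes 1 \<psi>2 \<and>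
    vanishes (Suc k) (\<lambda>x. evm N \<Phi> (\<psi>1 x, \<psi>2 x) - evm N \<Phi>' x)"
proof (induction k)
  case 0
  have "vanishes 1 (\<lambda>x. evm N \<Phi> (0, 0) - evm N \<Phi>' x)"
    using vanishes_uminus[OF vanishes_evm[OF order_coordinate_change[OF \<Phi>(2)]]]
      ev_0[OF order_coordinate_change(1)[OF \<Phi>(1)]] ev_0[OF order_coordinate_change(2)[OF \<Phi>(1)]]
    by (simp add: evm_def flip: zero_prod_def)
  then show ?case by (intro exI[of _ "\<lambda>_. 0"]) (auto simp: hol2_const)
next
  case (Suc k)
  then obtain \<psi>1 \<psi>2 where \<psi>: "hol2 \<psi>1 UNIV" "hol2 \<psi>2 UNIV" "vanishes 1 \<psi>1" "vanishes 1 \<psi>2"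
    "vanishes (Suc k) (\<lambda>x. evm N \<Phi> (\<psi>1 x, \<psi>2 x) - evm N \<Phi>' x)" by blast
  define p q s t where "p = coeff2 (fst \<Phi>) 1 0" and "q = coeff2 (fst \<Phi>) 0 1"
    and "s = coeff2 (snd \<Phi>) 1 0" and "t = coeff2 (snd \<Phi>) 0 1"
  define d where "d = p * t - q * s"
  have d: "d \<noteq> 0" using \<Phi>(1) by (simp add: formal_coordinate_change_def d_def p_def q_def s_def t_def)
  define u1 where "u1 = (\<lambda>x. ev N (fst \<Phi>') x - ev N (fst \<Phi>) (\<psi>1 x, \<psi>2 x))"
  define u2 where "u2 = (\<lambda>x. ev N (snd \<Phi>') x - ev N (snd \<Phi>) (\<psi>1 x, \<psi>2 x))"
  \<comment> \<open>The correction \<open>(h1, h2)\<close> is the inverse of the linear part of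
    \<open>\<Phi>\<close> applied to the residual \<open>(u1, u2)\<close>; \<open>lin\<close>
    confirms that its linear effect cancels the residual.\<close>
  define h1 where "h1 = (\<lambda>x. (t / d) * u1 x - (q / d) * u2 x)"
  define h2 where "h2 = (\<lambda>x. (p / d) * u2 x - (s / d) * u1 x)"
  have u: "hol2 u1 UNIV" "hol2 u2 UNIV"
    using hol2_ev[OF hol2_fst hol2_snd] by (auto simp: u1_def u2_def intro!: hol2_diff hol2_ev \<psi>)
  have h: "hol2 h1 UNIV" "hol2 h2 UNIV"
    unfolding h1_def h2_def by (intro hol2_diff hol2_cmult u)+
  have vu: "vanishes (Suc k) u1" "vanishes (Suc k) u2"
    using vanishes_uminus[OF \<psi>(5)] unfolding vanishes_prod_iff by (auto simp: u1_def u2_def evm_def)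
  have vh: "vanishes (Suc k) h1" "vanishes (Suc k) h2"
    unfolding h1_def h2_def by (intro vanishes_diff vanishes_cmult vu)+
  have vh1: "vanishes 1 h1" "vanishes 1 h2" using vh by (auto intro: vanishes_mono)
  have lin: "p * h1 x + q * h2 x = u1 x" "s * h1 x + t * h2 x = u2 x" for x
  proof -
    have "p * h1 x + q * h2 x = (p * t - q * s) / d * u1 x" "s * h1 x + t * h2 x = (p * t - q * s) / d * u2 x"
      unfolding h1_def h2_def by (simp_all add: diff_divide_distrib algebra_simps)
    then show "p * h1 x + q * h2 x = u1 x" "s * h1 x + t * h2 x = u2 x" using d by (simp_all add: d_def)
  qed
  \<comment> \<open>What remains is the nonlinear part, with Lipschitz constant O(|x|) on the
    relevant ball, applied to an increment of order \<open>k + 1\<close>: this is the gained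
    order.\<close>
  have main: "vanishes (Suc (Suc k)) (\<lambda>x. ev N f (\<psi>1 x + h1 x, \<psi>2 x + h2 x) - ev N f (\<psi>1 x, \<psi>2 x)
      - (coeff2 f 1 0 * h1 x + coeff2 f 0 1 * h2 x))" for f
  proof -
    define e where "e = (\<lambda>x. ev N f x - (coeff2 f 1 0 * fst x + coeff2 f 0 1 * snd x))"
    obtain K where K: "K \<ge> 0" "\<And>\<rho> x y. \<rho> \<le> 1 \<Longrightarrow> norm x \<le> \<rho> \<Longrightarrow> norm y \<le> \<rho> \<Longrightarrow> norm (e x - e y) \<le> K * \<rho> * norm (x - y)"
      using lip2_ev[OF N, of f] unfolding lip2_def e_def by blast
    have "vanishes 1 (\<lambda>x. (\<psi>1 x, \<psi>2 x))" "vanishes 1 (\<lambda>x. (\<psi>1 x + h1 x, \<psi>2 x + h2 x))"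
      using \<psi> vh1 by (auto intro!: vanishes_Pair vanishes_add)
    then obtain C1 C2 where C1: "C1 > 0" "\<forall>\<^sub>F x in nhds 0. norm (\<psi>1 x, \<psi>2 x) \<le> C1 * norm x ^ 1" and
      C2: "C2 > 0" "\<forall>\<^sub>F x in nhds 0. norm (\<psi>1 x + h1 x, \<psi>2 x + h2 x) \<le> C2 * norm x ^ 1"
      by (auto elim!: vanishesE)
    obtain C3 where C3: "C3 > 0" "\<forall>\<^sub>F x in nhds 0. norm (h1 x, h2 x) \<le> C3 * norm x ^ Suc k"
      using vanishes_Pair[OF vh] by (auto elim: vanishesE)
    have sm: "\<forall>\<^sub>F x::C2 in nhds 0. (C1 + C2) * norm x \<le> 1"
      unfolding eventually_nhds_0_ball
      using C1(1) C2(1) by (intro exI[of _ "1 / (C1 + C2)"]) (auto simp: field_simps)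
    have "\<forall>\<^sub>F x in nhds 0. norm (e (\<psi>1 x + h1 x, \<psi>2 x + h2 x) - e (\<psi>1 x, \<psi>2 x)) \<le> (K * (C1 + C2) * C3) * norm x ^ Suc (Suc k)"
      using C1(2) C2(2) C3(2) sm
    proof eventually_elim
      case (elim x)
      have n12: "0 \<le> C1 * norm x" "0 \<le> C2 * norm x" using C1(1) C2(1) by simp_all
      have "norm (\<psi>1 x + h1 x, \<psi>2 x + h2 x) \<le> (C1 + C2) * norm x" "norm (\<psi>1 x, \<psi>2 x) \<le> (C1 + C2) * norm x"
        using elim(1,2) n12 by (auto simp: distrib_right)
      then have "norm (e (\<psi>1 x + h1 x, \<psi>2 x + h2 x) - e (\<psi>1 x, \<psi>2 x)) \<le> K * ((C1 + C2) * norm x) * norm (h1 x, h2 x)"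
        using K(2)[OF elim(4), of "(\<psi>1 x + h1 x, \<psi>2 x + h2 x)" "(\<psi>1 x, \<psi>2 x)"] by simp
      also have "\<dots> \<le> K * ((C1 + C2) * norm x) * (C3 * norm x ^ Suc k)"
        using elim(3) K(1) C1(1) C2(1) by (intro mult_left_mono) auto
      finally show ?case by (simp add: mult_ac)
    qed
    then have "vanishes (Suc (Suc k)) (\<lambda>x. e (\<psi>1 x + h1 x, \<psi>2 x + h2 x) - e (\<psi>1 x, \<psi>2 x))" by (rule vanishesI)
    then show ?thesis by (simp add: e_def algebra_simps)
  qed
  have "vanishes (Suc (Suc k)) (\<lambda>x. evm N \<Phi> (\<psi>1 x + h1 x, \<psi>2 x + h2 x) - evm N \<Phi>' x)"
    using main[of "fst \<Phi>"] main[of "snd \<Phi>"] lin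
    unfolding vanishes_prod_iff by (simp add: evm_def p_def q_def s_def t_def u1_def u2_def)
  then show ?case
    using \<psi> h vh1 by (intro exI[of _ "\<lambda>x. \<psi>1 x + h1 x"] exI[of _ "\<lambda>x. \<psi>2 x + h2 x"]) (auto intro: hol2_add vanishes_add)
qed

text \<open>The Newton approximation is holomorphic, so its Taylor series agrees with it up to order
  \<open>N\<close>. The resulting \<open>\<Psi>\<close> plays the role of the inverse of
  \<open>\<Phi>\<close> composed with \<open>\<Phi>'\<close> without a formal inverse being
  constructed.\<close>

lemma ex_polynomial_transition:
  assumes "formal_coordinate_change \<Phi>" "formal_coordinate_change \<Phi>'" "N \<ge> 1"
  obtains \<Psi> :: fmap2 where "order_at_least 1 (fst \<Psi>)" "order_at_least 1 (snd \<Psi>)"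
    "vanishes (Suc N) (\<lambda>x. evm N \<Phi> (evm N \<Psi> x) - evm N \<Phi>' x)"
proof -
  obtain \<psi>1 \<psi>2 where \<psi>: "hol2 \<psi>1 UNIV" "hol2 \<psi>2 UNIV" "vanishes 1 \<psi>1" "vanishes 1 \<psi>2"
    "vanishes (Suc N) (\<lambda>x. evm N \<Phi> (\<psi>1 x, \<psi>2 x) - evm N \<Phi>' x)"
    using newton_transition[OF assms] by blast
  define \<Psi> where "\<Psi> = (taylor2 \<psi>1, taylor2 \<psi>2)"
  have z: "f 0 = 0" if "vanishes 1 f" for f :: "C2 \<Rightarrow> complex"
  proof -
    obtain C where "\<forall>\<^sub>F x in nhds 0. norm (f x) \<le> C * norm x ^ 1" using \<open>vanishes 1 f\<close> by (rule vanishesE)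
    then have "norm (f 0) \<le> 0" by (auto dest: eventually_nhds_x_imp_x)
    then show ?thesis by simp
  qed
  have fo: "order_at_least 1 (fst \<Psi>)" "order_at_least 1 (snd \<Psi>)"
    using z[OF \<psi>(3)] z[OF \<psi>(4)] unfolding order_at_least_1_iff by (auto simp: \<Psi>_def taylor2_def zero_prod_def)
  have j: "vanishes (Suc N) (\<lambda>x. evm N \<Psi> x - (\<psi>1 x, \<psi>2 x))"
    using vanishes_uminus[OF hol2_jet[OF \<psi>(1), unfolded jet_def, of N]] vanishes_uminus[OF hol2_jet[OF \<psi>(2), unfolded jet_def, of N]]
    unfolding vanishes_prod_iff by (auto simp: evm_def \<Psi>_def)
  have "vanishes (Suc N) (\<lambda>x. evm N \<Phi> (evm N \<Psi> x) - evm N \<Phi> (\<psi>1 x, \<psi>2 x))"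
    using \<psi>(3,4) by (intro vanishes_lip_diff[OF lip_evm j] vanishes_evm fo vanishes_Pair) auto
  from vanishes_add[OF this \<psi>(5)] show thesis
    by (intro that[OF fo]) simp
qed

lemma evm_fcomp:
  assumes "order_at_least 1 (fst G)" "order_at_least 1 (snd G)"
  shows "vanishes (Suc N) (\<lambda>x. evm N P (evm N G x) - evm N (fcomp P G) x)"
  using jet_subst[OF jet_ev jet_ev jet_ev assms, of N "fst P"] jet_subst[OF jet_ev jet_ev jet_ev assms, of N "snd P"]
  unfolding vanishes_prod_iff by (auto simp: jet_def evm_def fcomp_def)

lemma evm_conjugate:
  assumes "fcomp P \<Phi> = fcomp \<Phi> Q" "formal_coordinate_change \<Phi>" "order_at_least 1 (fst Q)" "order_at_least 1 (snd Q)"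
  shows "vanishes (Suc N) (\<lambda>x. evm N P (evm N \<Phi> x) - evm N \<Phi> (evm N Q x))"
  using vanishes_diff[OF evm_fcomp[OF order_coordinate_change[OF assms(2)], of N P] evm_fcomp[OF assms(3,4), of N \<Phi>]] assms(1)
  by simp

lemma vanishes_lower_lipschitz:
  assumes "formal_coordinate_change \<Phi>" "N \<ge> 1" "vanishes n (\<lambda>x. evm N \<Phi> (u x) - evm N \<Phi> (v x))" "vanishes 1 u" "vanishes 1 v"
  shows "vanishes n (\<lambda>x. u x - v x)"
proof -
  obtain r c where rc: "0 < r" "r < 1" "c > 0"
    "\<And>x y. norm x \<le> r \<Longrightarrow> norm y \<le> r \<Longrightarrow> norm (x - y) \<le> c * norm (evm N \<Phi> x - evm N \<Phi> y)"
    using evm_lower_lipschitz[OF assms(1,2)] by blast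
  have "(u \<longlongrightarrow> 0) (nhds 0)" "(v \<longlongrightarrow> 0) (nhds 0)"
    using assms(4,5) vanishes_tendsto[of 0] by auto
  then have "\<forall>\<^sub>F x in nhds 0. dist (u x) 0 < r" "\<forall>\<^sub>F x in nhds 0. dist (v x) 0 < r"
    using rc(1) by (simp_all only: tendstoD)
  then have "\<forall>\<^sub>F x in nhds 0. norm (u x - v x) \<le> c * norm (evm N \<Phi> (u x) - evm N \<Phi> (v x))"
    by eventually_elim (auto intro: rc(4))
  then show ?thesis by (rule vanishes_le[OF assms(3)]) (use rc in simp)
qed

text \<open>After applying \<open>\<Phi>\<close> on the left, both sides are joined by a chain of
  equalities up to order \<open>N\<close>: \<open>\<Phi> Q \<Psi>\<close>,
  \<open>P \<Phi> \<Psi>\<close>, \<open>P \<Phi>'\<close>, \<open>\<Phi>' Q'\<close>,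
  \<open>\<Phi> \<Psi> Q'\<close>. The lower Lipschitz bound then cancels
  \<open>\<Phi>\<close>.\<close>

lemma transition_conjugates:
  assumes P: "fcomp P \<Phi> = fcomp \<Phi> Q" "fcomp P \<Phi>' = fcomp \<Phi>' Q'"
    and \<Phi>: "formal_coordinate_change \<Phi>" "formal_coordinate_change \<Phi>'"
    and Q: "order_at_least 1 (fst Q)" "order_at_least 1 (snd Q)" "order_at_least 1 (fst Q')" "order_at_least 1 (snd Q')"
    and N: "N \<ge> 1"
    and \<Psi>: "order_at_least 1 (fst \<Psi>)" "order_at_least 1 (snd \<Psi>)" "vanishes (Suc N) (\<lambda>x. evm N \<Phi> (evm N \<Psi> x) - evm N \<Phi>' x)"
  shows "vanishes (Suc N) (\<lambda>x. evm N Q (evm N \<Psi> x) - evm N \<Psi> (evm N Q' x))"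
proof (rule vanishes_lower_lipschitz[OF \<Phi>(1) N])
  have v\<Psi>: "vanishes 1 (evm N \<Psi>)" by (intro vanishes_evm \<Psi>)
  have vQ: "vanishes 1 (evm N Q)" "vanishes 1 (evm N Q')" by (intro vanishes_evm Q)+
  have v\<Phi>: "vanishes 1 (evm N \<Phi>)" "vanishes 1 (evm N \<Phi>')"
    by (intro vanishes_evm order_coordinate_change \<Phi>)+
  show "vanishes 1 (\<lambda>x. evm N Q (evm N \<Psi> x))" by (rule vanishes_compose[OF vQ(1) v\<Psi>])
  show "vanishes 1 (\<lambda>x. evm N \<Psi> (evm N Q' x))" by (rule vanishes_compose[OF v\<Psi> vQ(2)])
  have "vanishes (Suc N) (\<lambda>x. - (evm N P (evm N \<Phi> (evm N \<Psi> x)) - evm N \<Phi> (evm N Q (evm N \<Psi> x))))"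
    by (intro vanishes_uminus vanishes_compose[OF evm_conjugate[OF P(1) \<Phi>(1) Q(1,2)] v\<Psi>])
  moreover have "vanishes (Suc N) (\<lambda>x. evm N P (evm N \<Phi> (evm N \<Psi> x)) - evm N P (evm N \<Phi>' x))"
    by (intro vanishes_lip_diff[OF lip_evm \<Psi>(3)] vanishes_compose[OF v\<Phi>(1) v\<Psi>] v\<Phi>)
  moreover have "vanishes (Suc N) (\<lambda>x. evm N P (evm N \<Phi>' x) - evm N \<Phi>' (evm N Q' x))"
    by (intro evm_conjugate P \<Phi> Q)
  moreover have "vanishes (Suc N) (\<lambda>x. - (evm N \<Phi> (evm N \<Psi> (evm N Q' x)) - evm N \<Phi>' (evm N Q' x)))"
    by (intro vanishes_uminus vanishes_compose[OF \<Psi>(3) vQ(2)])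
  ultimately have "vanishes (Suc N) (\<lambda>x. - (evm N P (evm N \<Phi> (evm N \<Psi> x)) - evm N \<Phi> (evm N Q (evm N \<Psi> x)))
     + (evm N P (evm N \<Phi> (evm N \<Psi> x)) - evm N P (evm N \<Phi>' x))
     + (evm N P (evm N \<Phi>' x) - evm N \<Phi>' (evm N Q' x))
     + - (evm N \<Phi> (evm N \<Psi> (evm N Q' x)) - evm N \<Phi>' (evm N Q' x)))"
    by (intro vanishes_add)
  then show "vanishes (Suc N) (\<lambda>x. evm N \<Phi> (evm N Q (evm N \<Psi> x)) - evm N \<Phi> (evm N \<Psi> (evm N Q' x)))"
    by simp
qed

section \<open>Invariance of the separating condition\<close>

definition lower :: "nat \<Rightarrow> ('a::real_normed_vector \<Rightarrow> 'b::real_normed_vector) \<Rightarrow> bool" where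
  "lower n g \<longleftrightarrow> (\<exists>c>0. \<forall>\<^sub>F x in nhds 0. c * norm x ^ n \<le> norm (g x))"

lemma lowerI: "c > 0 \<Longrightarrow> (\<forall>\<^sub>F x in nhds 0. c * norm x ^ n \<le> norm (g x)) \<Longrightarrow> lower n g"
  unfolding lower_def by blast

lemma lowerE:
  assumes "lower n g"
  obtains c where "c > 0" "\<forall>\<^sub>F x in nhds 0. c * norm x ^ n \<le> norm (g x)"
  using assms unfolding lower_def by blast

text \<open>If \<open>n > m\<close>, the two bounds at a point of small norm \<open>s > 0\<close>
  would give \<open>c \<le> C * s\<close>. Orders of normal forms are compared by bounding one
  quantity both from above and from below.\<close>

lemma lower_vanishes:
  fixes f :: "complex \<Rightarrow> 'b::real_normed_vector"
  assumes "lower m f" "vanishes n f"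
  shows "n \<le> m"
proof (rule ccontr)
  assume "\<not> n \<le> m"
  then have "vanishes (Suc m) f" using assms(2) by (auto intro: vanishes_mono)
  then obtain C where C: "C > 0" "\<forall>\<^sub>F x in nhds 0. norm (f x) \<le> C * norm x ^ Suc m" by (rule vanishesE)
  obtain c where c: "c > 0" "\<forall>\<^sub>F x in nhds 0. c * norm x ^ m \<le> norm (f x)" using assms(1) by (rule lowerE)
  from eventually_conj[OF C(2) c(2)] obtain d where d: "d > 0"
    "\<And>x. norm x < d \<Longrightarrow> norm (f x) \<le> C * norm x ^ Suc m \<and> c * norm x ^ m \<le> norm (f x)"
    unfolding eventually_nhds_0_ball by blast
  define s where "s = min (d / 2) (c / (2 * C))"
  have s: "s > 0" "s < d" "C * s < c"
    using d(1) c(1) C(1) by (auto simp: s_def min_def field_simps)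
  define x where "x = complex_of_real s"
  have nx: "norm x = s" using s by (simp add: x_def)
  have "c * s ^ m \<le> C * s ^ Suc m" using d(2)[of x] s(2) unfolding nx by linarith
  then have "c * s ^ m \<le> (C * s) * s ^ m" by (simp add: mult_ac)
  then have "c \<le> C * s" using s(1) by simp
  then show False using s(3) by simp
qed

lemma lower_le:
  assumes "lower n f" "\<forall>\<^sub>F x in nhds 0. norm (f x) \<le> K * norm (g x)" "K > 0"
  shows "lower n g"
proof -
  obtain c where c: "c > 0" "\<forall>\<^sub>F x in nhds 0. c * norm x ^ n \<le> norm (f x)" using assms(1) by (rule lowerE)
  from c(2) assms(2) have "\<forall>\<^sub>F x in nhds 0. c / K * norm x ^ n \<le> norm (g x)"
    by eventually_elim (use assms(3) in \<open>simp add: field_simps\<close>)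
  then show ?thesis using c(1) assms(3) by (intro lowerI[of "c / K"]) auto
qed

lemma lower_add:
  assumes "lower n f" "vanishes (Suc n) g"
  shows "lower n (\<lambda>x. f x + g x)"
proof -
  obtain c where c: "c > 0" "\<forall>\<^sub>F x in nhds 0. c * norm x ^ n \<le> norm (f x)" using assms(1) by (rule lowerE)
  obtain C where C: "C > 0" "\<forall>\<^sub>F x in nhds 0. norm (g x) \<le> C * norm x ^ Suc n" using assms(2) by (rule vanishesE)
  have "\<forall>\<^sub>F x::'a in nhds 0. C * norm x \<le> c / 2"
    unfolding eventually_nhds_0_ball using c(1) C(1) by (intro exI[of _ "c / (2 * C)"]) (auto simp: field_simps)
  with c(2) C(2) have "\<forall>\<^sub>F x in nhds 0. c / 2 * norm x ^ n \<le> norm (f x + g x)"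
  proof eventually_elim
    case (elim x)
    have "C * norm x ^ Suc n = (C * norm x) * norm x ^ n" by simp
    also have "\<dots> \<le> c / 2 * norm x ^ n" using elim(3) by (intro mult_right_mono) auto
    finally have "norm (g x) \<le> c / 2 * norm x ^ n" using elim(2) by simp
    then show ?case using elim(1) norm_diff_ineq[of "f x" "g x"] by simp
  qed
  then show ?thesis using c(1) by (intro lowerI[of "c / 2"]) auto
qed

lemma lower_compose:
  assumes "lower n g" "lower 1 f" "vanishes 1 f"
  shows "lower n (\<lambda>x. g (f x))"
proof -
  obtain c where c: "c > 0" "\<forall>\<^sub>F x in nhds 0. c * norm x ^ n \<le> norm (g x)" using assms(1) by (rule lowerE)
  obtain d where d: "d > 0" "\<forall>\<^sub>F x in nhds 0. d * norm x ^ 1 \<le> norm (f x)" using assms(2) by (rule lowerE)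
  have "filterlim f (nhds 0) (nhds 0)" using vanishes_tendsto[of 0 f] assms(3) by simp
  then have "\<forall>\<^sub>F x in nhds 0. c * norm (f x) ^ n \<le> norm (g (f x))"
    using c(2) by (rule eventually_compose_filterlim[rotated])
  with d(2) have "\<forall>\<^sub>F x in nhds 0. (c * d ^ n) * norm x ^ n \<le> norm (g (f x))"
  proof eventually_elim
    case (elim x)
    have "(d * norm x) ^ n \<le> norm (f x) ^ n" using elim d(1) by (intro power_mono) auto
    then have "c * (d * norm x) ^ n \<le> c * norm (f x) ^ n" using c(1) by simp
    then show ?case using elim by (simp add: power_mult_distrib mult_ac)
  qed
  then show ?thesis using c(1) d(1) by (intro lowerI[of "c * d ^ n"]) auto
qed

lemma lower_mult:
  fixes f g :: "'a::real_normed_vector \<Rightarrow> 'b::real_normed_div_algebra"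
  assumes "lower m f" "lower n g"
  shows "lower (m + n) (\<lambda>x. f x * g x)"
proof -
  obtain c where c: "c > 0" "\<forall>\<^sub>F x in nhds 0. c * norm x ^ m \<le> norm (f x)" using assms(1) by (rule lowerE)
  obtain d where d: "d > 0" "\<forall>\<^sub>F x in nhds 0. d * norm x ^ n \<le> norm (g x)" using assms(2) by (rule lowerE)
  from c(2) d(2) have "\<forall>\<^sub>F x in nhds 0. (c * d) * norm x ^ (m + n) \<le> norm (f x * g x)"
  proof eventually_elim
    case (elim x)
    have "(c * norm x ^ m) * (d * norm x ^ n) \<le> norm (f x) * norm (g x)"
      using elim c(1) d(1) by (intro mult_mono) auto
    then show ?case by (simp add: norm_mult power_add mult_ac)
  qed
  then show ?thesis using c(1) d(1) by (intro lowerI[of "c * d"]) auto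
qed

lemma lower_fst:
  assumes "lower n u" "vanishes (Suc n) (\<lambda>x. snd (u x))"
  shows "lower n (\<lambda>x. fst (u x))"
proof -
  have "lower n (\<lambda>x. (norm (u x)) + - norm (snd (u x)))"
    by (intro lower_add)
      (use assms in \<open>auto simp: lower_def vanishes_def\<close>)
  moreover have "norm (u x) - norm (snd (u x)) \<le> norm (fst (u x))" for x
    using norm_Pair_le[of "fst (u x)" "snd (u x)"] by simp
  moreover have "norm (u x) - norm (snd (u x)) \<ge> 0" for x
    using norm_snd_le_norm[of "u x"] by simp
  ultimately show ?thesis
    by (elim lower_le[where K = 1]) (auto intro: always_eventually)
qed

lemma lower_power: "lower n (\<lambda>x::'a::real_normed_div_algebra. x ^ n)"
  by (intro lowerI[of 1]) (auto simp: norm_power)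

lemma lower_const: "c \<noteq> 0 \<Longrightarrow> lower 0 (\<lambda>x. c)"
  by (intro lowerI[of "norm c"]) auto

lemma vanishes_ident: "vanishes 1 (\<lambda>x. x)"
  by (intro vanishesI[of _ 1]) auto

section \<open>Leading terms of polynomials and truncated normal forms\<close>

lemma vanishes_polynomial:
  fixes c :: "nat \<Rightarrow> 'a::real_normed_field"
  assumes "\<And>j. j < m \<Longrightarrow> c j = 0"
  shows "vanishes m (\<lambda>z::'a. \<Sum>i<n. c i * z ^ i)"
proof (rule vanishes_sum)
  fix i
  show "vanishes m (\<lambda>z. c i * z ^ i)"
  proof (cases "i < m")
    case True then show ?thesis by (simp add: assms)
  next
    case False then show ?thesis
      by (intro vanishes_cmult vanishes_mono[OF vanishes_power[OF vanishes_ident, of i]]) simp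
  qed
qed

lemma polynomial_leading_term:
  fixes c :: "nat \<Rightarrow> 'a::real_normed_field"
  assumes "\<And>j. j < m \<Longrightarrow> c j = 0" "m < n"
  shows "vanishes (Suc m) (\<lambda>z::'a. (\<Sum>i<n. c i * z ^ i) - c m * z ^ m)"
proof -
  have "(\<Sum>i<n. c i * z ^ i) - c m * z ^ m = (\<Sum>i<n. (c(m := 0)) i * z ^ i)" for z
    using assms(2) by (subst (1 2) sum.remove[of _ m]) (auto intro: sum.cong)
  moreover have "vanishes (Suc m) (\<lambda>z::'a. \<Sum>i<n. (c(m := 0)) i * z ^ i)"
    by (rule vanishes_polynomial) (use assms(1) in \<open>auto simp: less_Suc_eq\<close>)
  ultimately show ?thesis by simp
qed

lemma lower_polynomial:
  fixes c :: "nat \<Rightarrow> 'a::real_normed_field"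
  assumes "\<And>j. j < m \<Longrightarrow> c j = 0" "c m \<noteq> 0" "m < n"
  shows "lower m (\<lambda>z::'a. \<Sum>i<n. c i * z ^ i)"
proof -
  have "lower m (\<lambda>z. c m * z ^ m)"
    using lower_mult[OF lower_const[OF assms(2)] lower_power[of m]] by simp
  moreover have "vanishes (Suc m) (\<lambda>z::'a. (\<Sum>i<n. c i * z ^ i) - c m * z ^ m)"
    using assms by (intro polynomial_leading_term)
  ultimately have "lower m (\<lambda>z. c m * z ^ m + ((\<Sum>i<n. c i * z ^ i) - c m * z ^ m))" by (rule lower_add)
  then show ?thesis by simp
qed

lemma ev_leading_linear:
  assumes "order_at_least 1 f" "N \<ge> 1"
  shows "vanishes 2 (\<lambda>x. ev N f x - (coeff2 f 1 0 * fst x + coeff2 f 0 1 * snd x))"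
proof -
  define e where "e = (\<lambda>x. ev N f x - (coeff2 f 1 0 * fst x + coeff2 f 0 1 * snd x))"
  obtain K where K: "K \<ge> 0" "\<And>\<rho> x y. \<rho> \<le> 1 \<Longrightarrow> norm x \<le> \<rho> \<Longrightarrow> norm y \<le> \<rho> \<Longrightarrow> norm (e x - e y) \<le> K * \<rho> * norm (x - y)"
    using lip2_ev[OF assms(2), of f] unfolding lip2_def e_def by blast
  have e0: "e 0 = 0" using ev_0[OF assms(1)] by (simp add: e_def)
  have "\<forall>\<^sub>F x in nhds 0. norm (e x) \<le> K * norm x ^ 2"
    unfolding eventually_nhds_0_ball using K(2)[of "norm x" x 0 for x] e0
    by (intro exI[of _ 1]) (auto simp: power2_eq_square mult_ac)
  then show ?thesis unfolding e_def by (rule vanishesI)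
qed

lemma ev_fst_normal_form:
  assumes "N \<ge> 1"
  shows "ev N (fst (normal_form \<theta> a b)) x = fst x + (\<Sum>i<Suc N. a i * fst x ^ i)"
proof -
  have "coeff2 (fst (normal_form \<theta> a b)) i j = (if j = 0 then (if i = 1 then 1 else 0) + a i else 0)" for i j
    by (cases j) (auto simp: normal_form_def)
  then have "ev N (fst (normal_form \<theta> a b)) x =
      (\<Sum>j\<le>N. \<Sum>i<Suc N - j. (if j = 0 then (if i = 1 then 1 else 0) + a i else 0) * (fst x ^ i * snd x ^ j))"
    unfolding ev_def sum_triangle by simp
  also have "\<dots> = (\<Sum>j\<le>N. if j = 0 then (\<Sum>i<Suc N. ((if i = 1 then 1 else 0) + a i) * fst x ^ i) else 0)"
    by (intro sum.cong) auto
  also have "\<dots> = (\<Sum>i<Suc N. (if i = 1 then 1 else 0) * fst x ^ i) + (\<Sum>i<Suc N. a i * fst x ^ i)"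
    by (simp add: distrib_right sum.distrib del: sum.lessThan_Suc)
  also have "(\<Sum>i<Suc N. (if i = 1 then 1 else 0) * fst x ^ i) = (\<Sum>i<Suc N. if i = 1 then fst x else 0)"
    by (intro sum.cong) auto
  also have "\<dots> = fst x" using assms by (subst sum.delta) auto
  finally show ?thesis .
qed

text \<open>The sum over \<open>b\<close> stops at \<open>i < N\<close>, one earlier than the sum
  over \<open>a\<close> in the first component: the monomial \<open>b i * z^i * w\<close> has degree
  \<open>i + 1\<close>.\<close>

lemma ev_snd_normal_form:
  assumes "N \<ge> 1"
  shows "ev N (snd (normal_form \<theta> a b)) x = (multiplier \<theta> + (\<Sum>i<N. b i * fst x ^ i)) * snd x"
proof -
  have "coeff2 (snd (normal_form \<theta> a b)) i j = (if j = 1 then (if i = 0 then multiplier \<theta> else 0) + b i else 0)" for i j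
    by (auto simp: normal_form_def fps_mult_right_const_nth fps_X_nth[abs_def] fps_X_def)
  then have "ev N (snd (normal_form \<theta> a b)) x =
      (\<Sum>j\<le>N. \<Sum>i<Suc N - j. (if j = 1 then (if i = 0 then multiplier \<theta> else 0) + b i else 0) * (fst x ^ i * snd x ^ j))"
    unfolding ev_def sum_triangle by simp
  also have "\<dots> = (\<Sum>j\<le>N. if j = 1 then (\<Sum>i<N. ((if i = 0 then multiplier \<theta> else 0) + b i) * (fst x ^ i * snd x)) else 0)"
    by (intro sum.cong) auto
  also have "\<dots> = (\<Sum>i<N. (if i = 0 then multiplier \<theta> else 0) * (fst x ^ i * snd x)) + (\<Sum>i<N. b i * (fst x ^ i * snd x))"
    using assms by (simp add: distrib_right sum.distrib)
  also have "(\<Sum>i<N. (if i = 0 then multiplier \<theta> else 0) * (fst x ^ i * snd x)) = (\<Sum>i<N. if i = 0 then multiplier \<theta> * snd x else 0)"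
    by (intro sum.cong) auto
  also have "\<dots> = multiplier \<theta> * snd x" using assms by (subst sum.delta) auto
  finally show ?thesis by (simp add: distrib_right sum_distrib_right mult.assoc)
qed

lemma evm_normal_form:
  "N \<ge> 1 \<Longrightarrow> evm N (normal_form \<theta> a b) x = (fst x + (\<Sum>i<Suc N. a i * fst x ^ i),
     (multiplier \<theta> + (\<Sum>i<N. b i * fst x ^ i)) * snd x)"
  by (simp add: evm_def ev_fst_normal_form ev_snd_normal_form del: sum.lessThan_Suc)

lemma order_normal_form:
  assumes "a 0 = 0"
  shows "order_at_least 1 (fst (normal_form \<theta> a b))" "order_at_least 1 (snd (normal_form \<theta> a b))"
  using assms unfolding order_at_least_1_iff by (auto simp: normal_form_def fps_mult_right_const_nth)

text \<open>\<open>H\<close> collects the monomials divisible by \<open>w\<close>, with one factor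
  \<open>w\<close> removed. It isolates how a function changes when a point leaves the
  \<open>z\<close>-axis; its value at 0 is the coefficient of \<open>w\<close>.\<close>

lemma ev_factor_snd:
  obtains H where "lip H" "H 0 = (if N \<ge> 1 then coeff2 f 0 1 else 0)"
    "\<And>z w. ev N f (z, w) = ev N f (z, 0) + w * H (z, w)"
proof -
  define T where "T = {(i,j)\<in>triangle N. j \<ge> 1}"
  define H where "H = (\<lambda>x::C2. \<Sum>(i,j)\<in>T. coeff2 f i j * (fst x ^ i * snd x ^ (j - 1)))"
  have finT: "finite T" unfolding T_def by (rule finite_subset[OF _ finite_triangle[of N]]) auto
  have "lip H" unfolding H_def case_prod_unfold
    by (intro lip_sum lip_mult lip_const lip_power lip_fst lip_snd)
  moreover have "H 0 = (if N \<ge> 1 then coeff2 f 0 1 else 0)"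
  proof -
    have "H 0 = (\<Sum>p\<in>T. if p = (0,1) then coeff2 f 0 1 else 0)"
      unfolding H_def by (intro sum.cong) (auto simp: T_def power_0_left split: if_splits)
    also have "\<dots> = (if (0,1) \<in> T then coeff2 f 0 1 else 0)" using finT by (rule sum.delta)
    finally show ?thesis by (simp add: T_def triangle_def)
  qed
  moreover have "ev N f (z, w) = ev N f (z, 0) + w * H (z, w)" for z w
  proof -
    have sub: "T \<subseteq> triangle N" by (auto simp: T_def)
    have "ev N f (z, w) = (\<Sum>(i,j)\<in>triangle N - T. coeff2 f i j * (z ^ i * w ^ j)) + (\<Sum>(i,j)\<in>T. coeff2 f i j * (z ^ i * w ^ j))"
      unfolding ev_def by (subst sum.subset_diff[OF sub]) auto
    moreover have "ev N f (z, 0) = (\<Sum>(i,j)\<in>triangle N - T. coeff2 f i j * (z ^ i * 0 ^ j)) + (\<Sum>(i,j)\<in>T. coeff2 f i j * (z ^ i * 0 ^ j))"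
      unfolding ev_def by (subst sum.subset_diff[OF sub]) auto
    moreover have "(\<Sum>(i,j)\<in>T. coeff2 f i j * (z ^ i * 0 ^ j)) = 0"
      by (rule sum.neutral) (auto simp: T_def)
    moreover have "(\<Sum>(i,j)\<in>triangle N - T. coeff2 f i j * (z ^ i * 0 ^ j)) = (\<Sum>(i,j)\<in>triangle N - T. coeff2 f i j * (z ^ i * w ^ j))"
    proof (intro sum.cong refl, clarify)
      fix i j assume "(i,j) \<in> triangle N" "(i,j) \<notin> T"
      then have "j = 0" by (simp add: T_def)
      then show "coeff2 f i j * (z ^ i * 0 ^ j) = coeff2 f i j * (z ^ i * w ^ j)" by simp
    qed
    moreover have "(\<Sum>(i,j)\<in>T. coeff2 f i j * (z ^ i * w ^ j)) = w * H (z, w)"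
      unfolding H_def sum_distrib_left
    proof (intro sum.cong refl, clarify)
      fix i j assume "(i,j) \<in> T"
      then obtain k where "j = Suc k" by (cases j) (auto simp: T_def)
      then show "coeff2 f i j * (z ^ i * w ^ j) = w * (coeff2 f i j * (fst (z, w) ^ i * snd (z, w) ^ (j - 1)))" by simp
    qed
    ultimately show ?thesis by simp
  qed
  ultimately show thesis by (rule that)
qed

text \<open>Two normal forms of the same formal map \<open>P\<close>, together with a truncated
  transition \<open>\<Psi>\<close> between their coordinates. The locale is instantiated in both
  directions and with different \<open>N\<close>.\<close>

locale formal_transition =
  fixes \<theta> :: real and a b a' b' :: "nat \<Rightarrow> complex" and P \<Phi> \<Phi>' \<Psi> :: fmap2 and N :: nat
  assumes conj: "fcomp P \<Phi> = fcomp \<Phi> (normal_form \<theta> a b)"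
    and conj': "fcomp P \<Phi>' = fcomp \<Phi>' (normal_form \<theta> a' b')"
    and coord: "formal_coordinate_change \<Phi>" "formal_coordinate_change \<Phi>'"
    and a01: "\<And>j. j < 2 \<Longrightarrow> a j = 0" "\<And>j. j < 2 \<Longrightarrow> a' j = 0"
    and b0: "b 0 = 0" "b' 0 = 0"
    and mult_ne_1: "multiplier \<theta> \<noteq> 1"
    and N: "N \<ge> 1"
    and order_at_least\<Psi>: "order_at_least 1 (fst \<Psi>)" "order_at_least 1 (snd \<Psi>)"
    and transition: "vanishes (Suc N) (\<lambda>x. evm N \<Phi> (evm N \<Psi> x) - evm N \<Phi>' x)"
begin

abbreviation "u \<equiv> evm N \<Psi>"
abbreviation "ml \<equiv> multiplier \<theta>"
abbreviation "A z \<equiv> \<Sum>i<Suc N. a i * z ^ i"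
abbreviation "A' z \<equiv> \<Sum>i<Suc N. a' i * z ^ i"
abbreviation "B z \<equiv> \<Sum>i<N. b i * z ^ i"
abbreviation "B' z \<equiv> \<Sum>i<N. b' i * z ^ i"
abbreviation "Q x \<equiv> (fst x + A (fst x), (ml + B (fst x)) * snd x)"
abbreviation "Q' x \<equiv> (fst x + A' (fst x), (ml + B' (fst x)) * snd x)"

lemma u_conjugates: "vanishes (Suc N) (\<lambda>x. Q (u x) - u (Q' x))"
proof -
  have "vanishes (Suc N) (\<lambda>x. evm N (normal_form \<theta> a b) (u x) - u (evm N (normal_form \<theta> a' b') x))"
    by (intro transition_conjugates[OF conj conj' coord] order_normal_form N order_at_least\<Psi> transition) (auto simp: a01)
  then show ?thesis using N by (simp add: evm_normal_form del: sum.lessThan_Suc)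
qed

lemma vanishes_u: "vanishes 1 u"
  by (intro vanishes_evm order_at_least\<Psi>)

text \<open>\<open>\<Phi> \<circ> u\<close> differs from \<open>\<Phi>'\<close> by terms of order
  above 1, and \<open>\<Phi>'\<close> is bounded below by a multiple of the norm. As
  \<open>\<Phi>\<close> is Lipschitz, the bound passes to \<open>u\<close>.\<close>

lemma lower_u: "lower 1 u"
proof -
  obtain r c where rc: "0 < r" "r < 1" "c > 0"
    "\<And>x y. norm x \<le> r \<Longrightarrow> norm y \<le> r \<Longrightarrow> norm (x - y) \<le> c * norm (evm N \<Phi>' x - evm N \<Phi>' y)"
    using evm_lower_lipschitz[OF coord(2) N] by blast
  have z: "evm N \<Phi>' 0 = 0" "evm N \<Phi> 0 = 0"
    using order_coordinate_change coord by (auto simp: evm_def ev_0 zero_prod_def[symmetric])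
  have 1: "lower 1 (evm N \<Phi>')"
  proof (rule lower_le[of 1 "\<lambda>x. x"])
    show "\<forall>\<^sub>F x in nhds 0. norm x \<le> c * norm (evm N \<Phi>' x)"
      unfolding eventually_nhds_0_ball using rc(1) rc(4)[of _ 0] z by (intro exI[of _ r]) auto
  qed (use rc in \<open>auto intro: lowerI[of 1]\<close>)
  have "lower 1 (\<lambda>x. evm N \<Phi>' x + (evm N \<Phi> (u x) - evm N \<Phi>' x))"
    by (rule lower_add[OF 1]) (rule vanishes_mono[OF transition], use N in simp)
  then have 2: "lower 1 (\<lambda>x. evm N \<Phi> (u x))" by simp
  obtain K where K: "K \<ge> 0" "\<And>x y. norm x \<le> 1 \<Longrightarrow> norm y \<le> 1 \<Longrightarrow> norm (evm N \<Phi> x - evm N \<Phi> y) \<le> K * norm (x - y)"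
    using lip_evm[of N \<Phi>] unfolding lip_def by blast
  have "(u \<longlongrightarrow> 0) (nhds 0)" using vanishes_u vanishes_tendsto[of 0] by auto
  then have "\<forall>\<^sub>F x in nhds 0. dist (u x) 0 < 1" by (rule tendstoD) simp
  then have "\<forall>\<^sub>F x in nhds 0. norm (evm N \<Phi> (u x)) \<le> (K + 1) * norm (u x)"
  proof eventually_elim
    case (elim x)
    then have "norm (evm N \<Phi> (u x)) \<le> K * norm (u x)" using K(2)[of "u x" 0] z by simp
    then show ?case by (simp add: distrib_right add_increasing2)
  qed
  then show ?thesis by (rule lower_le[OF 2]) (use K in simp)
qed

lemma vanishes_A': "(\<And>j. j < m \<Longrightarrow> a' j = 0) \<Longrightarrow> vanishes m A'"
  and vanishes_B: "(\<And>j. j < m \<Longrightarrow> b j = 0) \<Longrightarrow> vanishes m B" and vanishes_B': "(\<And>j. j < m \<Longrightarrow> b' j = 0) \<Longrightarrow> vanishes m B'"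
  by (intro vanishes_polynomial; blast)+

lemma lip_B: "lip B"
  by (intro lip_sum lip_mult lip_const lip_power) (auto simp: lip_def intro!: exI[of _ 1])

lemma vanishes_B1: "vanishes 1 B" "vanishes 1 B'"
  by (intro vanishes_B vanishes_B'; simp add: b0)+

abbreviation (input) "x0 t \<equiv> (t :: complex, 0 :: complex)"

lemma vanishes_x0: "vanishes 1 x0"
  by (intro vanishes_Pair vanishes_ident vanishes_zero)

lemma vanishes_Q': "vanishes 1 Q'"
  using vanishes_compose[OF vanishes_A'[of 2] vanishes_fst] vanishes_compose[OF vanishes_B1(2) vanishes_fst] a01
  by (intro vanishes_Pair vanishes_add vanishes_fst vanishes_bounded_mult[OF vanishes_add[OF vanishes_const]] vanishes_snd)
    (auto intro: vanishes_mono)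

lemma lower_x0: "lower 1 x0"
  by (intro lowerI[of 1]) (auto simp: norm_Pair)

text \<open>\<open>Q'\<close> moves the point \<open>(t, 0)\<close> by O(t^m'), hence
  \<open>Q\<close> moves its image under \<open>u\<close> by no more. In the second component this
  displacement is \<open>(ml - 1 + B) * snd\<close>, whose first factor stays away from 0 because
  the multiplier is not 1. So the image hugs the \<open>z\<close>-axis, and the lower bound on
  \<open>u\<close> falls to its first component.\<close>

lemma axis_image:
  assumes a': "\<And>j. j < m' \<Longrightarrow> a' j = 0" and m': "m' \<le> Suc N" "2 \<le> m'"
  shows "vanishes m' (\<lambda>t. snd (u (x0 t)))" "vanishes m' (\<lambda>t. A (fst (u (x0 t))))" "lower 1 (\<lambda>t. fst (u (x0 t)))"
proof -
  have v: "vanishes 1 (\<lambda>t. u (x0 t))" by (rule vanishes_compose[OF vanishes_u vanishes_x0])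
  have vf: "vanishes 1 (\<lambda>t. fst (u (x0 t)))" using v unfolding vanishes_prod_iff by simp
  have "vanishes (Suc N) (\<lambda>t. Q (u (x0 t)) - u (Q' (x0 t)))"
    using vanishes_compose[OF u_conjugates vanishes_x0] .
  then have 1: "vanishes m' (\<lambda>t. Q (u (x0 t)) - u (Q' (x0 t)))" by (rule vanishes_mono) (fact m')
  have "vanishes m' (\<lambda>t. Q' (x0 t) - x0 t)"
    using vanishes_A'[OF a'] by (auto simp: vanishes_prod_iff)
  then have 2: "vanishes m' (\<lambda>t. u (Q' (x0 t)) - u (x0 t))"
    by (intro vanishes_lip_diff[OF lip_evm] vanishes_compose[OF vanishes_Q' vanishes_x0] vanishes_x0)
  have 3: "vanishes m' (\<lambda>t. Q (u (x0 t)) - u (x0 t))" using vanishes_add[OF 1 2] by simp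
  then show "vanishes m' (\<lambda>t. A (fst (u (x0 t))))" unfolding vanishes_prod_iff by simp
  have 4: "vanishes m' (\<lambda>t. (ml - 1 + B (fst (u (x0 t)))) * snd (u (x0 t)))"
    using 3 unfolding vanishes_prod_iff by (simp add: algebra_simps)
  have "lower 0 (\<lambda>t. (ml - 1) + B (fst (u (x0 t))))"
    using mult_ne_1 vanishes_compose[OF vanishes_B1(1) vf] by (intro lower_add lower_const) auto
  then obtain c where c: "c > 0" "\<forall>\<^sub>F t in nhds 0. c * norm t ^ 0 \<le> norm ((ml - 1) + B (fst (u (x0 t))))" by (rule lowerE)
  have "\<forall>\<^sub>F t in nhds 0. norm (snd (u (x0 t))) \<le> 1 / c * norm ((ml - 1 + B (fst (u (x0 t)))) * snd (u (x0 t)))"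
    using c(2)
  proof eventually_elim
    case (elim t)
    then have "c * norm (snd (u (x0 t))) \<le> norm (ml - 1 + B (fst (u (x0 t)))) * norm (snd (u (x0 t)))"
      by (intro mult_right_mono) auto
    then show ?case using c(1) unfolding norm_mult by (simp add: pos_le_divide_eq mult_ac)
  qed
  then show 5: "vanishes m' (\<lambda>t. snd (u (x0 t)))"
    by (rule vanishes_le[OF 4]) (use c in simp)
  have "lower 1 (\<lambda>t. u (x0 t))" by (rule lower_compose[OF lower_u lower_x0 vanishes_x0])
  then show "lower 1 (\<lambda>t. fst (u (x0 t)))"
    by (rule lower_fst) (rule vanishes_mono[OF 5], use m' in simp)
qed

text \<open>The displacement \<open>Q x - x\<close> along the image of the \<open>z\<close>-axis detects the order \<open>\<nu>\<close>.\<close>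

lemma order_le:
  assumes "\<And>j. j < m' \<Longrightarrow> a' j = 0" "m' \<le> Suc N" "2 \<le> m'"
    and "\<And>j. j < m \<Longrightarrow> a j = 0" "a m \<noteq> 0" "m \<le> N"
  shows "m' \<le> m"
proof -
  note ax = axis_image[OF assms(1-3)]
  have vf: "vanishes 1 (\<lambda>t. fst (u (x0 t)))" using vanishes_compose[OF vanishes_u vanishes_x0] unfolding vanishes_prod_iff by simp
  have "lower m A" using assms(4-6) by (intro lower_polynomial) auto
  from lower_compose[OF this ax(3) vf] have "lower m (\<lambda>t. A (fst (u (x0 t))))" .
  then show ?thesis using ax(2) by (rule lower_vanishes)
qed

text \<open>The second components of \<open>Q \<circ> u\<close> and \<open>u \<circ> Q'\<close> are compared at the points \<open>(t, 0)\<close> and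
  \<open>(t, t^m)\<close>: their difference is linear in \<open>t^m\<close> up to negligible terms, and the factors are
  the transverse multipliers \<open>B\<close> and \<open>B'\<close>.\<close>

lemma multiplier_order:
  assumes a': "\<And>j. j < m \<Longrightarrow> a' j = 0" and m: "2 \<le> m" "N = 2 * m"
    and b': "\<And>j. j < m - 1 \<Longrightarrow> b' j = 0" and j: "j < m - 1"
  shows "b j = 0"
proof (rule ccontr)
  assume "b j \<noteq> 0"
  define \<mu> where "\<mu> = (LEAST j. b j \<noteq> 0)"
  have \<mu>: "b \<mu> \<noteq> 0" "\<mu> \<le> j" "\<And>i. i < \<mu> \<Longrightarrow> b i = 0"
    unfolding \<mu>_def using \<open>b j \<noteq> 0\<close> by (rule LeastI, rule Least_le, blast dest: not_less_Least)
  have mN: "m \<le> Suc N" using m by simp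
  note ax = axis_image[OF a' mN m(1)]
  obtain H where H: "lip H" "H 0 = (if N \<ge> 1 then coeff2 (snd \<Psi>) 0 1 else 0)"
    "\<And>z w. ev N (snd \<Psi>) (z, w) = ev N (snd \<Psi>) (z, 0) + w * H (z, w)"
    using ev_factor_snd[of N "snd \<Psi>"] by blast
  have lin: "vanishes 2 (\<lambda>x. fst (u x) - (coeff2 (fst \<Psi>) 1 0 * fst x + coeff2 (fst \<Psi>) 0 1 * snd x))"
      "vanishes 2 (\<lambda>x. snd (u x) - (coeff2 (snd \<Psi>) 1 0 * fst x + coeff2 (snd \<Psi>) 0 1 * snd x))"
    unfolding evm_def fst_conv snd_conv by (intro ev_leading_linear order_at_least\<Psi> N)+
  \<comment> \<open>The image of the \<open>z\<close>-axis has second component O(t^2), which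
    excludes a linear term in \<open>z\<close>. The linear part of \<open>\<Psi>\<close> is thus
    triangular, and both diagonal entries turn out nonzero.\<close>
  have f10: "coeff2 (snd \<Psi>) 1 0 = 0"
  proof (rule ccontr)
    assume nz: "coeff2 (snd \<Psi>) 1 0 \<noteq> 0"
    have "lower 1 (\<lambda>t::complex. coeff2 (snd \<Psi>) 1 0 * t)"
      using nz by (intro lowerI[of "norm (coeff2 (snd \<Psi>) 1 0)"]) (auto simp: norm_mult)
    moreover have "vanishes 2 (\<lambda>t. snd (u (x0 t)))" by (rule vanishes_mono[OF ax(1)]) (use m in auto)
    moreover have "vanishes 2 (\<lambda>t. snd (u (x0 t)) - coeff2 (snd \<Psi>) 1 0 * t)"
      using vanishes_compose[OF lin(2) vanishes_x0] by simp
    ultimately have "vanishes 2 (\<lambda>t::complex. coeff2 (snd \<Psi>) 1 0 * t)"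
      using vanishes_diff by fastforce
    moreover note \<open>lower 1 (\<lambda>t. coeff2 (snd \<Psi>) 1 0 * t)\<close>
    ultimately show False using lower_vanishes[of 1 "\<lambda>t::complex. coeff2 (snd \<Psi>) 1 0 * t" 2] by simp
  qed
  have g10: "coeff2 (fst \<Psi>) 1 0 \<noteq> 0"
  proof
    assume "coeff2 (fst \<Psi>) 1 0 = 0"
    then have "vanishes 2 (\<lambda>t. fst (u (x0 t)))" using vanishes_compose[OF lin(1) vanishes_x0] by simp
    from lower_vanishes[OF ax(3) this] show False by simp
  qed
  have f01: "coeff2 (snd \<Psi>) 0 1 \<noteq> 0"
  proof
    assume z: "coeff2 (snd \<Psi>) 0 1 = 0"
    \<comment> \<open>This direction is annihilated by the first row of the linear part. If the
      second row vanished too, \<open>u\<close> would be O(t^2) along it, against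
      \<open>lower_u\<close>.\<close>
    define k where "k = (\<lambda>t. (- coeff2 (fst \<Psi>) 0 1 * t, coeff2 (fst \<Psi>) 1 0 * t))"
    have vk: "vanishes 1 k" unfolding k_def by (intro vanishes_Pair vanishes_cmult vanishes_ident)
    have "lower 1 k"
    proof (rule lower_le[where K = 1])
      show "lower 1 (\<lambda>t. coeff2 (fst \<Psi>) 1 0 * t)"
        using g10 by (intro lowerI[of "norm (coeff2 (fst \<Psi>) 1 0)"]) (auto simp: norm_mult)
      show "\<forall>\<^sub>F t in nhds 0. norm (coeff2 (fst \<Psi>) 1 0 * t) \<le> 1 * norm (k t)"
        by (intro always_eventually allI) (auto simp: k_def norm_snd_le)
    qed simp
    then have "lower 1 (\<lambda>t. u (k t))" by (rule lower_compose[OF lower_u _ vk])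
    moreover have "vanishes 2 (\<lambda>t. u (k t))"
      using vanishes_compose[OF lin(1) vk] vanishes_compose[OF lin(2) vk] f10 z
      unfolding vanishes_prod_iff by (simp add: k_def)
    ultimately show False using lower_vanishes[of 1 "\<lambda>t. u (k t)" 2] by simp
  qed
  have H0: "H 0 \<noteq> 0" using H(2) f01 N by simp
  \<comment> \<open>The exponent \<open>m\<close> balances the errors. In the difference below, the
    term with \<open>H (x1 t) - H (Q' (x1 t))\<close> and the one with
    \<open>B (p (x1 t)) - B (p (x0 t))\<close> have order \<open>2 * m\<close>, the term with
    \<open>B'\<close> has order \<open>2 * m - 1\<close>, and \<open>N = 2 * m\<close> makes the
    truncation error negligible. The remaining term has exact order \<open>m + \<mu>\<close>, which
    forces \<open>\<mu> \<ge> m - 1\<close>.\<close>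
  define x1 where "x1 = (\<lambda>t::complex. (t, t ^ m))"
  have v1: "vanishes 1 x1" unfolding x1_def
    using m by (intro vanishes_Pair vanishes_ident vanishes_mono[OF vanishes_power[OF vanishes_ident], of _ m]) simp
  have vm: "vanishes m (\<lambda>t::complex. t ^ m)" by (intro vanishes_power vanishes_ident)
  define p where "p = (\<lambda>x. fst (u x))"
  define q where "q = (\<lambda>x. snd (u x))"
  have lip_p: "lip p" unfolding p_def evm_def fst_conv by (rule lip_ev)
  have vp: "vanishes 1 p" "vanishes 1 q" using vanishes_u unfolding vanishes_prod_iff p_def q_def by auto
  have qH: "q (z, w) = q (z, 0) + w * H (z, w)" for z w
    unfolding q_def evm_def snd_conv by (rule H(3))
  have E: "vanishes (Suc N) (\<lambda>x. (ml + B (p x)) * q x - q (Q' x))"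
    using u_conjugates unfolding vanishes_prod_iff by (simp add: p_def q_def)
  have "vanishes (m + m) (\<lambda>t. ((ml + B (p (x1 t))) * q (x1 t) - q (Q' (x1 t))) - ((ml + B (p (x0 t))) * q (x0 t) - q (Q' (x0 t))))"
    using m by (intro vanishes_diff vanishes_mono[OF vanishes_compose[OF E v1]] vanishes_mono[OF vanishes_compose[OF E vanishes_x0]]) auto
  moreover have "((ml + B (p (x1 t))) * q (x1 t) - q (Q' (x1 t))) - ((ml + B (p (x0 t))) * q (x0 t) - q (Q' (x0 t)))
    = t ^ m * B (p (x1 t)) * H (x1 t) + t ^ m * (ml * (H (x1 t) - H (Q' (x1 t)))) - t ^ m * (B' t * H (Q' (x1 t)))
      + (B (p (x1 t)) - B (p (x0 t))) * q (x0 t)" for t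
  proof -
    have e1: "q (x1 t) = q (x0 t) + t ^ m * H (x1 t)" unfolding x1_def by (rule qH)
    have e2: "q (Q' (x1 t)) = q (Q' (x0 t)) + (ml + B' t) * t ^ m * H (Q' (x1 t))"
      unfolding x1_def fst_conv snd_conv mult_zero_right by (rule qH)
    have alg: "((l + B1) * (q0 + T * H1) - (qQ + (l + b1) * T * HQ)) - ((l + B0) * q0 - qQ)
      = T * B1 * H1 + T * (l * (H1 - HQ)) - T * (b1 * HQ) + (B1 - B0) * q0" for l B1 B0 b1 q0 qQ T H1 HQ :: complex
      by (simp add: algebra_simps)
    show ?thesis unfolding e1 e2 by (rule alg)
  qed
  ultimately have S: "vanishes (m + m) (\<lambda>t. t ^ m * B (p (x1 t)) * H (x1 t) + t ^ m * (ml * (H (x1 t) - H (Q' (x1 t)))) - t ^ m * (B' t * H (Q' (x1 t)))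
      + (B (p (x1 t)) - B (p (x0 t))) * q (x0 t))" by simp
  have vQx1: "vanishes 1 (\<lambda>t. Q' (x1 t))" by (rule vanishes_compose[OF vanishes_Q' v1])
  have "vanishes m (\<lambda>t. x1 t - Q' (x1 t))"
  proof -
    have "vanishes m (\<lambda>t. (ml + B' t - 1) * t ^ m)"
      by (intro vanishes_bounded_mult vanishes_diff vanishes_add vanishes_const vanishes_mono[OF vanishes_B1(2)] vm) simp
    then have "vanishes m (\<lambda>t. - ((ml + B' t - 1) * t ^ m))" by (rule vanishes_uminus)
    moreover have "vanishes m (\<lambda>t. - A' t)" by (intro vanishes_uminus vanishes_A' a')
    ultimately show ?thesis unfolding vanishes_prod_iff by (simp add: x1_def algebra_simps del: sum.lessThan_Suc)
  qed
  then have T2: "vanishes (m + m) (\<lambda>t. t ^ m * (ml * (H (x1 t) - H (Q' (x1 t)))))"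
    by (intro vanishes_mult vm vanishes_cmult vanishes_lip_diff[OF H(1)] v1 vQx1)
  have vH: "vanishes 0 H"
  proof -
    obtain C where "C \<ge> 0" "\<And>x. norm x \<le> 1 \<Longrightarrow> norm (H x) \<le> C" using lip_bounded[OF H(1)] by blast
    then show ?thesis
      by (intro vanishesI[of _ C]) (auto simp: eventually_nhds_0_ball intro!: exI[of _ 1])
  qed
  have T3: "vanishes (m + ((m - 1) + 0)) (\<lambda>t. t ^ m * (B' t * H (Q' (x1 t))))"
    by (intro vanishes_mult vm vanishes_B' vanishes_compose[OF vH vQx1]) (use b' in auto)
  have "vanishes m (\<lambda>t. x1 t - x0 t)" using vm unfolding vanishes_prod_iff by (simp add: x1_def)
  then have pd: "vanishes m (\<lambda>t. p (x1 t) - p (x0 t))"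
    by (intro vanishes_lip_diff[OF lip_p] v1 vanishes_x0)
  have T4: "vanishes (m + m) (\<lambda>t. (B (p (x1 t)) - B (p (x0 t))) * q (x0 t))"
    using ax(1) by (intro vanishes_mult vanishes_lip_diff[OF lip_B] pd vanishes_compose[OF vp(1)] v1 vanishes_x0) (simp add: q_def)
  let ?S = "\<lambda>t. t ^ m * B (p (x1 t)) * H (x1 t) + t ^ m * (ml * (H (x1 t) - H (Q' (x1 t)))) - t ^ m * (B' t * H (Q' (x1 t)))
      + (B (p (x1 t)) - B (p (x0 t))) * q (x0 t)"
  have "vanishes (m + (m - 1)) (\<lambda>t. ?S t - t ^ m * (ml * (H (x1 t) - H (Q' (x1 t)))) + t ^ m * (B' t * H (Q' (x1 t)))
      - (B (p (x1 t)) - B (p (x0 t))) * q (x0 t))"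
    by (intro vanishes_add vanishes_diff vanishes_mono[OF S] vanishes_mono[OF T2] vanishes_mono[OF T3] vanishes_mono[OF T4]) auto
  then have up: "vanishes (m + (m - 1)) (\<lambda>t. t ^ m * B (p (x1 t)) * H (x1 t))" by simp
  have "lower 1 (\<lambda>t. p (x0 t) + (p (x1 t) - p (x0 t)))"
    using m(1) ax(3) by (intro lower_add vanishes_mono[OF pd]) (auto simp: p_def)
  then have lp: "lower 1 (\<lambda>t. p (x1 t))" by simp
  have "lower \<mu> B" using \<mu> j m by (intro lower_polynomial) auto
  then have lB: "lower \<mu> (\<lambda>t. B (p (x1 t)))"
    by (rule lower_compose[OF _ lp vanishes_compose[OF vp(1) v1]])
  have "lower 0 (\<lambda>t. H 0 + (H (x1 t) - H 0))"
    by (intro lower_add lower_const[OF H0] vanishes_lip_diff[OF H(1)]) (use v1 in auto)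
  then have "lower 0 (\<lambda>t. H (x1 t))" by simp
  then have "lower (m + \<mu> + 0) (\<lambda>t. t ^ m * B (p (x1 t)) * H (x1 t))"
    by (intro lower_mult lower_power lB)
  from lower_vanishes[OF this up] show False using \<mu>(2) j by simp
qed

end

text \<open>\<open>order_le\<close>, used in both directions with the normal forms exchanged, gives
  equal orders \<open>m = m'\<close>. Only then are the thresholds for \<open>b\<close> and
  \<open>b'\<close> the same and \<open>multiplier_order\<close> applicable.\<close>

lemma normal_form_separating_invariant:
  assumes nf: "has_normal_form \<theta> F a b" "has_normal_form \<theta> F a' b'"
    and mult: "multiplier \<theta> \<noteq> 1"
    and a: "\<And>j. j < m \<Longrightarrow> a j = 0" "a m \<noteq> 0"
    and a': "\<And>j. j < m' \<Longrightarrow> a' j = 0" "a' m' \<noteq> 0"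
    and b': "\<And>j. j < m' - 1 \<Longrightarrow> b' j = 0"
    and j: "j < m - 1"
  shows "b j = 0"
proof -
  obtain \<Phi> where \<Phi>: "formal_coordinate_change \<Phi>" "fcomp (taylor_map F) \<Phi> = fcomp \<Phi> (normal_form \<theta> a b)"
    using nf(1) unfolding has_normal_form_def formally_conjugate_def by blast
  obtain \<Phi>' where \<Phi>': "formal_coordinate_change \<Phi>'" "fcomp (taylor_map F) \<Phi>' = fcomp \<Phi>' (normal_form \<theta> a' b')"
    using nf(2) unfolding has_normal_form_def formally_conjugate_def by blast
  have low: "a j = 0" "a' j = 0" if "j < 2" for j using nf that by (auto simp: has_normal_form_def)
  have b0: "b 0 = 0" "b' 0 = 0" using nf by (auto simp: has_normal_form_def)
  have m2: "2 \<le> m" "2 \<le> m'" using a(2) a'(2) low not_less by blast+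
  have "m' \<le> m"
  proof -
    define N where "N = max m m'"
    have N: "N \<ge> 1" using m2 by (simp add: N_def)
    obtain \<Psi> where \<Psi>: "order_at_least 1 (fst \<Psi>)" "order_at_least 1 (snd \<Psi>)" "vanishes (Suc N) (\<lambda>x. evm N \<Phi> (evm N \<Psi> x) - evm N \<Phi>' x)"
      using ex_polynomial_transition[OF \<Phi>(1) \<Phi>'(1) N] by blast
    interpret formal_transition \<theta> a b a' b' "taylor_map F" \<Phi> \<Phi>' \<Psi> N
      by unfold_locales (use \<Phi> \<Phi>' low b0 mult N \<Psi> in auto)
    show ?thesis by (rule order_le[OF a'(1)]) (use a m2 in \<open>auto simp: N_def\<close>)
  qed
  moreover have "m \<le> m'"
  proof -
    define N where "N = max m m'"
    have N: "N \<ge> 1" using m2 by (simp add: N_def)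
    obtain \<Psi> where \<Psi>: "order_at_least 1 (fst \<Psi>)" "order_at_least 1 (snd \<Psi>)" "vanishes (Suc N) (\<lambda>x. evm N \<Phi>' (evm N \<Psi> x) - evm N \<Phi> x)"
      using ex_polynomial_transition[OF \<Phi>'(1) \<Phi>(1) N] by blast
    interpret formal_transition \<theta> a' b' a b "taylor_map F" \<Phi>' \<Phi> \<Psi> N
      by unfold_locales (use \<Phi> \<Phi>' low b0 mult N \<Psi> in auto)
    show ?thesis by (rule order_le[OF a(1)]) (use a' m2 in \<open>auto simp: N_def\<close>)
  qed
  ultimately have mm: "m' = m" by simp
  define N where "N = 2 * m"
  have N: "N \<ge> 1" using m2 by (simp add: N_def)
  obtain \<Psi> where \<Psi>: "order_at_least 1 (fst \<Psi>)" "order_at_least 1 (snd \<Psi>)" "vanishes (Suc N) (\<lambda>x. evm N \<Phi> (evm N \<Psi> x) - evm N \<Phi>' x)"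
    using ex_polynomial_transition[OF \<Phi>(1) \<Phi>'(1) N] by blast
  interpret formal_transition \<theta> a b a' b' "taylor_map F" \<Phi> \<Phi>' \<Psi> N
    by unfold_locales (use \<Phi> \<Phi>' low b0 mult N \<Psi> in auto)
  show ?thesis
    by (rule multiplier_order[of m]) (use a' b' m2 j mm in \<open>auto simp: N_def\<close>)
qed

section \<open>The germ in truncated normal coordinates\<close>

lemma germ_conjugate:
  assumes F: "holomorphic2_on F W" "open W" "0 \<in> W"
    and \<Phi>: "fcomp (taylor_map F) \<Phi> = fcomp \<Phi> Q" "formal_coordinate_change \<Phi>" "order_at_least 1 (fst Q)" "order_at_least 1 (snd Q)"
  shows "vanishes (Suc N) (\<lambda>x. F (evm N \<Phi> x) - evm N \<Phi> (evm N Q x))"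
proof -
  have "vanishes (Suc N) (\<lambda>x. F x - evm N (taylor_map F) x)"
    using hol2_jet[OF holomorphic2_on_imp_hol2(1)[OF F(1)] F(2,3), of N] hol2_jet[OF holomorphic2_on_imp_hol2(2)[OF F(1)] F(2,3), of N]
    unfolding vanishes_prod_iff by (simp add: jet_def evm_def taylor_map_def)
  from vanishes_compose[OF this vanishes_evm[OF order_coordinate_change[OF \<Phi>(2)]], of N]
  have "vanishes (Suc N) (\<lambda>x. F (evm N \<Phi> x) - evm N (taylor_map F) (evm N \<Phi> x))" .
  from vanishes_add[OF this evm_conjugate[OF \<Phi>]] show ?thesis by simp
qed

text \<open>The image of a small ball under \<open>evm N \<Phi>\<close> is open by injectivity and
  invariance of domain, so it contains the value of \<open>F\<close> near 0, whose preimage is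
  \<open>y\<close>. The lower Lipschitz bound turns the error after \<open>evm N \<Phi>\<close> into
  one before it. Thus \<open>F\<close> acts in the new coordinates although no inverse map is
  defined.\<close>

lemma local_lift:
  assumes F: "holomorphic2_on F W" "open W" "0 \<in> W"
    and \<Phi>: "fcomp (taylor_map F) \<Phi> = fcomp \<Phi> Q" "formal_coordinate_change \<Phi>" "order_at_least 1 (fst Q)" "order_at_least 1 (snd Q)"
    and N: "N \<ge> 1"
  obtains r c C \<delta> where "0 < r" "r < 1" "c > 0" "C > 0" "\<delta> > 0"
    "\<And>x y. norm x \<le> r \<Longrightarrow> norm y \<le> r \<Longrightarrow> norm (x - y) \<le> c * norm (evm N \<Phi> x - evm N \<Phi> y)"
    "\<And>x. norm x < \<delta> \<Longrightarrow> \<exists>y. norm y < r \<and> F (evm N \<Phi> x) = evm N \<Phi> y \<and> norm (y - evm N Q x) \<le> C * norm x ^ Suc N"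
proof -
  let ?\<phi> = "evm N \<Phi>" and ?Q = "evm N Q"
  obtain r c where rc: "0 < r" "r < 1" "c > 0"
    "\<And>x y. norm x \<le> r \<Longrightarrow> norm y \<le> r \<Longrightarrow> norm (x - y) \<le> c * norm (?\<phi> x - ?\<phi> y)"
    using evm_lower_lipschitz[OF \<Phi>(2) N] by blast
  have inj: "inj_on ?\<phi> (ball 0 r)"
  proof (rule inj_onI)
    fix x y assume "x \<in> ball 0 r" "y \<in> ball 0 r" "?\<phi> x = ?\<phi> y"
    then show "x = y" using rc(4)[of x y] by simp
  qed
  have "continuous_on (ball 0 r) ?\<phi>"
    by (rule continuous_on_subset[OF lip_continuous_on[OF lip_evm]]) (use rc in auto)
  then have op: "open (?\<phi> ` ball 0 r)" using inj by (intro invariance_of_domain) auto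
  have \<phi>0: "?\<phi> 0 = 0" using order_coordinate_change[OF \<Phi>(2)] by (simp add: evm_def ev_0 zero_prod_def[symmetric])
  have v\<phi>: "vanishes 1 ?\<phi>" by (intro vanishes_evm order_coordinate_change \<Phi>)
  have vQ: "vanishes 1 ?Q" by (intro vanishes_evm \<Phi>)
  note E = germ_conjugate[OF F \<Phi>, of N]
  have "vanishes 1 (\<lambda>x. (F (?\<phi> x) - ?\<phi> (?Q x)) + ?\<phi> (?Q x))"
    by (intro vanishes_add vanishes_mono[OF E] vanishes_compose[OF v\<phi> vQ]) simp
  then have "((\<lambda>x. F (?\<phi> x)) \<longlongrightarrow> 0) (nhds 0)" using vanishes_tendsto[of 0] by simp
  moreover have "0 \<in> ?\<phi> ` ball 0 r" using \<phi>0 rc(1) by (intro image_eqI[of _ _ 0]) auto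
  ultimately have e1: "\<forall>\<^sub>F x in nhds 0. F (?\<phi> x) \<in> ?\<phi> ` ball 0 r" using op by (auto dest: topological_tendstoD)
  have "(?Q \<longlongrightarrow> 0) (nhds 0)" using vQ vanishes_tendsto[of 0] by auto
  then have e2: "\<forall>\<^sub>F x in nhds 0. dist (?Q x) 0 < r" using rc(1) by (rule tendstoD)
  obtain C where C: "C > 0" "\<forall>\<^sub>F x in nhds 0. norm (F (?\<phi> x) - ?\<phi> (?Q x)) \<le> C * norm x ^ Suc N"
    using E by (rule vanishesE)
  from e1 e2 C(2) have "\<forall>\<^sub>F x in nhds 0. \<exists>y. norm y < r \<and> F (?\<phi> x) = ?\<phi> y \<and> norm (y - ?Q x) \<le> (c * C) * norm x ^ Suc N"
  proof eventually_elim
    case (elim x)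
    then obtain y where y: "norm y < r" "F (?\<phi> x) = ?\<phi> y" by auto
    have "norm (y - ?Q x) \<le> c * norm (?\<phi> y - ?\<phi> (?Q x))" using elim(2) y(1) by (intro rc) auto
    also have "\<dots> \<le> c * (C * norm x ^ Suc N)" using elim(3) y(2) rc(3) by (intro mult_left_mono) auto
    finally show ?case using y by (intro exI[of _ y]) (simp add: mult.assoc)
  qed
  then obtain \<delta> where "\<delta> > 0" "\<And>x. norm x < \<delta> \<Longrightarrow> \<exists>y. norm y < r \<and> F (?\<phi> x) = ?\<phi> y \<and> norm (y - ?Q x) \<le> (c * C) * norm x ^ Suc N"
    unfolding eventually_nhds_0_ball by blast
  then show thesis using rc C(1) by (intro that[of r c "c * C" \<delta>]) auto
qed

text \<open>\<open>h\<close> measures progress: each step raises it by at least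
  \<open>\<delta>\<close>, and by \<open>small\<close> and \<open>large\<close> a point
  \<open>G p\<close> is near 0 exactly when \<open>h p\<close> is large. Superlevel sets of
  \<open>h\<close> are therefore both forward invariant and the traces of neighbourhoods of
  0.\<close>

lemma basin_of_attraction_image:
  fixes F :: "C2 \<Rightarrow> C2" and G :: "'p \<Rightarrow> C2" and h :: "'p \<Rightarrow> real"
  assumes W: "open W" "0 \<in> W"
    and U: "D \<noteq> {}" "open (G ` D)" "inj_on G D" "G ` D \<subseteq> W"
    and step: "\<And>p. p \<in> D \<Longrightarrow> \<exists>p'\<in>D. F (G p) = G p' \<and> h p + \<delta> \<le> h p'" and \<delta>: "\<delta> > 0"
    and small: "\<And>e. e > 0 \<Longrightarrow> \<exists>R. \<forall>p\<in>D. h p > R \<longrightarrow> norm (G p) < e"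
    and large: "\<And>R. \<exists>e>0. \<forall>p\<in>D. norm (G p) < e \<longrightarrow> h p > R"
  shows "basin_of_attraction W F (G ` D)"
proof -
  have orbit: "\<exists>p'\<in>D. (F ^^ n) (G p) = G p' \<and> h p + real n * \<delta> \<le> h p'" if "p \<in> D" for p n
  proof (induction n)
    case 0 then show ?case using that by auto
  next
    case (Suc n)
    then obtain p' where p': "p' \<in> D" "(F ^^ n) (G p) = G p'" "h p + real n * \<delta> \<le> h p'" by blast
    obtain p'' where "p'' \<in> D" "F (G p') = G p''" "h p' + \<delta> \<le> h p''" using step[OF p'(1)] by blast
    then show ?case using p' by (intro bexI[of _ p'']) (auto simp: algebra_simps)
  qed
  have conv: "(\<lambda>n. (F ^^ n) (G p)) \<longlonglongrightarrow> 0" if p: "p \<in> D" for p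
  proof (rule tendstoI)
    fix e :: real assume "e > 0"
    then obtain R where R: "\<And>p. p \<in> D \<Longrightarrow> h p > R \<Longrightarrow> norm (G p) < e" using small by blast
    have "\<forall>\<^sub>F n in sequentially. h p + real n * \<delta> > R"
    proof -
      obtain m where m: "(R - h p) / \<delta> < real m" using reals_Archimedean2 by blast
      show ?thesis
        unfolding eventually_sequentially
      proof (intro exI[of _ m] allI impI)
        fix n assume "m \<le> n"
        then have "(R - h p) / \<delta> < real n" using m by simp
        then show "h p + real n * \<delta> > R" using \<delta> by (simp add: field_simps)
      qed
    qed
    then show "\<forall>\<^sub>F n in sequentially. dist ((F ^^ n) (G p)) 0 < e"
    proof eventually_elim
      case (elim n)
      obtain p' where "p' \<in> D" "(F ^^ n) (G p) = G p'" "h p + real n * \<delta> \<le> h p'" using orbit[OF p, of n] by blast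
      then show ?case using R[of p'] elim by simp
    qed
  qed
  \<comment> \<open>Off the basin the shape of \<open>\<Omega> R\<close> is irrelevant; inside it, a superlevel set of \<open>h\<close> is invariant.\<close>
  define \<Omega> where "\<Omega> = (\<lambda>R. G ` {p\<in>D. h p > R} \<union> ((W \<inter> ball 0 (1 / (R + 1))) - G ` D))"
  have \<Omega>U: "G ` D \<inter> \<Omega> R = G ` {p\<in>D. h p > R}" for R by (auto simp: \<Omega>_def)
  have "neighbourhood_basis_0 (\<Omega> ` {0<..})"
    unfolding neighbourhood_basis_0_def
  proof (intro conjI ballI allI impI)
    fix S assume "S \<in> \<Omega> ` {0<..}"
    then obtain R where R: "R > 0" "S = \<Omega> R" by auto
    obtain e where e: "e > 0" "\<And>p. p \<in> D \<Longrightarrow> norm (G p) < e \<Longrightarrow> h p > R" using large[of R] by blast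
    have "W \<inter> ball 0 (1 / (R + 1)) \<inter> ball 0 e \<subseteq> S"
      using e(2) by (auto simp: R \<Omega>_def)
    then show "0 \<in> interior S"
      using R(1) e(1) W by (intro interiorI[of "W \<inter> ball 0 (1 / (R + 1)) \<inter> ball 0 e"]) auto
  next
    fix V :: "C2 set" assume V: "open V \<and> 0 \<in> V"
    then obtain e where e: "e > 0" "ball 0 e \<subseteq> V" using openE by blast
    obtain R0 where R0: "\<And>p. p \<in> D \<Longrightarrow> h p > R0 \<Longrightarrow> norm (G p) < e" using small[OF e(1)] by blast
    define R where "R = max (max R0 1) (1 / e)"
    have R: "R > 0" "R \<ge> R0" "1 / (R + 1) \<le> e"
    proof -
      have "1 / e \<le> R + 1" by (simp add: R_def)
      then have "1 \<le> (R + 1) * e" using e(1) by (simp add: field_simps)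
      moreover have "R + 1 > 0" by (simp add: R_def add_pos_pos less_max_iff_disj)
      ultimately show "1 / (R + 1) \<le> e" by (simp add: field_simps)
    qed (auto simp: R_def)
    have "\<Omega> R \<subseteq> ball 0 e" using R0 R by (fastforce simp: \<Omega>_def)
    then show "\<exists>\<Omega>'\<in>\<Omega> ` {0<..}. \<Omega>' \<subseteq> V" using R(1) e(2) by blast
  qed
  moreover have "\<Omega> R \<subseteq> W \<and> F ` (G ` D \<inter> \<Omega> R) \<subseteq> G ` D \<inter> \<Omega> R \<and> (\<forall>x\<in>G ` D \<inter> \<Omega> R. (\<lambda>n. (F ^^ n) x) \<longlonglongrightarrow> 0)" for R
  proof (intro conjI ballI)
    show "\<Omega> R \<subseteq> W" using U(4) by (auto simp: \<Omega>_def)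
    show "F ` (G ` D \<inter> \<Omega> R) \<subseteq> G ` D \<inter> \<Omega> R"
      unfolding \<Omega>U
    proof (rule image_subsetI)
      fix x assume "x \<in> G ` {p \<in> D. R < h p}"
      then obtain p where p: "p \<in> D" "R < h p" "x = G p" by auto
      then obtain p' where "p' \<in> D" "F (G p) = G p'" "h p' > R" using step[of p] \<delta> by fastforce
      then show "F x \<in> G ` {p \<in> D. R < h p}" using p by auto
    qed
    fix x assume "x \<in> G ` D \<inter> \<Omega> R"
    then show "(\<lambda>n. (F ^^ n) x) \<longlonglongrightarrow> 0" using conv by auto
  qed
  moreover have "0 \<in> closure (G ` D)"
  proof -
    obtain p where p: "p \<in> D" using U(1) by blast
    have "(F ^^ n) (G p) \<in> G ` D" for n using orbit[OF p, of n] by auto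
    then show ?thesis unfolding closure_sequential using conv[OF p]
      by (intro exI[of _ "\<lambda>n. (F ^^ n) (G p)"]) auto
  qed
  ultimately show ?thesis
    unfolding basin_of_attraction_def using U by (intro conjI exI[of _ "\<Omega> ` {0<..}"]) auto
qed

section \<open>Attracting sectors\<close>

text \<open>In the coordinate \<open>z = \<gamma> v powr (- 1 / d)\<close>, the map \<open>z \<mapsto> z * (1 + s)\<close> with \<open>s\<close> close to
  \<open>- 1 / (d * v)\<close> is nearly the translation by \<open>1\<close>.\<close>

lemma fatou_coordinate_step:
  assumes d: "d \<ge> 1" and \<eta>: "\<eta> > 0" and K: "K \<ge> 0"
  obtains R where "R \<ge> 1" "\<And>v s. Re v > 0 \<Longrightarrow> norm v \<ge> R \<Longrightarrow> norm (s + 1 / (of_nat d * v)) \<le> K * norm v powr (- 1 - 1 / d) \<Longrightarrow>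
     \<exists>v'. norm (v' - v - 1) \<le> \<eta> \<and> exp (- Ln v' / of_nat d) = exp (- Ln v / of_nat d) * (1 + s)"
proof -
  \<comment> \<open>Half of \<open>\<eta>\<close> is granted to the linearisation error of
    \<open>(1 + s)^(-d)\<close>, half to the deviation of \<open>s\<close> from
    \<open>- 1 / (d * v)\<close>.\<close>
  define e where "e = \<eta> / (2 * (1 + K))"
  have e: "e > 0" using \<eta> K by (simp add: e_def)
  have "((\<lambda>s. inverse ((1 + s) ^ d)) has_field_derivative (- of_nat d)) (at (0::complex))"
    by (auto intro!: derivative_eq_intros)
  then obtain \<delta> where \<delta>: "\<delta> > 0" "\<And>s::complex. norm s < \<delta> \<Longrightarrow> norm (inverse ((1 + s) ^ d) - 1 + of_nat d * s) \<le> e * norm s"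
    using e unfolding has_field_derivative_def has_derivative_at_alt by fastforce
  \<comment> \<open>Bound for \<open>norm v powr (- (1 / d))\<close>. Its three entries ensure that
    \<open>norm s < \<delta>\<close>, that \<open>norm s \<le> 1 / (4 * d)\<close> for the branch of
    the logarithm, and that the second half of \<open>\<eta>\<close> suffices.\<close>
  define m where "m = Min {\<delta> / 2 / (1 + K), 1 / (4 * real d * (1 + K)), \<eta> / (2 * real d * (1 + K))}"
  have m: "m > 0" "m \<le> \<delta> / 2 / (1 + K)" "m \<le> 1 / (4 * real d * (1 + K))" "m \<le> \<eta> / (2 * real d * (1 + K))"
    using \<delta>(1) \<eta> K d by (auto simp: m_def)
  have "((\<lambda>\<rho>::real. \<rho> powr (- (1 / d))) \<longlongrightarrow> 0) at_top"
    using d by (intro tendsto_neg_powr filterlim_ident) auto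
  then have "\<forall>\<^sub>F \<rho> in at_top. \<rho> powr (- (1 / d)) < m" using m(1) by (rule order_tendstoD)
  then obtain R0 where R0: "\<And>\<rho>. \<rho> \<ge> R0 \<Longrightarrow> \<rho> powr (- (1 / d)) < m" unfolding eventually_at_top_linorder by blast
  define R where "R = max R0 1"
  have "\<exists>v'. norm (v' - v - 1) \<le> \<eta> \<and> exp (- Ln v' / of_nat d) = exp (- Ln v / of_nat d) * (1 + s)"
    if v: "Re v > 0" "norm v \<ge> R" and s: "norm (s + 1 / (of_nat d * v)) \<le> K * norm v powr (- 1 - 1 / d)" for v s
  proof -
    define \<rho> where "\<rho> = norm v"
    have \<rho>: "\<rho> \<ge> 1" "\<rho> \<ge> R0" using v by (auto simp: \<rho>_def R_def)
    have v0: "v \<noteq> 0" using v by auto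
    define q where "q = \<rho> powr (- (1 / d))"
    have q: "q < m" "q \<ge> 0" using R0[OF \<rho>(2)] by (auto simp: q_def)
    have "\<rho> powr (- 1) \<le> q" unfolding q_def using \<rho>(1) d by (intro powr_mono) (auto simp: field_simps)
    then have \<rho>q: "1 / \<rho> \<le> q" using \<rho> by (simp add: powr_minus_divide)
    have "\<rho> powr (- 1 - 1 / d) = \<rho> powr (-1) * \<rho> powr (- (1 / d))" by (subst powr_add[symmetric]) simp
    moreover have "\<rho> powr (-1) = 1 / \<rho>" using \<rho> by (simp add: powr_minus_divide)
    ultimately have "\<rho> powr (- 1 - 1 / d) = 1 / \<rho> * q" by (simp only: q_def)
    then have pw: "\<rho> powr (- 1 - 1 / d) = q / \<rho>" by simp
    have "q \<le> 1" unfolding q_def using \<rho>(1) d powr_mono[of "-(1/d)" 0 \<rho>] by auto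
    have ns: "norm s \<le> (1 + K) / \<rho>"
    proof -
      have "norm s \<le> norm (s + 1 / (of_nat d * v)) + norm (1 / (of_nat d * v))"
        using norm_triangle_ineq4[of "s + 1 / (of_nat d * v)" "1 / (of_nat d * v)"] by simp
      also have "norm (1 / (of_nat d * v)) = 1 / (real d * \<rho>)" by (simp add: norm_divide norm_mult \<rho>_def)
      also have "1 / (real d * \<rho>) \<le> 1 / \<rho>" using d \<rho> by (intro divide_left_mono) auto
      also have "norm (s + 1 / (of_nat d * v)) \<le> K * (q / \<rho>)" using s pw by (simp add: \<rho>_def)
      also have "\<dots> \<le> K * (1 / \<rho>)" using K \<rho> \<open>q \<le> 1\<close> by (intro mult_left_mono divide_right_mono) auto
      finally show ?thesis by (simp add: add_divide_distrib add.commute)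
    qed
    also have "(1 + K) / \<rho> = (1 + K) * (1 / \<rho>)" by simp
    also have "\<dots> \<le> (1 + K) * q" using K \<rho>q by (intro mult_left_mono) auto
    also have "\<dots> \<le> (1 + K) * m" using K q by (intro mult_left_mono) auto
    finally have sm: "norm s \<le> (1 + K) * m" .
    have "(1 + K) * m \<le> (1 + K) * (\<delta> / 2 / (1 + K))" using K m by (intro mult_left_mono) auto
    moreover have "(1 + K) * (X / (1 + K)) = X" for X using K by simp
    ultimately have s1: "norm s < \<delta>" using sm \<delta>(1) by (metis field_sum_of_halves less_add_same_cancel1 half_gt_zero order_le_less_trans)
    have "(1 + K) * m \<le> (1 + K) * (1 / (4 * real d * (1 + K)))" using K m by (intro mult_left_mono) auto
    then have s2: "norm s \<le> 1 / (4 * real d)" using sm K by simp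
    moreover have "1 / (4 * real d) < 1 / 2" using d by (simp add: field_simps)
    ultimately have s3: "norm s < 1 / 2" by linarith
    have s4: "1 + s \<noteq> 0"
    proof
      assume "1 + s = 0"
      then have "s = -1" by (simp add: add_eq_0_iff)
      then show False using s3 by simp
    qed
    define v' where "v' = exp (Ln v - of_nat d * Ln (1 + s))"
    have v': "v' = v * inverse ((1 + s) ^ d)"
      unfolding v'_def exp_diff using v0 s4 by (simp add: exp_of_nat_mult field_simps)
    \<comment> \<open>No branch jump: the argument of \<open>v\<close> is below
      \<open>pi / 2\<close> and \<open>d * Ln (1 + s)\<close> changes it by at most 1. The formula
      for \<open>z\<close> is therefore exact, not merely up to a root of unity.\<close>
    have LnL: "Ln v' = Ln v - of_nat d * Ln (1 + s)"
    proof -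
      have "norm (Ln (1 + s)) \<le> 2 * norm s" using s3 by (intro norm_Ln_le) auto
      then have "real d * norm (Ln (1 + s)) \<le> real d * (2 * (1 / (4 * real d)))" using s2 by (intro mult_left_mono) auto
      then have "real d * norm (Ln (1 + s)) \<le> 1" using d by simp
      moreover have "\<bar>Im (Ln (1 + s))\<bar> * real d \<le> norm (Ln (1 + s)) * real d"
        by (intro mult_right_mono abs_Im_le_cmod) auto
      ultimately have "\<bar>Im (of_nat d * Ln (1 + s))\<bar> \<le> 1" by (simp add: abs_mult mult.commute)
      moreover have "\<bar>Im (Ln v)\<bar> < pi / 2" using v v0 Re_Ln_pos_lt_imp by blast
      ultimately have "\<bar>Im (Ln v - of_nat d * Ln (1 + s))\<bar> < pi"
        using pi_gt3 by (simp only: minus_complex.sel)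
      then show ?thesis unfolding v'_def by (intro Ln_exp) auto
    qed
    have "exp (- Ln v' / of_nat d) = exp (- Ln v / of_nat d + Ln (1 + s))"
      unfolding LnL using d by (simp add: field_simps)
    then have ex: "exp (- Ln v' / of_nat d) = exp (- Ln v / of_nat d) * (1 + s)"
      by (simp only: exp_add exp_Ln[OF s4])
    have "v' - v - 1 = v * (inverse ((1 + s) ^ d) - 1 + of_nat d * s) - of_nat d * v * (s + 1 / (of_nat d * v))"
      unfolding v' using d v0 by (simp add: algebra_simps)
    then have "norm (v' - v - 1) \<le> \<rho> * norm (inverse ((1 + s) ^ d) - 1 + of_nat d * s) + real d * \<rho> * norm (s + 1 / (of_nat d * v))"
      using norm_triangle_ineq4[of "v * (inverse ((1 + s) ^ d) - 1 + of_nat d * s)" "of_nat d * v * (s + 1 / (of_nat d * v))"]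
      by (simp add: norm_mult \<rho>_def)
    also have "\<dots> \<le> \<rho> * (e * norm s) + real d * \<rho> * (K * (q / \<rho>))"
      using \<delta>(2)[OF s1] s pw \<rho> by (intro add_mono mult_left_mono) (auto simp: \<rho>_def)
    also have "\<dots> \<le> \<rho> * (e * ((1 + K) / \<rho>)) + real d * \<rho> * (K * (q / \<rho>))"
      using ns e \<rho> by (intro add_right_mono mult_left_mono) auto
    also have "\<dots> = e * (1 + K) + real d * K * q" using \<rho> by simp
    also have "\<dots> \<le> e * (1 + K) + real d * (1 + K) * m" using q K by (intro add_left_mono mult_mono) auto
    also have "\<dots> \<le> e * (1 + K) + real d * (1 + K) * (\<eta> / (2 * real d * (1 + K)))"
      using m K by (intro add_left_mono mult_left_mono) auto
    also have "\<dots> = \<eta>"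
    proof -
      have half: "X * (\<eta> / (2 * X)) = \<eta> / 2" if "X \<noteq> 0" for X using that by simp
      have "e * (1 + K) = \<eta> / 2" using half[of "1 + K"] K by (simp add: e_def mult.commute)
      moreover have "real d * (1 + K) * (\<eta> / (2 * real d * (1 + K))) = \<eta> / 2"
        using half[of "real d * (1 + K)"] K d by (simp add: mult.assoc)
      ultimately show ?thesis by simp
    qed
    finally show ?thesis using ex by blast
  qed
  then show thesis by (intro that[of R]) (auto simp: R_def)
qed

text \<open>In the cone \<open>Re v\<close> is at least \<open>4/5\<close> of \<open>norm v\<close>,
  and \<open>Im \<beta> * Im v\<close> costs at most a quarter of \<open>Re \<beta> * Re v\<close>;
  hence the constant \<open>3/5\<close>. The quadratic term comes from comparing the square of
  \<open>norm (1 - \<zeta>)\<close> with that of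
  \<open>1 - Re \<zeta> + (norm \<zeta>)^2\<close>.\<close>

lemma contraction_factor:
  assumes "Re v > 0" "\<bar>Im v\<bar> \<le> \<kappa> * Re v" "\<kappa> \<le> 1 / 4" "\<kappa> * \<bar>Im \<beta>\<bar> \<le> Re \<beta> / 4" "Re \<beta> > 0"
  shows "norm (1 - \<beta> / v) \<le> 1 - 3 / 5 * Re \<beta> / norm v + (norm \<beta> / norm v)\<^sup>2"
proof -
  define \<rho> where "\<rho> = norm v"
  have \<rho>: "\<rho> > 0" using assms by (auto simp: \<rho>_def)
  have "\<rho> \<le> \<bar>Re v\<bar> + \<bar>Im v\<bar>" unfolding \<rho>_def by (rule cmod_le)
  also have "\<dots> \<le> Re v + 1 / 4 * Re v"
    using assms(1,2) mult_right_mono[OF assms(3), of "Re v"] by linarith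
  finally have Rv: "4 / 5 * \<rho> \<le> Re v" by simp
  have "\<bar>Im \<beta>\<bar> * \<bar>Im v\<bar> \<le> \<bar>Im \<beta>\<bar> * (\<kappa> * Re v)" using assms by (intro mult_left_mono) auto
  also have "\<dots> = (\<kappa> * \<bar>Im \<beta>\<bar>) * Re v" by simp
  also have "\<dots> \<le> Re \<beta> / 4 * Re v" using assms by (intro mult_right_mono) auto
  finally have "Im \<beta> * Im v \<ge> - (Re \<beta> / 4 * Re v)"
    using abs_ge_minus_self[of "Im \<beta> * Im v"] by (simp add: abs_mult)
  then have "Re \<beta> * Re v + Im \<beta> * Im v \<ge> 3 / 4 * Re \<beta> * Re v" by simp
  moreover have "3 / 4 * Re \<beta> * (4 / 5 * \<rho>) \<le> 3 / 4 * Re \<beta> * Re v" using Rv assms by (intro mult_left_mono) auto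
  ultimately have "3 / 5 * Re \<beta> * \<rho> \<le> Re \<beta> * Re v + Im \<beta> * Im v" by (simp add: algebra_simps)
  then have "3 / 5 * Re \<beta> * \<rho> / \<rho>\<^sup>2 \<le> (Re \<beta> * Re v + Im \<beta> * Im v) / \<rho>\<^sup>2" by (intro divide_right_mono) auto
  also have "\<dots> = Re (\<beta> / v)" by (simp add: Re_divide \<rho>_def cmod_power2)
  finally have 1: "3 / 5 * Re \<beta> / \<rho> \<le> Re (\<beta> / v)" using \<rho> by (simp add: power2_eq_square)
  define \<zeta> where "\<zeta> = \<beta> / v"
  have "(norm (1 - \<zeta>))\<^sup>2 = 1 - 2 * Re \<zeta> + (norm \<zeta>)\<^sup>2"
    unfolding cmod_power2 by (simp add: power2_eq_square algebra_simps)
  also have "\<dots> \<le> (1 - Re \<zeta> + (norm \<zeta>)\<^sup>2)\<^sup>2"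
  proof -
    have a: "\<bar>Re \<zeta>\<bar> \<le> norm \<zeta>" by (rule abs_Re_le_cmod)
    have "(1 - Re \<zeta> + (norm \<zeta>)\<^sup>2)\<^sup>2 - (1 - 2 * Re \<zeta> + (norm \<zeta>)\<^sup>2) = (Re \<zeta> - (norm \<zeta>)\<^sup>2)\<^sup>2 + (norm \<zeta>)\<^sup>2"
      by (simp add: power2_eq_square algebra_simps)
    also have "\<dots> \<ge> 0" by simp
    finally show ?thesis by simp
  qed
  finally have sq: "(norm (1 - \<zeta>))\<^sup>2 \<le> (1 - Re \<zeta> + (norm \<zeta>)\<^sup>2)\<^sup>2" .
  have "0 \<le> 1 - Re \<zeta> + (norm \<zeta>)\<^sup>2"
  proof -
    have "Re \<zeta> \<le> norm \<zeta>" by (rule complex_Re_le_cmod)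
    moreover have "norm \<zeta> * 2 \<le> 1 + (norm \<zeta>)\<^sup>2"
      using zero_le_power2[of "norm \<zeta> - 1"] by (simp add: power2_eq_square algebra_simps)
    ultimately show ?thesis using norm_ge_zero[of \<zeta>] by linarith
  qed
  from power2_le_imp_le[OF sq this] 1 show ?thesis
    by (simp add: \<zeta>_def norm_divide \<rho>_def)
qed

text \<open>Bernoulli's inequality for a negative exponent, from \<open>ln (1 + x) \<le> x\<close>
  and \<open>1 + u \<le> exp u\<close>. It limits how fast the admissible size of \<open>w\<close>
  shrinks as \<open>norm v\<close> grows.\<close>

lemma powr_neg_growth:
  fixes \<rho> \<rho>' y \<sigma> :: real
  assumes "\<rho> > 0" "0 < \<rho>'" "\<rho>' \<le> \<rho> + y" "y \<ge> 0" "\<sigma> > 0"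
  shows "\<rho> powr (- \<sigma>) * (1 - \<sigma> * y / \<rho>) \<le> \<rho>' powr (- \<sigma>)"
proof -
  have "1 - \<sigma> * y / \<rho> \<le> 1 - \<sigma> * ln (1 + y / \<rho>)"
    using ln_add_one_self_le_self[of "y / \<rho>"] assms mult_left_mono[of "ln (1 + y / \<rho>)" "y / \<rho>" \<sigma>] by simp
  also have "\<dots> \<le> exp (- \<sigma> * ln (1 + y / \<rho>))"
    using exp_ge_add_one_self[of "- \<sigma> * ln (1 + y / \<rho>)"] by simp
  also have "\<dots> = (1 + y / \<rho>) powr (- \<sigma>)"
  proof -
    have "1 + y / \<rho> > 0" using assms by (intro add_pos_nonneg) auto
    then show ?thesis by (simp add: powr_def)
  qed
  finally have "\<rho> powr (- \<sigma>) * (1 - \<sigma> * y / \<rho>) \<le> \<rho> powr (- \<sigma>) * (1 + y / \<rho>) powr (- \<sigma>)"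
    by (intro mult_left_mono) auto
  also have "\<dots> = (\<rho> * (1 + y / \<rho>)) powr (- \<sigma>)" using assms by (subst powr_mult) auto
  also have "\<rho> * (1 + y / \<rho>) = \<rho> + y" using assms by (simp add: field_simps)
  also have "(\<rho> + y) powr (- \<sigma>) \<le> \<rho>' powr (- \<sigma>)" using assms by (intro powr_mono2') auto
  finally show ?thesis .
qed

text \<open>The exponential is the principal branch of \<open>v^(- 1 / d)\<close>. Scaling
  \<open>w\<close> by \<open>|v|^(- \<sigma>)\<close> straightens the shrinking region into a
  product with the unit disc in \<open>t\<close>.\<close>

definition chart :: "complex \<Rightarrow> nat \<Rightarrow> real \<Rightarrow> C2 \<Rightarrow> C2" where
  "chart \<gamma> d \<sigma> p = (\<gamma> * exp (- Ln (fst p) / of_nat d), snd p * of_real (norm (fst p) powr - \<sigma>))"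

lemma exp_neg_Ln_power:
  assumes "v \<noteq> 0" "d \<ge> 1"
  shows "exp (- Ln v / of_nat d) ^ d = 1 / v"
  using assms by (simp add: exp_of_nat_mult[symmetric] exp_minus field_simps)

lemma norm_exp_neg_Ln:
  assumes "v \<noteq> 0" "d \<ge> 1"
  shows "norm (exp (- Ln v / of_nat d)) = norm v powr - (1 / d)"
proof -
  have "Re (- Ln v / of_nat d) = - (1 / d) * ln (norm v)" using assms by (simp add: Re_divide_of_nat)
  then show ?thesis using assms unfolding norm_exp_eq_Re by (simp add: powr_def)
qed

lemma norm_chart_le:
  assumes "norm v \<ge> 1" "norm t \<le> 1" "s \<le> 1 / d" "s \<le> \<sigma>" "d \<ge> 1"
  shows "norm (chart \<gamma> d \<sigma> (v, t)) \<le> (norm \<gamma> + 1) * norm v powr - s"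
proof -
  have v: "v \<noteq> 0" using assms(1) by auto
  have "norm (chart \<gamma> d \<sigma> (v, t)) \<le> norm \<gamma> * norm v powr - (1 / d) + norm t * norm v powr - \<sigma>"
    unfolding chart_def fst_conv snd_conv
    by (rule order_trans[OF norm_Pair_le]) (simp only: norm_mult norm_exp_neg_Ln[OF v assms(5)] norm_of_real abs_of_nonneg powr_ge_zero order.refl)
  also have "\<dots> \<le> norm \<gamma> * norm v powr - s + 1 * norm v powr - s"
    using assms by (intro add_mono mult_mono powr_mono) auto
  finally show ?thesis by (simp add: distrib_right)
qed

text \<open>The \<open>d\<close>-th power of the first coordinate is \<open>\<gamma>^d / v\<close>,
  which is the same expression for every root and so determines \<open>v\<close>; the coordinate
  itself then determines \<open>\<gamma>\<close>. This is the source of the disjointness of the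
  basins.\<close>

lemma chart_inj:
  assumes "chart \<gamma> d \<sigma> p = chart \<gamma>' d \<sigma> p'" "fst p \<noteq> 0" "fst p' \<noteq> 0" "\<gamma> ^ d = \<gamma>' ^ d" "\<gamma> \<noteq> 0" "d \<ge> 1"
  shows "\<gamma> = \<gamma>'" "p = p'"
proof -
  have e: "\<gamma> * exp (- Ln (fst p) / of_nat d) = \<gamma>' * exp (- Ln (fst p') / of_nat d)"
    using assms(1) by (simp add: chart_def)
  then have "(\<gamma> * exp (- Ln (fst p) / of_nat d)) ^ d = (\<gamma>' * exp (- Ln (fst p') / of_nat d)) ^ d" by simp
  then have "\<gamma> ^ d / fst p = \<gamma> ^ d / fst p'"
    unfolding power_mult_distrib exp_neg_Ln_power[OF assms(2,6)] exp_neg_Ln_power[OF assms(3,6)]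
    by (simp only: assms(4) mult_1_right times_divide_eq_right)
  then have 1: "fst p = fst p'" using assms(2,3,5) by (simp add: frac_eq_eq)
  then show "\<gamma> = \<gamma>'" using e by simp
  have "snd p = snd p'" using assms(1,3) 1 by (simp add: chart_def)
  then show "p = p'" using 1 by (simp add: prod_eq_iff)
qed

text \<open>On the chart all points have size O(|v|^(- s)), so the condition on \<open>N\<close>
  makes the error O(|v|^(- 2 - \<sigma> - 2 / d)). This is small enough both relative to
  \<open>z\<close>, after division by a quantity of size \<open>|v|^(- 1 / d)\<close>, and against
  the bound \<open>|v|^(- \<sigma>)\<close> on \<open>w\<close>.\<close>

locale attracting_sector =
  fixes d N :: nat and a b l \<beta> :: complex and A B :: "complex \<Rightarrow> complex" and K C \<epsilon> \<delta> \<sigma> s \<kappa> :: real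
  assumes d: "d \<ge> 1" and a: "a \<noteq> 0" and l: "norm l = 1"
    and \<beta>: "\<beta> = b / (of_nat d * (l * a))" "Re \<beta> > 0"
    and \<sigma>: "\<sigma> = Re \<beta> / 4" and s: "s = min (1 / d) \<sigma>"
    and \<kappa>: "\<kappa> > 0" "\<kappa> \<le> 1 / 4" "\<kappa> * \<bar>Im \<beta>\<bar> \<le> Re \<beta> / 4"
    and N: "s * Suc N \<ge> 2 + \<sigma> + 2 / d"
    and A: "\<And>z. norm z < \<epsilon> \<Longrightarrow> norm (A z - a * z ^ Suc d) \<le> K * norm z ^ Suc (Suc d)"
    and B: "\<And>z. norm z < \<epsilon> \<Longrightarrow> norm (B z - b * z ^ d) \<le> K * norm z ^ Suc d"
    and pos: "K \<ge> 0" "C \<ge> 0" "\<epsilon> > 0" "\<delta> > 0"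
begin

lemma s_pos: "s > 0" and \<sigma>_pos: "\<sigma> > 0"
  using s \<sigma> \<beta>(2) d by auto

lemma step:
  assumes \<gamma>: "\<gamma> ^ d = - 1 / (of_nat d * a)" and \<eta>: "0 < \<eta>" "\<eta> \<le> 1"
  obtains R where "R \<ge> 1"
    "\<And>v t. Re v > 0 \<Longrightarrow> norm v \<ge> R \<Longrightarrow> \<bar>Im v\<bar> \<le> \<kappa> * Re v \<Longrightarrow> norm t < 1 \<Longrightarrow> norm (chart \<gamma> d \<sigma> (v, t)) < \<delta>"
    "\<And>v t x. Re v > 0 \<Longrightarrow> norm v \<ge> R \<Longrightarrow> \<bar>Im v\<bar> \<le> \<kappa> * Re v \<Longrightarrow> norm t < 1 \<Longrightarrow>
      (let y = chart \<gamma> d \<sigma> (v, t) in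
      norm (x - (fst y + A (fst y), (l + B (fst y)) * snd y)) \<le> C * norm y ^ Suc N) \<Longrightarrow>
      \<exists>v' t'. norm (v' - v - 1) \<le> \<eta> \<and> norm t' < 1 \<and> x = chart \<gamma> d \<sigma> (v', t')"
proof -
  have \<gamma>0: "\<gamma> \<noteq> 0" using \<gamma> a d by (auto simp: power_0_left)
  define c where "c = norm \<gamma>"
  have c: "c > 0" using \<gamma>0 by (simp add: c_def)
  define M where "M = C * (c + 1) ^ Suc N"
  have M: "M \<ge> 0" using pos c by (simp add: M_def)
  define K1 where "K1 = K * c ^ Suc d + M / c"
  have K1: "K1 \<ge> 0" using pos c M by (simp add: K1_def)
  \<comment> \<open>Collects the coefficients of everything beyond the main contraction of
    \<open>w\<close>: the square of \<open>\<beta> / v\<close>, the remainder of \<open>B\<close>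
    and the conjugation error.\<close>
  define L where "L = (norm \<beta>)\<^sup>2 + K * c ^ Suc d + M"
  have L: "L \<ge> 0" using pos c M by (simp add: L_def)
  obtain R0 where R0: "R0 \<ge> 1" "\<And>v s. Re v > 0 \<Longrightarrow> norm v \<ge> R0 \<Longrightarrow> norm (s + 1 / (of_nat d * v)) \<le> K1 * norm v powr (- 1 - 1 / d) \<Longrightarrow>
     \<exists>v'. norm (v' - v - 1) \<le> \<eta> \<and> exp (- Ln v' / of_nat d) = exp (- Ln v / of_nat d) * (1 + s)"
    using fatou_coordinate_step[OF d \<eta>(1) K1] by blast
  have lim: "((\<lambda>\<rho>::real. \<rho> powr (- (1 / d))) \<longlongrightarrow> 0) at_top" "((\<lambda>\<rho>::real. \<rho> powr (- s)) \<longlongrightarrow> 0) at_top"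
    using d s_pos by (intro tendsto_neg_powr filterlim_ident; simp)+
  \<comment> \<open>The first bound puts \<open>z\<close> into the disc where the expansions of
    \<open>A\<close> and \<open>B\<close> hold; the second makes the collected errors smaller than
    the margin between \<open>3/5\<close> and \<open>1/2\<close>.\<close>
  have "\<forall>\<^sub>F \<rho>::real in at_top. \<rho> powr (- (1 / d)) < min (\<epsilon> / c) (Re \<beta> / (20 * (L + 1)))"
    using c pos \<beta>(2) L by (intro order_tendstoD[OF lim(1)]) auto
  moreover have "\<forall>\<^sub>F \<rho>::real in at_top. \<rho> powr (- s) < \<delta> / (c + 1)"
    using c pos by (intro order_tendstoD[OF lim(2)]) auto
  ultimately have "\<forall>\<^sub>F \<rho>::real in at_top. \<rho> powr (- (1 / d)) < min (\<epsilon> / c) (Re \<beta> / (20 * (L + 1))) \<and> \<rho> powr (- s) < \<delta> / (c + 1)"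
    by (rule eventually_conj)
  then obtain R1 where R1: "\<And>\<rho>. \<rho> \<ge> R1 \<Longrightarrow> \<rho> powr (- (1 / d)) < min (\<epsilon> / c) (Re \<beta> / (20 * (L + 1)))" "\<And>\<rho>. \<rho> \<ge> R1 \<Longrightarrow> \<rho> powr (- s) < \<delta> / (c + 1)"
    unfolding eventually_at_top_linorder by blast
  define R where "R = max R0 R1"
  have small: "norm (chart \<gamma> d \<sigma> (v, t)) < \<delta>" if "norm v \<ge> R" "norm t < 1" for v t
  proof -
    have "norm (chart \<gamma> d \<sigma> (v, t)) \<le> (c + 1) * norm v powr - s"
      unfolding c_def using that R0(1) s d by (intro norm_chart_le) (auto simp: R_def)
    also have "\<dots> < (c + 1) * (\<delta> / (c + 1))"
      using that R1(2)[of "norm v"] c by (intro mult_strict_left_mono) (auto simp: R_def)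
    finally show ?thesis using c by simp
  qed
  have "\<exists>v' t'. norm (v' - v - 1) \<le> \<eta> \<and> norm t' < 1 \<and> x = chart \<gamma> d \<sigma> (v', t')"
    if v: "Re v > 0" "norm v \<ge> R" "\<bar>Im v\<bar> \<le> \<kappa> * Re v" and t: "norm t < 1" and y: "y = chart \<gamma> d \<sigma> (v, t)"
      and x: "norm (x - (fst y + A (fst y), (l + B (fst y)) * snd y)) \<le> C * norm y ^ Suc N" for v t x y
  proof -
    define \<rho> where "\<rho> = norm v"
    have v0: "v \<noteq> 0" using v by auto
    have \<rho>: "\<rho> \<ge> 1" "\<rho> \<ge> R0" "\<rho> \<ge> R1" using v R0(1) by (auto simp: \<rho>_def R_def)
    define q where "q = \<rho> powr (- (1 / d))"
    have q: "q > 0" "q < \<epsilon> / c" "q < Re \<beta> / (20 * (L + 1))" using R1(1)[OF \<rho>(3)] \<rho>(1) by (auto simp: q_def)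
    define p where "p = \<rho> powr (- 1 - 1 / d)"
    have "\<rho> powr (- 1 - 1 / d) = \<rho> powr (-1) * \<rho> powr (- (1 / d))" by (subst powr_add[symmetric]) simp
    moreover have "\<rho> powr (-1) = 1 / \<rho>" using \<rho> by (simp add: powr_minus_divide)
    ultimately have "p = 1 / \<rho> * q" by (simp only: q_def p_def)
    then have pq: "p = q / \<rho>" by simp
    define z where "z = fst y"
    define w where "w = snd y"
    have z: "z = \<gamma> * exp (- Ln v / of_nat d)" and w: "w = t * of_real (\<rho> powr - \<sigma>)"
      by (auto simp: z_def w_def y chart_def \<rho>_def)
    have z0: "z \<noteq> 0" using \<gamma>0 by (simp add: z)
    have nz: "norm z = c * q" unfolding z norm_mult norm_exp_neg_Ln[OF v0 d] by (simp add: c_def q_def \<rho>_def)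
    have z\<epsilon>: "norm z < \<epsilon>" using q c by (simp add: nz field_simps)
    have zd: "z ^ d = - 1 / (of_nat d * a) / v"
      unfolding z power_mult_distrib exp_neg_Ln_power[OF v0 d] \<gamma> by simp
    have azd: "a * z ^ d = - (1 / (of_nat d * v))" using a by (simp add: zd)
    have qd: "q ^ Suc d = p"
    proof -
      have "q ^ Suc d = \<rho> powr (- (1 / d) * real (Suc d))"
        unfolding q_def using \<rho> by (subst powr_powr[symmetric]) (simp add: powr_realpow del: of_nat_Suc)
      also have "- (1 / d) * real (Suc d) = - 1 - 1 / d" using d by (simp add: field_simps)
      finally show ?thesis by (simp add: p_def)
    qed
    have nzd: "norm z ^ Suc d = c ^ Suc d * p" unfolding nz power_mult_distrib qd by simp
    have err: "C * norm y ^ Suc N \<le> M * \<rho> powr (- (2 + \<sigma> + 2 / d))"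
    proof -
      have "norm y \<le> (c + 1) * \<rho> powr - s"
        unfolding c_def y \<rho>_def using \<rho>(1) s t d by (intro norm_chart_le) (auto simp: \<rho>_def)
      then have "norm y ^ Suc N \<le> ((c + 1) * \<rho> powr - s) ^ Suc N" by (intro power_mono) auto
      also have "\<dots> = (c + 1) ^ Suc N * (\<rho> powr - s) ^ Suc N" by (rule power_mult_distrib)
      also have "(\<rho> powr - s) ^ Suc N = \<rho> powr (- s * real (Suc N))"
        using \<rho> by (subst powr_powr[symmetric]) (simp add: powr_realpow del: of_nat_Suc)
      also have "(c + 1) ^ Suc N * \<rho> powr (- s * real (Suc N)) \<le> (c + 1) ^ Suc N * \<rho> powr (- (2 + \<sigma> + 2 / d))"
        using N c \<rho> by (intro mult_left_mono powr_mono) auto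
      finally show ?thesis using pos(2) unfolding M_def by (metis mult.assoc mult_left_mono)
    qed
    define e where "e = x - (z + A z, (l + B z) * w)"
    have ne: "norm e \<le> M * \<rho> powr (- (2 + \<sigma> + 2 / d))" using x err unfolding e_def z_def w_def by simp
    have x1: "fst x = z + A z + fst e" and x2: "snd x = (l + B z) * w + snd e" by (simp_all add: e_def)
    \<comment> \<open>The relative displacement of \<open>z\<close>: the first coordinate of
      \<open>x\<close> is \<open>z * (1 + s')\<close>, the form required for the step in the
      coordinate \<open>v\<close>.\<close>
    define s' where "s' = (A z + fst e) / z"
    have "s' + 1 / (of_nat d * v) = ((A z - a * z ^ Suc d) + fst e) / z"
    proof -
      have "1 / (of_nat d * v) = - (a * z ^ Suc d) / z" using azd z0 by simp
      then show ?thesis by (simp add: s'_def add_divide_distrib diff_divide_distrib)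
    qed
    then have "norm (s' + 1 / (of_nat d * v)) \<le> (norm (A z - a * z ^ Suc d) + norm (fst e)) / norm z"
      by (simp only: norm_divide) (intro divide_right_mono norm_triangle_ineq norm_ge_zero)
    also have "\<dots> \<le> (K * norm z ^ Suc (Suc d) + M * \<rho> powr (- (2 + \<sigma> + 2 / d))) / norm z"
      using A[OF z\<epsilon>] ne norm_fst_le_norm[of e] by (intro divide_right_mono add_mono) auto
    also have "\<dots> = K * norm z ^ Suc d + M * \<rho> powr (- (2 + \<sigma> + 2 / d)) / norm z"
      using z0 by (simp add: add_divide_distrib)
    also have "M * \<rho> powr (- (2 + \<sigma> + 2 / d)) / norm z = M / c * (\<rho> powr (- (2 + \<sigma> + 2 / d)) / q)"
      by (simp add: nz)
    also have "\<rho> powr (- (2 + \<sigma> + 2 / d)) / q = \<rho> powr (- (2 + \<sigma> + 1 / d))"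
      unfolding q_def by (subst powr_diff[symmetric]) (simp add: add_divide_distrib[symmetric] diff_divide_distrib[symmetric])
    also have "M / c * \<rho> powr (- (2 + \<sigma> + 1 / d)) \<le> M / c * p"
      unfolding p_def using \<rho> M c \<sigma>_pos by (intro mult_left_mono powr_mono) auto
    finally have "norm (s' + 1 / (of_nat d * v)) \<le> K1 * p"
      by (simp only: nzd K1_def distrib_right mult.assoc)
    then obtain v' where v': "norm (v' - v - 1) \<le> \<eta>" "exp (- Ln v' / of_nat d) = exp (- Ln v / of_nat d) * (1 + s')"
      using R0(2)[of v s'] v(1) \<rho>(2) unfolding p_def \<rho>_def by blast
    have xz: "fst x = \<gamma> * exp (- Ln v' / of_nat d)"
    proof -
      have "fst x = z * (1 + s')" using z0 by (simp add: x1 s'_def field_simps)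
      then show ?thesis unfolding v'(2) z by (simp only: mult.assoc)
    qed
    have "v' \<noteq> 0"
    proof
      assume "v' = 0"
      then have "norm (v + 1) \<le> 1" using v'(1) \<eta> by (metis add.commute diff_0 minus_diff_commute norm_minus_cancel order_trans diff_diff_eq minus_add_distrib)
      then show False using complex_Re_le_cmod[of "v + 1"] v(1) by simp
    qed
    \<comment> \<open>This crude growth by 2 is the source of the factor 2 in
      \<open>\<sigma> * 2 / \<rho>\<close>.\<close>
    have v'\<rho>: "norm v' \<le> \<rho> + 2"
    proof -
      have "norm v' \<le> norm (v' - v - 1) + norm (v + 1)" using norm_triangle_ineq[of "v' - v - 1" "v + 1"] by simp
      also have "norm (v + 1) \<le> \<rho> + 1" using norm_triangle_ineq[of v 1] by (simp add: \<rho>_def)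
      finally show ?thesis using v'(1) \<eta> by simp
    qed
    have grow: "\<rho> powr (- \<sigma>) * (1 - \<sigma> * 2 / \<rho>) \<le> norm v' powr (- \<sigma>)"
      using \<open>v' \<noteq> 0\<close> v'\<rho> \<rho> \<sigma>_pos by (intro powr_neg_growth) auto
    have bz: "b * z ^ d = - l * (\<beta> / v)"
    proof -
      have "l \<noteq> 0" using l by auto
      then have "b = of_nat d * (l * a) * \<beta>" using \<beta>(1) a d by simp
      then show ?thesis unfolding zd using a d v0 by (simp add: field_simps)
    qed
    have lB_eq: "l + B z = l * (1 - \<beta> / v) + (B z - b * z ^ d)" unfolding bz by (simp add: algebra_simps)
    have "norm (l + B z) \<le> norm (l * (1 - \<beta> / v)) + norm (B z - b * z ^ d)"
      unfolding lB_eq by (rule norm_triangle_ineq)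
    then have "norm (l + B z) \<le> norm (1 - \<beta> / v) + K * norm z ^ Suc d"
      using B[OF z\<epsilon>] l unfolding norm_mult by simp
    moreover have "norm (1 - \<beta> / v) \<le> 1 - 3 / 5 * Re \<beta> / \<rho> + (norm \<beta> / \<rho>)\<^sup>2"
      unfolding \<rho>_def using v \<kappa> \<beta>(2) by (intro contraction_factor[of v \<kappa>]) auto
    moreover have "(norm \<beta> / \<rho>)\<^sup>2 \<le> (norm \<beta>)\<^sup>2 * p"
    proof -
      have "\<rho> powr - 2 \<le> p" unfolding p_def using \<rho> d by (intro powr_mono) (auto simp: field_simps)
      moreover have "\<rho> powr - 2 = 1 / \<rho>\<^sup>2" using \<rho> by (simp add: powr_minus_divide powr_numeral)
      ultimately have "(norm \<beta>)\<^sup>2 * (1 / \<rho>\<^sup>2) \<le> (norm \<beta>)\<^sup>2 * p" by (intro mult_left_mono) auto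
      then show ?thesis by (simp add: power_divide)
    qed
    ultimately have lB: "norm (l + B z) \<le> 1 - 3 / 5 * Re \<beta> / \<rho> + ((norm \<beta>)\<^sup>2 + K * c ^ Suc d) * p"
      unfolding nzd by (simp only: distrib_right mult.assoc)
    have "norm (snd e) \<le> M * \<rho> powr (- (2 + \<sigma> + 2 / d))" using ne norm_snd_le_norm[of e] by simp
    also have "\<dots> \<le> M * \<rho> powr (- \<sigma> + (- 1 - 1 / d))"
    proof -
      have "0 \<le> 1 / real d" "2 / real d = 2 * (1 / real d)" by simp_all
      then have "- (2 + \<sigma> + 2 / d) \<le> - \<sigma> + (- 1 - 1 / d)" by linarith
      then show ?thesis using M \<rho> by (intro mult_left_mono powr_mono) auto
    qed
    also have "\<dots> = \<rho> powr - \<sigma> * (M * p)" unfolding powr_add p_def by simp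
    finally have e2: "norm (snd e) \<le> \<rho> powr - \<sigma> * (M * p)" .
    have nw: "norm w \<le> \<rho> powr - \<sigma>" unfolding w using t by (simp add: norm_mult mult_left_le_one_le)
    have "norm (snd x) \<le> norm (l + B z) * norm w + norm (snd e)"
      unfolding x2 norm_mult[symmetric] by (rule norm_triangle_ineq)
    also have "\<dots> \<le> (1 - 3 / 5 * Re \<beta> / \<rho> + ((norm \<beta>)\<^sup>2 + K * c ^ Suc d) * p) * \<rho> powr - \<sigma> + \<rho> powr - \<sigma> * (M * p)"
      using e2 nw lB order_trans[OF norm_ge_zero lB] by (intro add_mono mult_mono) auto
    also have "\<dots> = \<rho> powr - \<sigma> * (1 - 3 / 5 * Re \<beta> / \<rho> + L * p)"
      by (simp add: L_def algebra_simps)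
    also have "\<dots> < \<rho> powr (- \<sigma>) * (1 - \<sigma> * 2 / \<rho>)"
    proof -
      \<comment> \<open>With \<open>\<sigma> * 2 = Re \<beta> / 2\<close> the margin is
        \<open>3/5 - 1/2 = 1/10\<close> of \<open>Re \<beta> / \<rho>\<close>; the errors use at
        most half of it, which leaves the strict inequality.\<close>
      have "L * q \<le> (L + 1) * (Re \<beta> / (20 * (L + 1)))" using q L by (intro mult_mono) auto
      also have "\<dots> = Re \<beta> / 20"
      proof -
        have "Y * (Re \<beta> / (20 * Y)) = Re \<beta> / 20" if "Y \<noteq> 0" for Y using that by simp
        then show ?thesis using L by (metis add_nonneg_eq_0_iff zero_le_one zero_neq_one)
      qed
      finally have "L * q \<le> Re \<beta> / 20" .
      then have "L * q < 1 / 10 * Re \<beta>" using \<beta>(2) by simp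
      then have "L * q / \<rho> < 1 / 10 * Re \<beta> / \<rho>" using \<rho> by (intro divide_strict_right_mono) auto
      then have "1 - 3 / 5 * Re \<beta> / \<rho> + L * p < 1 - \<sigma> * 2 / \<rho>"
        unfolding \<sigma> pq by (simp add: field_simps)
      then show ?thesis using \<rho> by (intro mult_strict_left_mono) auto
    qed
    also have "\<dots> \<le> norm v' powr (- \<sigma>)" by (rule grow)
    finally have w': "norm (snd x) < norm v' powr - \<sigma>" .
    define t' where "t' = snd x / of_real (norm v' powr - \<sigma>)"
    have "norm t' < 1" unfolding t'_def using w' \<open>v' \<noteq> 0\<close> by (simp add: norm_divide)
    moreover have "x = chart \<gamma> d \<sigma> (v', t')"
      using xz \<open>v' \<noteq> 0\<close> by (simp add: chart_def t'_def prod_eq_iff)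
    ultimately show ?thesis using v'(1) by blast
  qed
  then show thesis using small R0(1) by (intro that[of R]) (auto simp: R_def Let_def)
qed


text \<open>The basin is parametrised injectively by a truncated cone in \<open>v\<close> times the
  unit disc in \<open>t\<close>: convexity gives connectedness, and \<open>Re v\<close> is the
  progress function. The inclusion in the conclusion retains the root \<open>\<gamma>\<close>, from
  which disjointness is later derived.\<close>

lemma ex_basin:
  fixes \<phi> F :: "C2 \<Rightarrow> C2" and W :: "C2 set" and r c :: real
  assumes \<gamma>: "\<gamma> ^ d = - 1 / (of_nat d * a)"
    and W: "open W" "0 \<in> W" "\<And>x. norm x < \<delta> \<Longrightarrow> \<phi> x \<in> W"
    and \<phi>: "continuous_on (ball 0 1) \<phi>" "\<phi> 0 = 0" and r: "\<delta> \<le> r" "r < 1" "c > 0"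
    and low: "\<And>x y. norm x \<le> r \<Longrightarrow> norm y \<le> r \<Longrightarrow> norm (x - y) \<le> c * norm (\<phi> x - \<phi> y)"
    and lift: "\<And>x. norm x < \<delta> \<Longrightarrow> \<exists>y. F (\<phi> x) = \<phi> y \<and>
       norm (y - (fst x + A (fst x), (l + B (fst x)) * snd x)) \<le> C * norm x ^ Suc N"
  shows "\<exists>U. connected U \<and> basin_of_attraction W F U \<and>
    U \<subseteq> \<phi> ` (ball 0 \<delta> \<inter> chart \<gamma> d \<sigma> ` {p. Re (fst p) > 0})"
proof -
  \<comment> \<open>In one step \<open>Im v\<close> changes by at most \<open>\<eta>\<close> while
    \<open>\<kappa> * Re v\<close> gains at least \<open>\<kappa> * (1 - \<eta>)\<close>. The cone
    is preserved when \<open>\<eta> * (1 + \<kappa>) \<le> \<kappa>\<close>, which this choice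
    grants.\<close>
  define \<eta> where "\<eta> = \<kappa> / 2"
  have \<eta>: "0 < \<eta>" "\<eta> \<le> 1" "\<eta> \<le> 1 / 2" using \<kappa> by (auto simp: \<eta>_def)
  have \<gamma>0: "\<gamma> \<noteq> 0" using \<gamma> a d by (auto simp: power_0_left)
  obtain R where R: "R \<ge> 1"
    "\<And>v t. Re v > 0 \<Longrightarrow> norm v \<ge> R \<Longrightarrow> \<bar>Im v\<bar> \<le> \<kappa> * Re v \<Longrightarrow> norm t < 1 \<Longrightarrow> norm (chart \<gamma> d \<sigma> (v, t)) < \<delta>"
    "\<And>v t x. Re v > 0 \<Longrightarrow> norm v \<ge> R \<Longrightarrow> \<bar>Im v\<bar> \<le> \<kappa> * Re v \<Longrightarrow> norm t < 1 \<Longrightarrow>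
      (let y = chart \<gamma> d \<sigma> (v, t) in
      norm (x - (fst y + A (fst y), (l + B (fst y)) * snd y)) \<le> C * norm y ^ Suc N) \<Longrightarrow>
      \<exists>v' t'. norm (v' - v - 1) \<le> \<eta> \<and> norm t' < 1 \<and> x = chart \<gamma> d \<sigma> (v', t')"
    using step[OF \<gamma> \<eta>(1,2)] by blast
  define V where "V = {v. Re v > R} \<inter> ({v. Im v < \<kappa> * Re v} \<inter> {v. - Im v < \<kappa> * Re v})"
  define D where "D = V \<times> ball (0::complex) 1"
  define G where "G = (\<lambda>p. \<phi> (chart \<gamma> d \<sigma> p))"
  have Dmem: "(v, t) \<in> D \<longleftrightarrow> Re v > R \<and> \<bar>Im v\<bar> < \<kappa> * Re v \<and> norm t < 1" for v t
    by (auto simp: D_def V_def)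
  have DR: "Re v > 0" "norm v \<ge> R" "\<bar>Im v\<bar> \<le> \<kappa> * Re v" "norm t < 1" if "(v, t) \<in> D" for v t
    using that R(1) complex_Re_le_cmod[of v] unfolding Dmem by auto
  have openD: "open D" unfolding D_def V_def
    by (intro open_Times open_Int open_ball open_Collect_less continuous_intros)
  have "convex D" unfolding D_def V_def
  proof (intro convex_Times convex_Int convex_ball)
    show "convex {v. Re v > R}" by (rule convex_halfspace_Re_gt)
    have "{v. Im v < \<kappa> * Re v} = {v. inner (Complex (-\<kappa>) 1) v < 0}" "{v. - Im v < \<kappa> * Re v} = {v. inner (Complex (-\<kappa>) (-1)) v < 0}"
      by (auto simp: inner_complex_def)
    then show "convex {v. Im v < \<kappa> * Re v}" "convex {v. - Im v < \<kappa> * Re v}"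
      by (simp_all add: convex_halfspace_lt)
  qed
  then have connD: "connected D" by (rule convex_connected)
  have small_chart: "norm (chart \<gamma> d \<sigma> p) < \<delta>" if "p \<in> D" for p
    using R(2)[of "fst p" "snd p"] DR[of "fst p" "snd p"] that by simp
  have "continuous_on D (chart \<gamma> d \<sigma>)"
  proof -
    have "fst p \<notin> \<real>\<^sub>\<le>\<^sub>0" "fst p \<noteq> 0" if "p \<in> D" for p
      using DR(1)[of "fst p" "snd p"] that by (auto simp: complex_nonpos_Reals_iff)
    then show ?thesis
      unfolding chart_def using d by (intro continuous_intros) auto
  qed
  then have contG: "continuous_on D G"
    unfolding G_def
    by (rule continuous_on_compose2[OF \<phi>(1)]) (use small_chart r in fastforce)
  have injG: "inj_on G D"
  proof (rule inj_onI)
    fix p p' assume p: "p \<in> D" "p' \<in> D" "G p = G p'"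
    have "norm (chart \<gamma> d \<sigma> p - chart \<gamma> d \<sigma> p') \<le> 0"
      using low[of "chart \<gamma> d \<sigma> p" "chart \<gamma> d \<sigma> p'"] p small_chart[of p] small_chart[of p'] r by (simp add: G_def)
    then have "chart \<gamma> d \<sigma> p = chart \<gamma> d \<sigma> p'" by simp
    moreover have "fst p \<noteq> 0" "fst p' \<noteq> 0"
      using DR(1)[of "fst p" "snd p"] DR(1)[of "fst p'" "snd p'"] p by auto
    ultimately show "p = p'" using chart_inj(2)[of \<gamma> d \<sigma> p \<gamma> p'] \<gamma>0 d by blast
  qed
  have "basin_of_attraction W F (G ` D)"
  proof (rule basin_of_attraction_image[where h = "\<lambda>p. Re (fst p)" and \<delta> = "1/2"])
    have "(of_real (R + 1), 0) \<in> D" using R(1) \<kappa> unfolding Dmem by simp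
    then show "D \<noteq> {}" by blast
    show "open (G ` D)" by (rule invariance_of_domain[OF contG openD injG])
    show "G ` D \<subseteq> W"
      unfolding G_def by (intro image_subsetI W(3) small_chart)
  next
    fix p assume p: "p \<in> D"
    obtain v t where vt: "p = (v, t)" by force
    note D = DR[OF p[unfolded vt]]
    obtain y where y: "F (G p) = \<phi> y"
      "norm (y - (fst (chart \<gamma> d \<sigma> p) + A (fst (chart \<gamma> d \<sigma> p)), (l + B (fst (chart \<gamma> d \<sigma> p))) * snd (chart \<gamma> d \<sigma> p))) \<le> C * norm (chart \<gamma> d \<sigma> p) ^ Suc N"
      using lift[OF small_chart[OF p]] unfolding G_def by blast
    obtain v' t' where v': "norm (v' - v - 1) \<le> \<eta>" "norm t' < 1" "y = chart \<gamma> d \<sigma> (v', t')"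
      using R(3)[OF D, of y] y(2) unfolding vt Let_def by blast
    have re: "\<bar>Re v' - Re v - 1\<bar> \<le> \<eta>" and im: "\<bar>Im v' - Im v\<bar> \<le> \<eta>"
      using abs_Re_le_cmod[of "v' - v - 1"] abs_Im_le_cmod[of "v' - v - 1"] v'(1) by auto
    have Re': "Re v' \<ge> Re v + 1 / 2" using re \<eta>(3) by linarith
    have "\<eta> * (1 + \<kappa>) \<le> \<kappa>"
    proof -
      have "\<kappa> / 2 * (1 + \<kappa>) \<le> \<kappa> / 2 * 2" using \<kappa> by (intro mult_left_mono) auto
      then show ?thesis by (simp add: \<eta>_def)
    qed
    moreover have "\<kappa> * (Re v + 1 - \<eta>) \<le> \<kappa> * Re v'" using re \<kappa> by (intro mult_left_mono) linarith+
    moreover have "\<bar>Im v\<bar> < \<kappa> * Re v" using p unfolding vt Dmem by blast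
    ultimately have "\<bar>Im v'\<bar> < \<kappa> * Re v'" using im by (simp add: algebra_simps)
    then have "(v', t') \<in> D" using Re' v'(2) p unfolding vt Dmem by simp
    then show "\<exists>p'\<in>D. F (G p) = G p' \<and> Re (fst p) + 1 / 2 \<le> Re (fst p')"
      using y(1) v'(3) Re' by (intro bexI[of _ "(v', t')"]) (auto simp: G_def vt)
  next
    fix e :: real assume e: "e > 0"
    have "isCont \<phi> 0" using \<phi>(1) by (simp add: continuous_on_eq_continuous_at)
    then have "(\<phi> \<longlongrightarrow> \<phi> 0) (nhds 0)" unfolding isCont_def tendsto_at_iff_tendsto_nhds .
    then have "\<forall>\<^sub>F x in nhds 0. dist (\<phi> x) (\<phi> 0) < e"
      using e by (rule tendstoD)
    then obtain \<delta>' where \<delta>': "\<delta>' > 0" "\<And>x. norm x < \<delta>' \<Longrightarrow> norm (\<phi> x) < e"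
      unfolding eventually_nhds_0_ball \<phi>(2) by auto
    have "((\<lambda>\<rho>::real. \<rho> powr (- s)) \<longlongrightarrow> 0) at_top"
      using s_pos by (intro tendsto_neg_powr filterlim_ident) simp
    moreover have "\<delta>' / (norm \<gamma> + 1) > 0" using \<delta>'(1) by (simp add: add_nonneg_pos)
    ultimately have "\<forall>\<^sub>F \<rho>::real in at_top. \<rho> powr (- s) < \<delta>' / (norm \<gamma> + 1)" by (rule order_tendstoD)
    then obtain S where S: "\<And>\<rho>. \<rho> \<ge> S \<Longrightarrow> \<rho> powr (- s) < \<delta>' / (norm \<gamma> + 1)" unfolding eventually_at_top_linorder by blast
    show "\<exists>R'. \<forall>p\<in>D. R' < Re (fst p) \<longrightarrow> norm (G p) < e"
    proof (intro exI[of _ S] ballI impI)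
      fix p assume p: "p \<in> D" "S < Re (fst p)"
      obtain v t where vt: "p = (v, t)" by force
      note D = DR[OF p(1)[unfolded vt]]
      have "norm (chart \<gamma> d \<sigma> (v, t)) \<le> (norm \<gamma> + 1) * norm v powr - s"
        using D R(1) s d by (intro norm_chart_le) auto
      also have "\<dots> < (norm \<gamma> + 1) * (\<delta>' / (norm \<gamma> + 1))"
        using S[of "norm v"] p(2) complex_Re_le_cmod[of v] by (intro mult_strict_left_mono) (auto simp: vt add_nonneg_pos)
      also have "\<dots> = \<delta>'" using norm_ge_zero[of \<gamma>] by (simp add: add_nonneg_eq_0_iff)
      finally show "norm (G p) < e" unfolding G_def vt by (rule \<delta>'(2))
    qed
  next
    fix R' :: real
    \<comment> \<open>In the cone \<open>norm v \<le> 2 * Re v\<close>, so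
      \<open>Re v \<le> S\<close> keeps \<open>z\<close> at least
      \<open>norm \<gamma> * (2 * S) powr - (1 / d)\<close> away from 0. Division by
      \<open>c\<close> transfers this to the image under \<open>\<phi>\<close>.\<close>
    define S where "S = max R' 1"
    define e where "e = norm \<gamma> * (2 * S) powr - (1 / d) / c"
    have "e > 0" using \<gamma>0 r(3) by (simp add: e_def S_def)
    moreover have "Re (fst p) > R'" if p: "p \<in> D" and e: "norm (G p) < e" for p
    proof (rule ccontr)
      assume "\<not> R' < Re (fst p)"
      obtain v t where vt: "p = (v, t)" by force
      note D = DR[OF p(1)[unfolded vt]]
      have v0: "v \<noteq> 0" using D(1) by auto
      have le: "Re v \<le> S" using \<open>\<not> R' < Re (fst p)\<close> by (simp add: vt S_def)
      have "norm v \<le> \<bar>Re v\<bar> + \<bar>Im v\<bar>" by (rule cmod_le)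
      also have "\<dots> \<le> Re v + 1 * Re v" using D(1) order_trans[OF D(3) mult_right_mono[of \<kappa> 1 "Re v"]] \<kappa> by simp
      also have "\<dots> \<le> 2 * S" using le by simp
      finally have "(2 * S) powr - (1 / d) \<le> norm v powr - (1 / d)" using v0 d by (intro powr_mono2') auto
      then have "norm \<gamma> * (2 * S) powr - (1 / d) \<le> norm \<gamma> * norm v powr - (1 / d)" by (intro mult_left_mono) auto
      also have "\<dots> = norm (fst (chart \<gamma> d \<sigma> (v, t)))"
        unfolding chart_def fst_conv norm_mult norm_exp_neg_Ln[OF v0 d] ..
      also have "\<dots> \<le> norm (chart \<gamma> d \<sigma> (v, t))" by (rule norm_fst_le_norm)
      also have "\<dots> \<le> c * norm (G p)"
        using low[of "chart \<gamma> d \<sigma> p" 0] small_chart[OF p] r \<phi>(2) small_chart[OF p, THEN order.strict_trans1[OF norm_ge_zero]]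
        by (simp add: G_def vt)
      finally have "e \<le> norm (G p)" using r(3) by (simp add: e_def field_simps)
      then show False using e by simp
    qed
    ultimately show "\<exists>e>0. \<forall>p\<in>D. norm (G p) < e \<longrightarrow> R' < Re (fst p)" by blast
  qed (use injG W in auto)
  moreover have "connected (G ` D)" by (rule connected_continuous_image[OF contG connD])
  moreover have "G ` D \<subseteq> \<phi> ` (ball 0 \<delta> \<inter> chart \<gamma> d \<sigma> ` {p. Re (fst p) > 0})"
  proof
    fix x assume "x \<in> G ` D"
    then obtain p where p: "p \<in> D" "x = \<phi> (chart \<gamma> d \<sigma> p)" by (auto simp: G_def)
    then show "x \<in> \<phi> ` (ball 0 \<delta> \<inter> chart \<gamma> d \<sigma> ` {p. Re (fst p) > 0})"
      using small_chart[OF p(1)] DR(1)[of "fst p" "snd p"] by (intro image_eqI[of _ _ "chart \<gamma> d \<sigma> p"]) auto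
  qed
  ultimately show ?thesis by blast
qed

end

section \<open>Basins of attraction\<close>

lemma coeff_order_enatD:
  assumes "coeff_order c = enat n"
  shows "c n \<noteq> 0" "\<And>j. j < n \<Longrightarrow> c j = 0"
proof -
  have ne: "{j. c j \<noteq> 0} \<noteq> {}"
  proof
    assume "{j. c j \<noteq> 0} = {}"
    then have "coeff_order c = top" unfolding coeff_order_def by simp
    then show False using assms by (simp add: top_enat_def)
  qed
  then have "enat ` {j. c j \<noteq> 0} \<noteq> {}" by simp
  then have "coeff_order c \<in> enat ` {j. c j \<noteq> 0}"
    unfolding coeff_order_def Inf_enat_def by (auto intro: LeastI)
  then show "c n \<noteq> 0" using assms by auto
  show "c j = 0" if "j < n" for j
  proof (rule ccontr)
    assume "c j \<noteq> 0"
    then have "coeff_order c \<le> enat j" unfolding coeff_order_def by (intro INF_lower) simp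
    then show False using assms that by simp
  qed
qed

text \<open>For finite orders the sign condition reads \<open>n - 1 \<le> k\<close> with
  \<open>k\<close> the order of \<open>b\<close>; for infinite order the sequence \<open>b\<close>
  is zero.\<close>

lemma Theta_nonpos_imp:
  assumes "coeff_order a = enat n" "Theta a b \<le> 0" "j < n - 1"
  shows "b j = 0"
proof (cases "coeff_order b")
  case (enat k)
  have "real n - real k - 1 \<le> 0" using assms(1,2) enat by (simp add: Theta_def one_ereal_def zero_ereal_def)
  then have "j < k" using assms(3) by linarith
  then show ?thesis using coeff_order_enatD(2)[OF enat] by simp
next
  case infinity
  show ?thesis
  proof (rule ccontr)
    assume "b j \<noteq> 0"
    then have "coeff_order b \<le> enat j" unfolding coeff_order_def by (intro INF_lower) simp
    then show False using infinity by simp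
  qed
qed

lemma norm_multiplier: "norm (multiplier \<theta>) = 1"
  by (simp add: multiplier_def norm_exp_eq_Re)

lemma multiplier_ne_1:
  assumes "\<theta> \<notin> \<rat>" shows "multiplier \<theta> \<noteq> 1"
proof
  assume "multiplier \<theta> = 1"
  then obtain n :: int where "2 * pi * \<theta> = of_int (2 * n) * pi" by (auto simp: multiplier_def exp_eq_1)
  then have "\<theta> = of_int n" by simp
  then show False using assms by simp
qed

theorem corollary6p3:
  fixes \<theta> :: real and W :: "C2 set" and F :: "C2 \<Rightarrow> C2"
    and a b :: "nat \<Rightarrow> complex" and \<nu> :: nat
  assumes "\<theta> \<notin> \<rat>"
    and "quasi_parabolic \<theta> W F"
    and "dynamically_separating \<theta> F"
    and "has_normal_form \<theta> F a b"
    and "coeff_order a = enat \<nu>"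
    and "Re (b (\<nu> - 1) / (multiplier \<theta> * a \<nu>)) > 0"
  shows "\<exists>U :: nat \<Rightarrow> C2 set.
           (\<forall>k<\<nu> - 1. connected (U k) \<and> basin_of_attraction W F (U k)) \<and>
           disjoint_family_on U {..<\<nu> - 1}"
proof -
  have F: "holomorphic2_on F W" "open W" "0 \<in> W"
    using assms(2) by (auto simp: quasi_parabolic_def holomorphic_diffeo_germ_def)
  note a\<nu> = coeff_order_enatD[OF assms(5)]
  have a01: "a j = 0" if "j < 2" for j using assms(4) that by (simp add: has_normal_form_def)
  have \<nu>2: "\<nu> \<ge> 2" using a\<nu>(1) a01 not_less by blast
  define d where "d = \<nu> - 1"
  have d: "d \<ge> 1" "\<nu> = Suc d" using \<nu>2 by (auto simp: d_def)
  define l where "l = multiplier \<theta>"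
  have l: "norm l = 1" by (simp add: l_def norm_multiplier)
  have b_low: "b j = 0" if "j < d" for j
  proof -
    obtain a' b' where nf': "has_normal_form \<theta> F a' b'" "coeff_order a' < \<infinity>" "Theta a' b' \<le> 0"
      using assms(3) unfolding dynamically_separating_def by blast
    obtain \<nu>' where \<nu>': "coeff_order a' = enat \<nu>'" using nf'(2) by (cases "coeff_order a'") auto
    show ?thesis
      by (rule normal_form_separating_invariant[OF assms(4) nf'(1) multiplier_ne_1[OF assms(1)]
            a\<nu>(2,1) coeff_order_enatD(2,1)[OF \<nu>'] Theta_nonpos_imp[OF \<nu>' nf'(3)]])
        (use that in \<open>auto simp: d_def\<close>)
  qed
  define \<beta> where "\<beta> = b d / (of_nat d * (l * a \<nu>))"
  have "0 < Re (b d / (l * a \<nu>))" using assms(6) unfolding d_def l_def .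
  moreover have "\<beta> = b d / (l * a \<nu>) / of_nat d" by (simp add: \<beta>_def)
  then have "Re \<beta> = Re (b d / (l * a \<nu>)) / real d" by (simp only: Re_divide_of_nat)
  ultimately have \<beta>: "Re \<beta> > 0" using d(1) by simp
  define \<sigma> where "\<sigma> = Re \<beta> / 4"
  define s where "s = min (1 / d) \<sigma>"
  have s: "s > 0" using \<beta> d by (simp add: s_def \<sigma>_def)
  \<comment> \<open>The summand 1 keeps the denominator positive for real
    \<open>\<beta>\<close>.\<close>
  define \<kappa> where "\<kappa> = min (1 / 4) (Re \<beta> / (4 * (\<bar>Im \<beta>\<bar> + 1)))"
  have \<kappa>: "\<kappa> > 0" "\<kappa> \<le> 1 / 4" "\<kappa> * \<bar>Im \<beta>\<bar> \<le> Re \<beta> / 4"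
  proof -
    show "\<kappa> > 0" using \<beta> by (auto simp: \<kappa>_def)
    show "\<kappa> \<le> 1 / 4" unfolding \<kappa>_def by (rule min.cobounded1)
    have "\<kappa> * \<bar>Im \<beta>\<bar> \<le> Re \<beta> / (4 * (\<bar>Im \<beta>\<bar> + 1)) * (\<bar>Im \<beta>\<bar> + 1)"
      using \<beta> by (intro mult_mono) (auto simp: \<kappa>_def)
    also have "\<dots> = Re \<beta> / 4" by (simp add: field_simps add_nonneg_eq_0_iff)
    finally show "\<kappa> * \<bar>Im \<beta>\<bar> \<le> Re \<beta> / 4" .
  qed
  obtain N0 where N0: "(2 + \<sigma> + 2 / d) / s < real N0" using reals_Archimedean2 by blast
  \<comment> \<open>\<open>N0\<close> provides the decay of the conjugation error;
    \<open>\<nu>\<close> keeps the leading terms of \<open>a\<close> and \<open>b\<close> inside the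
    truncation.\<close>
  define N where "N = max N0 \<nu>"
  have N: "N \<ge> 1" "\<nu> < Suc N" "d < N" using \<nu>2 by (auto simp: N_def d_def)
  have Ns: "s * Suc N \<ge> 2 + \<sigma> + 2 / d"
  proof -
    have "(2 + \<sigma> + 2 / d) / s < real (Suc N)" using N0 by (simp add: N_def)
    then show ?thesis using s by (simp add: field_simps)
  qed
  define A where "A = (\<lambda>z. \<Sum>i<Suc N. a i * z ^ i)"
  define B where "B = (\<lambda>z. \<Sum>i<N. b i * z ^ i)"
  obtain K1 where K1: "K1 > 0" "\<forall>\<^sub>F z in nhds 0. norm (A z - a \<nu> * z ^ \<nu>) \<le> K1 * norm z ^ Suc \<nu>"
    using polynomial_leading_term[OF a\<nu>(2) N(2)] unfolding A_def by (rule vanishesE) blast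
  obtain K2 where K2: "K2 > 0" "\<forall>\<^sub>F z in nhds 0. norm (B z - b d * z ^ d) \<le> K2 * norm z ^ Suc d"
    using polynomial_leading_term[OF b_low N(3)] unfolding B_def by (rule vanishesE) blast
  define K where "K = max K1 K2"
  from eventually_conj[OF K1(2) K2(2)] obtain \<epsilon> where \<epsilon>: "\<epsilon> > 0"
    "\<And>z. norm z < \<epsilon> \<Longrightarrow> norm (A z - a \<nu> * z ^ \<nu>) \<le> K1 * norm z ^ Suc \<nu> \<and> norm (B z - b d * z ^ d) \<le> K2 * norm z ^ Suc d"
    unfolding eventually_nhds_0_ball by blast
  obtain \<Phi> where \<Phi>: "formal_coordinate_change \<Phi>" "fcomp (taylor_map F) \<Phi> = fcomp \<Phi> (normal_form \<theta> a b)"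
    using assms(4) unfolding has_normal_form_def formally_conjugate_def by blast
  define \<phi> where "\<phi> = evm N \<Phi>"
  obtain r c C \<delta>0 where rc: "0 < r" "r < 1" "c > 0" "C > 0" "\<delta>0 > 0"
    "\<And>x y. norm x \<le> r \<Longrightarrow> norm y \<le> r \<Longrightarrow> norm (x - y) \<le> c * norm (\<phi> x - \<phi> y)"
    "\<And>x. norm x < \<delta>0 \<Longrightarrow> \<exists>y. norm y < r \<and> F (\<phi> x) = \<phi> y \<and> norm (y - evm N (normal_form \<theta> a b) x) \<le> C * norm x ^ Suc N"
    unfolding \<phi>_def
    by (rule local_lift[OF F \<Phi>(2,1) order_normal_form N(1)]) (use a01 in auto)
  have v\<phi>: "vanishes 1 \<phi>" unfolding \<phi>_def by (intro vanishes_evm order_coordinate_change \<Phi>)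
  then have "(\<phi> \<longlongrightarrow> 0) (nhds 0)" using vanishes_tendsto[of 0] by simp
  then have "\<forall>\<^sub>F x in nhds 0. \<phi> x \<in> W" using F by (auto dest: topological_tendstoD)
  then obtain \<delta>1 where \<delta>1: "\<delta>1 > 0" "\<And>x. norm x < \<delta>1 \<Longrightarrow> \<phi> x \<in> W" unfolding eventually_nhds_0_ball by blast
  \<comment> \<open>Within this radius \<open>\<phi>\<close> satisfies the lower Lipschitz bound,
    \<open>F\<close> lifts through \<open>\<phi>\<close>, and the values of \<open>\<phi>\<close>
    lie in \<open>W\<close>.\<close>
  define \<delta> where "\<delta> = min r (min \<delta>0 \<delta>1)"
  have \<delta>: "\<delta> > 0" "\<delta> \<le> r" "\<delta> \<le> \<delta>0" "\<delta> \<le> \<delta>1" using rc \<delta>1 by (auto simp: \<delta>_def)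
  interpret S: attracting_sector d N "a \<nu>" "b d" l \<beta> A B K C \<epsilon> \<delta> \<sigma> s \<kappa>
  proof
    show "norm (A z - a \<nu> * z ^ Suc d) \<le> K * norm z ^ Suc (Suc d)" if "norm z < \<epsilon>" for z
      using \<epsilon>(2)[OF that] d(2) mult_right_mono[of K1 K "norm z ^ Suc (Suc d)"] by (simp add: K_def)
    show "norm (B z - b d * z ^ d) \<le> K * norm z ^ Suc d" if "norm z < \<epsilon>" for z
      using \<epsilon>(2)[OF that] mult_right_mono[of K2 K "norm z ^ Suc d"] by (simp add: K_def)
  qed (use d a\<nu>(1) l \<beta> \<kappa> Ns K1 \<epsilon> \<delta> rc in \<open>auto simp: \<beta>_def \<sigma>_def s_def K_def\<close>)
  define \<omega> where "\<omega> = - 1 / (of_nat d * a \<nu>)"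
  have \<omega>: "\<omega> \<noteq> 0" using a\<nu>(1) d by (simp add: \<omega>_def)
  have ex: "\<exists>U. connected U \<and> basin_of_attraction W F U \<and>
      U \<subseteq> \<phi> ` (ball 0 \<delta> \<inter> chart \<gamma> d \<sigma> ` {p. Re (fst p) > 0})" if "\<gamma> ^ d = \<omega>" for \<gamma>
  proof (rule S.ex_basin[OF _ F(2,3) _ _ _ \<delta>(2) rc(2,3,6)])
    show "\<gamma> ^ d = - 1 / (of_nat d * a \<nu>)" using that by (simp add: \<omega>_def)
    show "continuous_on (ball 0 1) \<phi>" unfolding \<phi>_def by (rule lip_continuous_on[OF lip_evm])
    show "\<phi> 0 = 0" unfolding \<phi>_def using order_coordinate_change[OF \<Phi>(1)] by (simp add: evm_def ev_0 zero_prod_def[symmetric])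
    show "\<exists>y. F (\<phi> x) = \<phi> y \<and> norm (y - (fst x + A (fst x), (l + B (fst x)) * snd x)) \<le> C * norm x ^ Suc N"
      if "norm x < \<delta>" for x
      using rc(7)[of x] that \<delta>(3) unfolding evm_normal_form[OF N(1)] A_def B_def l_def by force
    show "\<phi> x \<in> W" if "norm x < \<delta>" for x using that \<delta>(4) by (intro \<delta>1(2)) simp
  qed
  \<comment> \<open>Each of the \<open>d\<close> distinct roots of \<open>\<omega>\<close> carries
    one basin; \<open>g\<close> numbers them.\<close>
  have "finite {\<gamma>. \<gamma> ^ d = \<omega>}" "card {\<gamma>. \<gamma> ^ d = \<omega>} = d"
    using card_nth_roots[OF \<omega>] finite_nth_roots[of d \<omega>] d by auto
  then obtain g where g: "bij_betw g {0..<d} {\<gamma>. \<gamma> ^ d = \<omega>}" using ex_bij_betw_nat_finite by metis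
  have "\<forall>k. \<exists>U. k < d \<longrightarrow> connected U \<and> basin_of_attraction W F U \<and>
      U \<subseteq> \<phi> ` (ball 0 \<delta> \<inter> chart (g k) d \<sigma> ` {p. Re (fst p) > 0})"
    using ex bij_betwE[OF g] by fastforce
  then obtain U where U: "\<And>k. k < d \<Longrightarrow> connected (U k)" "\<And>k. k < d \<Longrightarrow> basin_of_attraction W F (U k)"
    "\<And>k. k < d \<Longrightarrow> U k \<subseteq> \<phi> ` (ball 0 \<delta> \<inter> chart (g k) d \<sigma> ` {p. Re (fst p) > 0})"
    by metis
  have "disjoint_family_on U {..<d}"
    unfolding disjoint_family_on_def
  proof (intro ballI impI)
    fix j k assume jk: "j \<in> {..<d}" "k \<in> {..<d}" "j \<noteq> k"
    show "U j \<inter> U k = {}"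
    proof (rule ccontr)
      assume "U j \<inter> U k \<noteq> {}"
      then obtain x where x: "x \<in> U j" "x \<in> U k" by blast
      obtain p where p: "Re (fst p) > 0" "norm (chart (g j) d \<sigma> p) < \<delta>" "x = \<phi> (chart (g j) d \<sigma> p)"
        using U(3)[of j] x(1) jk by fastforce
      obtain p' where p': "Re (fst p') > 0" "norm (chart (g k) d \<sigma> p') < \<delta>" "x = \<phi> (chart (g k) d \<sigma> p')"
        using U(3)[of k] x(2) jk by fastforce
      \<comment> \<open>A common point has equal preimages under \<open>\<phi>\<close> because both
        lie in the ball of radius \<open>r\<close>, and equal chart values force equal
        roots.\<close>
      have "norm (chart (g j) d \<sigma> p - chart (g k) d \<sigma> p') \<le> 0"
        using rc(6)[of "chart (g j) d \<sigma> p" "chart (g k) d \<sigma> p'"] p p' \<delta>(2) by simp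
      then have "chart (g j) d \<sigma> p = chart (g k) d \<sigma> p'" by simp
      moreover have "g j ^ d = \<omega>" "g k ^ d = \<omega>" using bij_betwE[OF g] jk by auto
      moreover have "g j \<noteq> 0" using \<open>g j ^ d = \<omega>\<close> \<omega> d by (auto simp: power_0_left)
      ultimately have "g j = g k" using chart_inj(1)[of "g j" d \<sigma> p "g k" p'] p(1) p'(1) d(1) by fastforce
      then show False using bij_betw_imp_inj_on[OF g] jk by (auto dest: inj_onD)
    qed
  qed
  then show ?thesis using U unfolding d_def by blast
qed

end
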